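(* There exists $\varphi_{0}>0$ such that for every $\varphi\in\mathbb R$ with $\mathrm{dist}(\varphi,\tfrac{\pi}{2}\mathbb Z)\le\varphi_{0}$ the following hold for the family $U_{\omega}(\varphi)$: (1) $U_{\omega}(\varphi)$ has pure point spectrum for $\mathbb P$-almost every $\omega$; (2) for every $p\ge 0$ and every $\psi\in\ell^{2}(\mathbb Z^{2})$ of compact (finite) support, for $\mathbb P$-almost every $\omega$, \[\sup_{n\in\mathbb Z}\big\Vert\, |X|^{p}\,U_{\omega}(\varphi)^{n}\psi\big\Vert<\infty,\] where $|X|^{p}$ is the multiplication operator $|X|^{p}e_{\mu}=|\mu|^{p}e_{\mu}$, $|\mu|=(\mu_1^2+\mu_2^2)^{1/2}$; (3) there exist constants $c,g>0$ such that for all $\mu,\nu\in\mathbb Z^{2}$ \[\mathbb E\Big[\sup_{f\in C(\mathbb T),\ \|f\|_{\infty}\le 1}\big|\langle e_{\mu},f(U_{\omega}(\varphi))e_{\nu}\rangle\big|\Big]\le c\,e^{-g|\mu-\nu|},\] where $C(\mathbb T)$ denotes the complex-valued continuous functions on $\mathbb T$.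
   Context: Let $\{e_{\mu}\}_{\mu\in\mathbb Z^{2}}$ be the standard basis of $\ell^{2}(\mathbb Z^{2})$ and $\mathbb T=\{z\in\mathbb C:|z|=1\}$. Let $\Omega=\mathbb T^{\mathbb Z^{2}}$ with the product $\sigma$-algebra (generated by cylinder sets) and the probability measure $\mathbb P=\bigotimes_{\mu\in\mathbb Z^{2}}d\ell$, where $d\ell$ is normalized Lebesgue measure on $\mathbb T$; $\mathbb E$ denotes expectation. For $\omega\in\Omega$, $D_{\omega}$ is the diagonal unitary $D_{\omega}e_{\mu}=\omega_{\mu}e_{\mu}$. For $j,k\in\mathbb Z$, let $S_{\circlearrowleft}$ be the unitary which permutes cyclically the basis vectors $e_{(2j,2k)}\mapsto e_{(2j+1,2k)}\mapsto e_{(2j+1,2k+1)}\mapsto e_{(2j,2k+1)}\mapsto e_{(2j,2k)}$ (for all $j,k$), and $S_{\circlearrowright}$ the unitary which permutes cyclically $e_{(2j,2k)}\mapsto e_{(2j,2k-1)}\mapsto e_{(2j-1,2k-1)}\mapsto e_{(2j-1,2k)}\mapsto e_{(2j,2k)}$ (for all $j,k$). For $\varphi\in\mathbb R$ set $S(\varphi)=\cos\varphi\,S_{\circlearrowleft}+i\sin\varphi\,S_{\circlearrowright}$ and $U_{\omega}(\varphi)=D_{\omega}S(\varphi)$ on $\ell^{2}(\mathbb Z^{2})$ (the Chalker–Coddington model). *)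

theory Defs
  imports "HOL-Probability.Probability"
begin

type_synonym site = "int \<times> int"
type_synonym vec = "site \<Rightarrow> complex"   (* vectors in C^(Z^2); l^2 membership is asserted separately *)

definition znorm :: "site \<Rightarrow> real" where
  "znorm \<mu> = sqrt (real_of_int (fst \<mu>)^2 + real_of_int (snd \<mu>)^2)"

definition ebasis :: "site \<Rightarrow> vec" where
  "ebasis \<mu> = (\<lambda>\<nu>. if \<nu> = \<mu> then 1 else 0)"

definition ell2 :: "vec \<Rightarrow> bool" where
  "ell2 \<psi> \<longleftrightarrow> (\<lambda>\<mu>. (cmod (\<psi> \<mu>))^2) summable_on UNIV"

definition l2norm :: "vec \<Rightarrow> real" where
  "l2norm \<psi> = sqrt (infsum (\<lambda>\<mu>. (cmod (\<psi> \<mu>))^2) UNIV)"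

text \<open>Cyclic permutations of sites. fwdL is the permutation along which S_ccw moves
  basis vectors (S_ccw e_mu = e_(fwdL mu)); bwdL is its inverse. Similarly fwdR/bwdR for S_cw.\<close>
definition fwdL :: "site \<Rightarrow> site" where
  "fwdL = (\<lambda>(a,b). if even a \<and> even b then (a+1,b) else if odd a \<and> even b then (a,b+1)
                   else if odd a \<and> odd b then (a-1,b) else (a,b-1))"
definition bwdL :: "site \<Rightarrow> site" where
  "bwdL = (\<lambda>(a,b). if odd a \<and> even b then (a-1,b) else if odd a \<and> odd b then (a,b-1)
                   else if even a \<and> odd b then (a+1,b) else (a,b+1))"
definition fwdR :: "site \<Rightarrow> site" where
  "fwdR = (\<lambda>(a,b). if even a \<and> even b then (a,b-1) else if even a \<and> odd b then (a-1,b)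
                   else if odd a \<and> odd b then (a,b+1) else (a+1,b))"
definition bwdR :: "site \<Rightarrow> site" where
  "bwdR = (\<lambda>(a,b). if even a \<and> odd b then (a,b+1) else if odd a \<and> odd b then (a+1,b)
                   else if odd a \<and> even b then (a,b-1) else (a-1,b))"

text \<open>S(phi) = cos phi S_ccw + i sin phi S_cw, and its adjoint.
  (S_ccw psi)(mu) = psi(bwdL mu), (S_ccw^* psi)(mu) = psi(fwdL mu).\<close>
definition Sop :: "real \<Rightarrow> vec \<Rightarrow> vec" where
  "Sop \<phi> \<psi> = (\<lambda>\<mu>. complex_of_real (cos \<phi>) * \<psi> (bwdL \<mu>) + \<i> * complex_of_real (sin \<phi>) * \<psi> (bwdR \<mu>))"
definition Sadj :: "real \<Rightarrow> vec \<Rightarrow> vec" where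
  "Sadj \<phi> \<psi> = (\<lambda>\<mu>. complex_of_real (cos \<phi>) * \<psi> (fwdL \<mu>) - \<i> * complex_of_real (sin \<phi>) * \<psi> (fwdR \<mu>))"

definition CCop :: "vec \<Rightarrow> real \<Rightarrow> vec \<Rightarrow> vec" where
  "CCop \<omega> \<phi> \<psi> = (\<lambda>\<mu>. \<omega> \<mu> * Sop \<phi> \<psi> \<mu>)"
definition CCadj :: "vec \<Rightarrow> real \<Rightarrow> vec \<Rightarrow> vec" where
  "CCadj \<omega> \<phi> \<psi> = Sadj \<phi> (\<lambda>\<mu>. cnj (\<omega> \<mu>) * \<psi> \<mu>)"

text \<open>Integer powers U^n (U^(-1) = U^*).\<close>
definition CCpow :: "vec \<Rightarrow> real \<Rightarrow> int \<Rightarrow> vec \<Rightarrow> vec" where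
  "CCpow \<omega> \<phi> n = (if 0 \<le> n then CCop \<omega> \<phi> ^^ nat n else CCadj \<omega> \<phi> ^^ nat (- n))"

definition eigvec :: "(vec \<Rightarrow> vec) \<Rightarrow> vec \<Rightarrow> bool" where
  "eigvec U v \<longleftrightarrow> ell2 v \<and> v \<noteq> (\<lambda>_. 0) \<and> (\<exists>ev. U v = (\<lambda>\<mu>. ev * v \<mu>))"

definition pure_point :: "(vec \<Rightarrow> vec) \<Rightarrow> bool" where
  "pure_point U \<longleftrightarrow> (\<forall>\<psi>. ell2 \<psi> \<longrightarrow> (\<forall>\<epsilon>>0. \<exists>F c. finite F \<and> (\<forall>v\<in>F. eigvec U v) \<and>
       l2norm (\<lambda>\<mu>. \<psi> \<mu> - (\<Sum>v\<in>F. c v * v \<mu>)) < \<epsilon>))"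

definition circle :: "complex set" where
  "circle = {z. cmod z = 1}"

definition circ_measure :: "complex measure" where
  "circ_measure = distr (uniform_measure lborel {0..<2*pi}) borel cis"

definition Pmeas :: "vec measure" where
  "Pmeas = PiM UNIV (\<lambda>_::site. circ_measure)"

text \<open>Continuous functional calculus matrix element <e_mu, f(U) e_nu>: the limit of the matrix
  elements of p_n(U) for any sequence of Laurent polynomials p_n converging uniformly to f on T.\<close>
definition fcalc_entry :: "vec \<Rightarrow> real \<Rightarrow> (complex \<Rightarrow> complex) \<Rightarrow> site \<Rightarrow> site \<Rightarrow> complex" where
  "fcalc_entry \<omega> \<phi> f \<mu> \<nu> = (THE z. \<forall>a :: nat \<Rightarrow> int \<Rightarrow> complex.
      ((\<forall>n. finite {k. a n k \<noteq> 0}) \<and>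
       uniform_limit circle (\<lambda>n x. \<Sum>k\<in>{k. a n k \<noteq> 0}. a n k * x powi k) f sequentially)
      \<longrightarrow> (\<lambda>n. \<Sum>k\<in>{k. a n k \<noteq> 0}. a n k * CCpow \<omega> \<phi> k (ebasis \<nu>) \<mu>) \<longlonglongrightarrow> z)"

definition xweight :: "real \<Rightarrow> site \<Rightarrow> real" where
  "xweight p \<mu> = (if p = 0 then 1 else znorm \<mu> powr p)"

end

theory Submission
  imports Defs "HOL-Complex_Analysis.Great_Picard"
begin

text \<open>
  Close to a multiple of \<open>\<pi> / 2\<close> the product \<open>sin \<phi> cos \<phi>\<close> is small and the walk is almost a
  permutation with cycles of length four. Let \<open>G\<close> be the resolvent inside the disc. Isolating the
  phase \<open>w\<close> at one site gives \<open>G = x / (1 - a w)\<close>, where \<open>x\<close> and \<open>a\<close> come from the model with that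
  site removed. Averaging \<open>\<bar>G\<bar>\<^bsup>1/2\<^esup>\<close> over \<open>w\<close> costs a constant factor and leaves a recursion along
  self-avoiding paths. Four consecutive moves of the same kind return to a removed site, so every
  four steps gain a factor \<open>\<bar>sin \<phi> cos \<phi>\<bar>\<^bsup>1/2\<^esup>\<close>, and the fractional moments decay exponentially.

  The mean of \<open>(1 - \<bar>z\<bar>\<^sup>2) \<bar>G\<bar>\<^sup>2\<close> over \<open>w\<close> is governed by the Poisson kernel, whose mean
  \<open>1 / (1 - \<bar>a\<bar>\<^sup>2)\<close> compensates the energy of \<open>x\<close>. Hence second moments decay as well, uniformly up
  to the circle, and by Fatou so does the expected eigenfunction correlator, which dominates the
  matrix entries of all Laurent polynomials of the operator. Functions follow by Stone--Weierstrass
  and moments of the position by summation.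

  For pure point spectrum, a vector orthogonal to all eigenvectors has averages
  \<open>(1/N) \<Sum> x\<^bsup>-n\<^esup> U\<^sup>n f\<close> that become small uniformly on the circle. By Wiener's lemma and von Neumann's
  inequality its orbit leaves every finite set in the mean, but the correlator makes it tight.
\<close>

text \<open>The exponent 1/2 serves two purposes. The mean of 1 / |1 - a w| diverges as |a| tends to
  1, while that of its square root stays below \<open>sqrt 2\<close>; and the square root is
  subadditive, so it passes through the expansion over neighbours. The phase at a site can be
  averaged only if \<open>x\<close> and \<open>a\<close> do not depend on it, which forces the
  removal of the site. Removal is encoded as phase 0 and the spectral parameter is multiplied into
  the phases, so that \<open>S\<close> stays unitary and all reduced models are of one type.

  Four steps cost 7 * (sqrt 2)^4 = 28, hence the threshold 1/56, at which a round of four steps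
  contracts by 1/2. The trivial bound by 1 / (1 - |z|) only supplies finiteness and a starting
  value; iteration removes it.

  For pure point spectrum, near-minimisers of a distance replace the orthogonal projection onto the
  eigenvectors. Orthogonality is then approximate, with an error that must be small in terms of the
  cardinality of the finite set holding the orbit. This set must therefore be fixed before the
  error.\<close>

section \<open>The two families of four-cycles\<close>

lemmas step_defs = fwdL_def bwdL_def fwdR_def bwdR_def

lemma step_inverses [simp]:
  "bwdL (fwdL \<mu>) = \<mu>" "fwdL (bwdL \<mu>) = \<mu>" "bwdR (fwdR \<mu>) = \<mu>" "fwdR (bwdR \<mu>) = \<mu>"
  by (cases \<mu>; simp add: step_defs)+

lemma bij_steps: "bij fwdL" "bij bwdL" "bij fwdR" "bij bwdR"
  by (rule bij_betw_byWitness[where f'=bwdL], simp_all)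
     (rule bij_betw_byWitness[where f'=fwdL], simp_all,
      rule bij_betw_byWitness[where f'=bwdR], simp_all,
      rule bij_betw_byWitness[where f'=fwdR], simp_all)

lemma step_eq_iff:
  "bwdL \<mu> = \<nu> \<longleftrightarrow> \<mu> = fwdL \<nu>" "bwdR \<mu> = \<nu> \<longleftrightarrow> \<mu> = fwdR \<nu>"
  by (metis step_inverses)+

text \<open>In the products of \<open>Sop\<close> and \<open>Sadj\<close> the cross terms carry +i
  sin cos and -i sin cos. Here they are seen to sit at the same site, so they cancel: this is the
  unitarity of the walk.\<close>

lemma step_commute: "bwdR (fwdL \<mu>) = bwdL (fwdR \<mu>)" "fwdR (bwdL \<mu>) = fwdL (bwdR \<mu>)"
  by (cases \<mu>; simp add: step_defs)+

lemma step_four: "fwdL (fwdL (fwdL (fwdL \<mu>))) = \<mu>" "fwdR (fwdR (fwdR (fwdR \<mu>))) = \<mu>"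
  by (cases \<mu>; simp add: step_defs)+

subsection \<open>Square-summable vectors\<close>

text \<open>\<open>infsum\<close> is 0 by convention on non-summable families, so a bound on
  \<open>l2norm\<close> means nothing without membership. Bounds on finite sums deliver both
  together.\<close>

lemma ell2I:
  assumes "\<And>B. finite B \<Longrightarrow> (\<Sum>\<mu>\<in>B. (cmod (f \<mu>))\<^sup>2) \<le> C"
  shows "ell2 f" "(l2norm f)\<^sup>2 \<le> C"
proof -
  show *: "ell2 f" unfolding ell2_def
    by (rule nonneg_bdd_above_summable_on) (auto simp: bdd_above_def intro!: assms)
  have "infsum (\<lambda>\<mu>. (cmod (f \<mu>))\<^sup>2) UNIV \<le> C"
    using * unfolding ell2_def by (rule infsum_le_finite_sums) (simp add: assms)
  then show "(l2norm f)\<^sup>2 \<le> C"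
    unfolding l2norm_def by (simp add: infsum_nonneg)
qed

lemma l2norm_nonneg [simp]: "0 \<le> l2norm f"
  unfolding l2norm_def by (simp add: infsum_nonneg)

lemma l2norm_power2: "(l2norm f)\<^sup>2 = infsum (\<lambda>\<mu>. (cmod (f \<mu>))\<^sup>2) UNIV"
  unfolding l2norm_def by (simp add: infsum_nonneg)

lemma sum_le_l2norm: "ell2 f \<Longrightarrow> finite B \<Longrightarrow> (\<Sum>\<mu>\<in>B. (cmod (f \<mu>))\<^sup>2) \<le> (l2norm f)\<^sup>2"
  unfolding l2norm_power2 ell2_def by (rule finite_sum_le_infsum) auto

lemma L2_set_le_l2norm: "ell2 f \<Longrightarrow> finite B \<Longrightarrow> L2_set (\<lambda>\<mu>. cmod (f \<mu>)) B \<le> l2norm f"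
  unfolding L2_set_def by (rule real_le_lsqrt) (auto intro: sum_nonneg sum_le_l2norm)

lemma ell2_L2_setI:
  assumes "\<And>B. finite B \<Longrightarrow> L2_set (\<lambda>\<mu>. cmod (f \<mu>)) B \<le> C"
  shows "ell2 f" "l2norm f \<le> C"
proof -
  have C: "0 \<le> C" using assms[of "{}"] by simp
  have *: "(\<Sum>\<mu>\<in>B. (cmod (f \<mu>))\<^sup>2) \<le> C\<^sup>2" if "finite B" for B
    using power_mono[OF assms[OF that], of 2] by (simp add: L2_set_def sum_nonneg)
  show "ell2 f" by (rule ell2I(1)[OF *])
  show "l2norm f \<le> C" using power2_le_imp_le[OF ell2I(2)[OF *] C] by simp
qed

lemma cmod_le_l2norm: "ell2 f \<Longrightarrow> cmod (f \<mu>) \<le> l2norm f"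
  using power2_le_imp_le[of "cmod (f \<mu>)" "l2norm f"] sum_le_l2norm[of f "{\<mu>}"] by simp

lemma
  assumes fg: "ell2 f" "ell2 g"
  shows ell2_add: "ell2 (\<lambda>\<mu>. f \<mu> + g \<mu>)"
    and l2norm_add: "l2norm (\<lambda>\<mu>. f \<mu> + g \<mu>) \<le> l2norm f + l2norm g"
proof -
  have *: "L2_set (\<lambda>\<mu>. cmod (f \<mu> + g \<mu>)) B \<le> l2norm f + l2norm g" if B: "finite B" for B
  proof -
    have "L2_set (\<lambda>\<mu>. cmod (f \<mu> + g \<mu>)) B \<le> L2_set (\<lambda>\<mu>. cmod (f \<mu>) + cmod (g \<mu>)) B"
      by (rule L2_set_mono) (auto intro: norm_triangle_ineq)
    also have "\<dots> \<le> L2_set (\<lambda>\<mu>. cmod (f \<mu>)) B + L2_set (\<lambda>\<mu>. cmod (g \<mu>)) B"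
      by (rule L2_set_triangle_ineq)
    finally show ?thesis
      using L2_set_le_l2norm[OF fg(1) B] L2_set_le_l2norm[OF fg(2) B] by linarith
  qed
  show "ell2 (\<lambda>\<mu>. f \<mu> + g \<mu>)" by (rule ell2_L2_setI(1)[OF *])
  show "l2norm (\<lambda>\<mu>. f \<mu> + g \<mu>) \<le> l2norm f + l2norm g" by (rule ell2_L2_setI(2)[OF *])
qed

lemma ell2_scale: "ell2 f \<Longrightarrow> ell2 (\<lambda>\<mu>. a * f \<mu>)"
  using summable_on_cmult_right[of "\<lambda>\<mu>. (cmod (f \<mu>))\<^sup>2" UNIV "(cmod a)\<^sup>2"]
  by (simp add: ell2_def norm_mult power_mult_distrib)

lemma l2norm_scale: "l2norm (\<lambda>\<mu>. a * f \<mu>) = cmod a * l2norm f"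
  using infsum_cmult_right'[of "(cmod a)\<^sup>2" "\<lambda>\<mu>. (cmod (f \<mu>))\<^sup>2" UNIV]
  by (simp add: l2norm_def norm_mult power_mult_distrib real_sqrt_mult)

lemma ell2_zero [simp]: "ell2 (\<lambda>_. 0)" and l2norm_zero [simp]: "l2norm (\<lambda>_. 0) = 0"
  by (auto simp: ell2_def l2norm_def)

lemma ell2_diff: "ell2 f \<Longrightarrow> ell2 g \<Longrightarrow> ell2 (\<lambda>\<mu>. f \<mu> - g \<mu>)"
  using ell2_add[of f "\<lambda>\<mu>. (-1) * g \<mu>"] ell2_scale[of g "-1"] by simp

lemma ell2_sum: "(\<And>i. i \<in> I \<Longrightarrow> ell2 (f i)) \<Longrightarrow> ell2 (\<lambda>\<mu>. \<Sum>i\<in>I. f i \<mu>)"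
  by (induction I rule: infinite_finite_induct) (auto intro: ell2_add)

lemma l2norm_sum:
  "(\<And>i. i \<in> I \<Longrightarrow> ell2 (f i)) \<Longrightarrow> l2norm (\<lambda>\<mu>. \<Sum>i\<in>I. f i \<mu>) \<le> (\<Sum>i\<in>I. l2norm (f i))"
proof (induction I rule: infinite_finite_induct)
  case (insert i I)
  have "l2norm (\<lambda>\<mu>. \<Sum>i\<in>insert i I. f i \<mu>) \<le> l2norm (f i) + l2norm (\<lambda>\<mu>. \<Sum>i\<in>I. f i \<mu>)"
    using insert by (simp add: l2norm_add ell2_sum)
  with insert show ?case by auto
qed auto

lemma ell2_finite_support:
  assumes "finite {\<mu>. f \<mu> \<noteq> 0}" shows "ell2 f"
proof -
  have "(\<lambda>\<mu>. (cmod (f \<mu>))\<^sup>2) summable_on {\<mu>. f \<mu> \<noteq> 0}" using assms by simp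
  then show ?thesis unfolding ell2_def
    using summable_on_cong_neutral[of UNIV "{\<mu>. f \<mu> \<noteq> 0}" "\<lambda>\<mu>. (cmod (f \<mu>))\<^sup>2" "\<lambda>\<mu>. (cmod (f \<mu>))\<^sup>2"] by simp
qed

lemma ell2_ebasis [simp]: "ell2 (ebasis \<mu>)"
  by (rule ell2_finite_support) (auto simp: ebasis_def)

lemma l2norm_eq_0: "ell2 f \<Longrightarrow> l2norm f = 0 \<Longrightarrow> f = (\<lambda>_. 0)"
  using cmod_le_l2norm by fastforce

section \<open>Inner product, antilinear in the first argument\<close>

definition ip :: "vec \<Rightarrow> vec \<Rightarrow> complex" where
  "ip f g = infsum (\<lambda>\<mu>. cnj (f \<mu>) * g \<mu>) UNIV"

lemma ip_abs_summable: "ell2 f \<Longrightarrow> ell2 g \<Longrightarrow> (\<lambda>\<mu>. cmod (cnj (f \<mu>) * g \<mu>)) summable_on UNIV"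
  using abs_summable_product[of "\<lambda>\<mu>. cnj (f \<mu>)" UNIV g]
  by (simp add: ell2_def power2_eq_square norm_mult)

lemma ip_summable: "ell2 f \<Longrightarrow> ell2 g \<Longrightarrow> (\<lambda>\<mu>. cnj (f \<mu>) * g \<mu>) summable_on UNIV"
  by (rule abs_summable_summable) (rule ip_abs_summable)

lemma ip_add_right: "ell2 f \<Longrightarrow> ell2 g \<Longrightarrow> ell2 h \<Longrightarrow> ip f (\<lambda>\<mu>. g \<mu> + h \<mu>) = ip f g + ip f h"
  unfolding ip_def distrib_left by (rule infsum_add) (auto intro: ip_summable)

lemma ip_scale_right: "ip f (\<lambda>\<mu>. a * g \<mu>) = a * ip f g"
  unfolding ip_def by (simp add: mult.left_commute infsum_cmult_right')

lemma ip_cnj: "cnj (ip f g) = ip g f"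
  unfolding ip_def infsum_cnj[symmetric] by (simp add: mult.commute)

lemma ip_self: assumes "ell2 f" shows "ip f f = complex_of_real ((l2norm f)\<^sup>2)"
proof -
  have "ip f f = infsum (\<lambda>\<mu>. complex_of_real ((cmod (f \<mu>))\<^sup>2)) UNIV"
    unfolding ip_def by (rule infsum_cong) (metis complex_norm_square mult.commute)
  also have "\<dots> = complex_of_real ((l2norm f)\<^sup>2)"
    unfolding l2norm_power2
    by (rule infsumI[OF has_sum_of_real[OF has_sum_infsum]]) (use assms in \<open>simp add: ell2_def\<close>)
  finally show ?thesis .
qed

lemma ip_Cauchy_Schwarz_abs:
  assumes "ell2 f" "ell2 g"
  shows "infsum (\<lambda>\<mu>. cmod (f \<mu>) * cmod (g \<mu>)) UNIV \<le> l2norm f * l2norm g"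
proof (rule infsum_le_finite_sums)
  show "(\<lambda>\<mu>. cmod (f \<mu>) * cmod (g \<mu>)) summable_on UNIV"
    using ip_abs_summable[OF assms] by (simp add: norm_mult)
  fix B :: "site set" assume "finite B"
  then have "L2_set (\<lambda>\<mu>. cmod (f \<mu>)) B * L2_set (\<lambda>\<mu>. cmod (g \<mu>)) B \<le> l2norm f * l2norm g"
    by (intro mult_mono L2_set_le_l2norm assms) auto
  moreover have "(\<Sum>\<mu>\<in>B. cmod (f \<mu>) * cmod (g \<mu>))
      \<le> L2_set (\<lambda>\<mu>. cmod (f \<mu>)) B * L2_set (\<lambda>\<mu>. cmod (g \<mu>)) B"
    using L2_set_mult_ineq[of "\<lambda>\<mu>. cmod (f \<mu>)" "\<lambda>\<mu>. cmod (g \<mu>)" B] by simp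
  ultimately show "(\<Sum>\<mu>\<in>B. cmod (f \<mu>) * cmod (g \<mu>)) \<le> l2norm f * l2norm g" by linarith
qed

lemma ip_le_abs:
  assumes "ell2 f" "ell2 g"
  shows "cmod (ip f g) \<le> infsum (\<lambda>\<mu>. cmod (f \<mu>) * cmod (g \<mu>)) UNIV"
  using norm_infsum_bound[OF ip_abs_summable[OF assms]] by (simp add: ip_def norm_mult)

lemma ip_Cauchy_Schwarz: "ell2 f \<Longrightarrow> ell2 g \<Longrightarrow> cmod (ip f g) \<le> l2norm f * l2norm g"
  using ip_le_abs ip_Cauchy_Schwarz_abs order_trans by blast

lemma ip_add_left: "ell2 f \<Longrightarrow> ell2 g \<Longrightarrow> ell2 h \<Longrightarrow> ip (\<lambda>\<mu>. g \<mu> + h \<mu>) f = ip g f + ip h f"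
  using ip_add_right[of f g h] by (metis complex_cnj_add ip_cnj)

lemma ip_scale_left: "ip (\<lambda>\<mu>. a * g \<mu>) f = cnj a * ip g f"
  using ip_scale_right[of f a g] by (metis complex_cnj_mult ip_cnj)

lemma ip_diff_right: "ell2 f \<Longrightarrow> ell2 g \<Longrightarrow> ell2 h \<Longrightarrow> ip f (\<lambda>\<mu>. g \<mu> - h \<mu>) = ip f g - ip f h"
  using ip_add_right[of f g "\<lambda>\<mu>. (-1) * h \<mu>"] ip_scale_right[of f "-1" h] ell2_scale[of h "-1"]
  by simp

lemma ip_diff_left: "ell2 f \<Longrightarrow> ell2 g \<Longrightarrow> ell2 h \<Longrightarrow> ip (\<lambda>\<mu>. g \<mu> - h \<mu>) f = ip g f - ip h f"
  using ip_diff_right[of f g h] by (metis complex_cnj_diff ip_cnj)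

lemma ip_sum_right:
  "ell2 f \<Longrightarrow> (\<And>i. i \<in> I \<Longrightarrow> ell2 (g i)) \<Longrightarrow> ip f (\<lambda>\<mu>. \<Sum>i\<in>I. g i \<mu>) = (\<Sum>i\<in>I. ip f (g i))"
proof (induction I rule: infinite_finite_induct)
  case (insert i I)
  then show ?case by (simp add: ip_add_right ell2_sum)
qed (auto simp: ip_def)

lemma ip_ebasis_left: "ip (ebasis \<mu>) f = f \<mu>"
proof -
  have "ip (ebasis \<mu>) f = infsum (\<lambda>\<nu>. cnj (ebasis \<mu> \<nu>) * f \<nu>) {\<mu>}"
    unfolding ip_def by (rule infsum_cong_neutral) (auto simp: ebasis_def)
  then show ?thesis by (simp add: ebasis_def)
qed

lemma ip_ebasis_right: "ip f (ebasis \<mu>) = cnj (f \<mu>)"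
  by (metis ip_cnj ip_ebasis_left)

subsection \<open>The evolution operator\<close>

lemma ell2_comp_bij: "bij p \<Longrightarrow> ell2 f \<Longrightarrow> ell2 (\<lambda>\<mu>. f (p \<mu>))"
  unfolding ell2_def
  using summable_on_reindex_bij_betw[of p UNIV UNIV "\<lambda>\<mu>. (cmod (f \<mu>))\<^sup>2"] by simp

lemma ell2_Sop: "ell2 \<psi> \<Longrightarrow> ell2 (Sop \<phi> \<psi>)"
  unfolding Sop_def by (intro ell2_add ell2_scale bij_steps[THEN ell2_comp_bij])

lemma ell2_Sadj: "ell2 \<psi> \<Longrightarrow> ell2 (Sadj \<phi> \<psi>)"
  unfolding Sadj_def by (intro ell2_diff ell2_scale bij_steps[THEN ell2_comp_bij])

lemma cos_sin_sq: "complex_of_real (cos \<phi>) * complex_of_real (cos \<phi>)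
     = 1 - complex_of_real (sin \<phi>) * complex_of_real (sin \<phi>)"
proof -
  have "cos \<phi> * cos \<phi> = 1 - sin \<phi> * sin \<phi>"
    using sin_cos_squared_add[of \<phi>] by (simp add: power2_eq_square)
  from arg_cong[OF this, of complex_of_real] show ?thesis by simp
qed

lemma Sadj_Sop: "Sadj \<phi> (Sop \<phi> \<psi>) = \<psi>"
proof
  fix \<mu>
  have "Sadj \<phi> (Sop \<phi> \<psi>) \<mu> = (complex_of_real (cos \<phi>) * complex_of_real (cos \<phi>)
     + complex_of_real (sin \<phi>) * complex_of_real (sin \<phi>)) * \<psi> \<mu>"
    unfolding Sadj_def Sop_def by (simp add: step_commute algebra_simps)
  then show "Sadj \<phi> (Sop \<phi> \<psi>) \<mu> = \<psi> \<mu>" by (simp add: cos_sin_sq)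
qed

lemma Sop_Sadj: "Sop \<phi> (Sadj \<phi> \<psi>) = \<psi>"
proof
  fix \<mu>
  have "Sop \<phi> (Sadj \<phi> \<psi>) \<mu> = (complex_of_real (cos \<phi>) * complex_of_real (cos \<phi>)
     + complex_of_real (sin \<phi>) * complex_of_real (sin \<phi>)) * \<psi> \<mu>"
    unfolding Sadj_def Sop_def by (simp add: step_commute algebra_simps)
  then show "Sop \<phi> (Sadj \<phi> \<psi>) \<mu> = \<psi> \<mu>" by (simp add: cos_sin_sq)
qed

lemma ip_comp_bij:
  assumes "\<And>\<mu>. p (q \<mu>) = \<mu>" "\<And>\<mu>. q (p \<mu>) = \<mu>"
  shows "ip (\<lambda>\<mu>. f (p \<mu>)) g = ip f (\<lambda>\<mu>. g (q \<mu>))"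
proof -
  have "bij p" by (rule bij_betw_byWitness[where f'=q]) (auto simp: assms)
  then have "infsum (\<lambda>\<mu>. cnj (f (p \<mu>)) * g (q (p \<mu>))) UNIV = infsum (\<lambda>\<mu>. cnj (f \<mu>) * g (q \<mu>)) UNIV"
    by (intro infsum_reindex_bij_betw[of p UNIV UNIV "\<lambda>\<mu>. cnj (f \<mu>) * g (q \<mu>)"]) auto
  then show ?thesis by (simp add: ip_def assms)
qed

lemma ip_Sop: 
  assumes "ell2 \<psi>" "ell2 \<eta>" shows "ip (Sop \<phi> \<psi>) \<eta> = ip \<psi> (Sadj \<phi> \<eta>)"
proof -
  have e: "ell2 (\<lambda>\<mu>. \<psi> (bwdL \<mu>))" "ell2 (\<lambda>\<mu>. \<psi> (bwdR \<mu>))"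
    "ell2 (\<lambda>\<mu>. \<eta> (fwdL \<mu>))" "ell2 (\<lambda>\<mu>. \<eta> (fwdR \<mu>))"
    by (rule ell2_comp_bij[OF bij_steps(2) assms(1)], rule ell2_comp_bij[OF bij_steps(4) assms(1)],
        rule ell2_comp_bij[OF bij_steps(1) assms(2)], rule ell2_comp_bij[OF bij_steps(3) assms(2)])
  have "ip (Sop \<phi> \<psi>) \<eta> = cnj (complex_of_real (cos \<phi>)) * ip (\<lambda>\<mu>. \<psi> (bwdL \<mu>)) \<eta>
      + cnj (\<i> * complex_of_real (sin \<phi>)) * ip (\<lambda>\<mu>. \<psi> (bwdR \<mu>)) \<eta>"
    unfolding Sop_def ip_add_left[OF assms(2) ell2_scale[OF e(1)] ell2_scale[OF e(2)]] ip_scale_left ..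
  moreover have "ip \<psi> (Sadj \<phi> \<eta>) = complex_of_real (cos \<phi>) * ip \<psi> (\<lambda>\<mu>. \<eta> (fwdL \<mu>))
      - (\<i> * complex_of_real (sin \<phi>)) * ip \<psi> (\<lambda>\<mu>. \<eta> (fwdR \<mu>))"
    unfolding Sadj_def ip_diff_right[OF assms(1) ell2_scale[OF e(3)] ell2_scale[OF e(4)]] ip_scale_right ..
  moreover have "ip (\<lambda>\<mu>. \<psi> (bwdL \<mu>)) \<eta> = ip \<psi> (\<lambda>\<mu>. \<eta> (fwdL \<mu>))"
    by (rule ip_comp_bij) simp_all
  moreover have "ip (\<lambda>\<mu>. \<psi> (bwdR \<mu>)) \<eta> = ip \<psi> (\<lambda>\<mu>. \<eta> (fwdR \<mu>))"
    by (rule ip_comp_bij) simp_all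
  ultimately show ?thesis by simp
qed

lemma l2norm_Sop: "ell2 \<psi> \<Longrightarrow> l2norm (Sop \<phi> \<psi>) = l2norm \<psi>"
proof -
  assume \<psi>: "ell2 \<psi>"
  have "ip (Sop \<phi> \<psi>) (Sop \<phi> \<psi>) = ip \<psi> \<psi>"
    using ip_Sop[OF \<psi> ell2_Sop[OF \<psi>]] by (simp add: Sadj_Sop)
  then have "(l2norm (Sop \<phi> \<psi>))\<^sup>2 = (l2norm \<psi>)\<^sup>2" unfolding ip_self[OF \<psi>] ip_self[OF ell2_Sop[OF \<psi>]] of_real_eq_iff .
  then show ?thesis by simp
qed

lemma ell2_mult_bounded:
  assumes "ell2 f" "\<And>\<mu>. cmod (\<omega> \<mu>) \<le> r" "0 \<le> r"
  shows "ell2 (\<lambda>\<mu>. \<omega> \<mu> * f \<mu>)" "l2norm (\<lambda>\<mu>. \<omega> \<mu> * f \<mu>) \<le> r * l2norm f"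
proof -
  have *: "L2_set (\<lambda>\<mu>. cmod (\<omega> \<mu> * f \<mu>)) B \<le> r * l2norm f" if "finite B" for B
  proof -
    have "L2_set (\<lambda>\<mu>. cmod (\<omega> \<mu> * f \<mu>)) B \<le> L2_set (\<lambda>\<mu>. r * cmod (f \<mu>)) B"
      by (rule L2_set_mono) (auto simp: norm_mult intro!: mult_right_mono assms)
    also have "\<dots> = r * L2_set (\<lambda>\<mu>. cmod (f \<mu>)) B"
      by (simp add: L2_set_right_distrib assms)
    also have "\<dots> \<le> r * l2norm f" by (intro mult_left_mono L2_set_le_l2norm assms that)
    finally show ?thesis .
  qed
  show "ell2 (\<lambda>\<mu>. \<omega> \<mu> * f \<mu>)" by (rule ell2_L2_setI(1)[OF *])
  show "l2norm (\<lambda>\<mu>. \<omega> \<mu> * f \<mu>) \<le> r * l2norm f" by (rule ell2_L2_setI(2)[OF *])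
qed

text \<open>Phases of modulus at most \<open>r\<close> rather than unimodular ones: the same
  estimate then serves the unitary walk (\<open>r = 1\<close>), its multiples by z, and models with
  removed sites.\<close>

lemma CCop_bounded:
  assumes "ell2 f" "\<And>\<mu>. cmod (\<omega> \<mu>) \<le> r" "0 \<le> r"
  shows "ell2 (CCop \<omega> \<phi> f)" "l2norm (CCop \<omega> \<phi> f) \<le> r * l2norm f"
  using ell2_mult_bounded[of "Sop \<phi> f" \<omega> r] assms
  by (auto simp: CCop_def ell2_Sop l2norm_Sop)

lemma CCop_add: "CCop \<omega> \<phi> (\<lambda>\<mu>. f \<mu> + g \<mu>) = (\<lambda>\<mu>. CCop \<omega> \<phi> f \<mu> + CCop \<omega> \<phi> g \<mu>)"
  by (auto simp: CCop_def Sop_def algebra_simps)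

lemma CCop_scale: "CCop \<omega> \<phi> (\<lambda>\<mu>. a * f \<mu>) = (\<lambda>\<mu>. a * CCop \<omega> \<phi> f \<mu>)"
  by (auto simp: CCop_def Sop_def algebra_simps)

lemma CCop_diff: "CCop \<omega> \<phi> (\<lambda>\<mu>. f \<mu> - g \<mu>) = (\<lambda>\<mu>. CCop \<omega> \<phi> f \<mu> - CCop \<omega> \<phi> g \<mu>)"
  by (auto simp: CCop_def Sop_def algebra_simps)

lemma CCop_zero: "CCop \<omega> \<phi> (\<lambda>_. 0) = (\<lambda>_. 0)"
  by (simp add: CCop_def Sop_def)

lemma CCop_sum: "CCop \<omega> \<phi> (\<lambda>\<mu>. \<Sum>i\<in>I. f i \<mu>) = (\<lambda>\<mu>. \<Sum>i\<in>I. CCop \<omega> \<phi> (f i) \<mu>)"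
  by (induction I rule: infinite_finite_induct) (simp_all add: CCop_zero CCop_add)

lemma CCadj_add: "CCadj \<omega> \<phi> (\<lambda>\<mu>. f \<mu> + g \<mu>) = (\<lambda>\<mu>. CCadj \<omega> \<phi> f \<mu> + CCadj \<omega> \<phi> g \<mu>)"
  by (auto simp: CCadj_def Sadj_def algebra_simps)

lemma CCadj_scale: "CCadj \<omega> \<phi> (\<lambda>\<mu>. a * f \<mu>) = (\<lambda>\<mu>. a * CCadj \<omega> \<phi> f \<mu>)"
  by (auto simp: CCadj_def Sadj_def algebra_simps)

lemma ip_CCop:
  assumes "ell2 \<psi>" "ell2 \<eta>" "\<And>\<mu>. cmod (\<omega> \<mu>) = 1"
  shows "ip (CCop \<omega> \<phi> \<psi>) \<eta> = ip \<psi> (CCadj \<omega> \<phi> \<eta>)"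
proof -
  have "ip (CCop \<omega> \<phi> \<psi>) \<eta> = ip (Sop \<phi> \<psi>) (\<lambda>\<mu>. cnj (\<omega> \<mu>) * \<eta> \<mu>)"
    unfolding ip_def CCop_def by (simp add: mult_ac)
  also have "\<dots> = ip \<psi> (CCadj \<omega> \<phi> \<eta>)"
    unfolding CCadj_def
    by (intro ip_Sop assms ell2_mult_bounded(1)[where r=1]) (auto simp: assms)
  finally show ?thesis .
qed

lemma cnj_mult_unit:
  assumes "cmod w = 1" shows "cnj w * (w * a) = a" "w * (cnj w * a) = a"
proof -
  have *: "w * cnj w = 1" using complex_norm_square[of w] assms by simp
  show "w * (cnj w * a) = a" by (simp only: mult.assoc[symmetric] * mult_1)
  show "cnj w * (w * a) = a" by (simp only: mult.assoc[symmetric] mult.commute[of "cnj w" w] * mult_1)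
qed

lemma CCadj_CCop:
  assumes "\<And>\<mu>. cmod (\<omega> \<mu>) = 1" shows "CCadj \<omega> \<phi> (CCop \<omega> \<phi> \<psi>) = \<psi>"
  unfolding CCadj_def CCop_def cnj_mult_unit(1)[OF assms] by (rule Sadj_Sop)

lemma CCop_CCadj:
  assumes "\<And>\<mu>. cmod (\<omega> \<mu>) = 1" shows "CCop \<omega> \<phi> (CCadj \<omega> \<phi> \<psi>) = \<psi>"
  unfolding CCadj_def CCop_def Sop_Sadj cnj_mult_unit(2)[OF assms] ..

subsection \<open>The resolvent\<close>

text \<open>The spectral parameter is absorbed into the phases, which only satisfy \<open>cmod (\<omega> \<kappa>) \<le> r < 1\<close>.\<close>

definition Gr :: "vec \<Rightarrow> real \<Rightarrow> site \<Rightarrow> vec" where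
  "Gr \<omega> \<phi> \<mu> = (\<lambda>\<nu>. \<Sum>n. (CCop \<omega> \<phi> ^^ n) (ebasis \<mu>) \<nu>)"

lemma l2norm_ebasis [simp]: "l2norm (ebasis \<mu>) = 1"
proof -
  have "complex_of_real ((l2norm (ebasis \<mu>))\<^sup>2) = complex_of_real 1"
    unfolding ip_self[OF ell2_ebasis, symmetric] ip_ebasis_left by (simp add: ebasis_def)
  then have "(l2norm (ebasis \<mu>))\<^sup>2 = 1" unfolding of_real_eq_iff .
  then show ?thesis by (metis l2norm_nonneg one_power2 power2_eq_imp_eq zero_le_one)
qed

lemma ip_CCop_CCop:
  assumes "ell2 \<psi>" "ell2 \<eta>" "\<And>\<mu>. cmod (\<omega> \<mu>) = 1"
  shows "ip (CCop \<omega> \<phi> \<psi>) (CCop \<omega> \<phi> \<eta>) = ip \<psi> \<eta>"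
proof -
  have "ell2 (CCop \<omega> \<phi> \<eta>)"
    by (rule CCop_bounded(1)[where r = 1, OF assms(2)]) (simp_all add: assms(3))
  from ip_CCop[OF assms(1) this assms(3)] show ?thesis by (simp only: CCadj_CCop[OF assms(3)])
qed

lemma CCop_phase: "CCop (\<lambda>\<kappa>. z * \<omega> \<kappa>) \<phi> \<psi> = (\<lambda>\<mu>. z * CCop \<omega> \<phi> \<psi> \<mu>)"
  by (simp add: CCop_def mult.assoc)

lemma CCop_phase_pow: "(CCop (\<lambda>\<kappa>. z * \<omega> \<kappa>) \<phi> ^^ n) \<psi> = (\<lambda>\<mu>. z ^ n * (CCop \<omega> \<phi> ^^ n) \<psi> \<mu>)"
  by (induction n) (simp_all add: CCop_phase CCop_scale mult_ac)

lemma CCop_ebasis: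
  "CCop \<omega> \<phi> (ebasis \<mu>) = (\<lambda>\<nu>. complex_of_real (cos \<phi>) * \<omega> (fwdL \<mu>) * ebasis (fwdL \<mu>) \<nu>
     + \<i> * complex_of_real (sin \<phi>) * \<omega> (fwdR \<mu>) * ebasis (fwdR \<mu>) \<nu>)"
  by (rule ext) (auto simp: CCop_def Sop_def ebasis_def step_eq_iff algebra_simps)

context
  fixes \<omega> :: vec and r \<phi> :: real
  assumes bound: "\<And>\<kappa>. cmod (\<omega> \<kappa>) \<le> r" and r: "r < 1"
begin

lemma r_nonneg: "0 \<le> r"
  using order_trans[OF norm_ge_zero bound[of undefined]] .

lemma CCop_pow_bound:
  shows "ell2 ((CCop \<omega> \<phi> ^^ n) (ebasis \<mu>))" "l2norm ((CCop \<omega> \<phi> ^^ n) (ebasis \<mu>)) \<le> r ^ n"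
proof (induction n)
  case (Suc n)
  { case 1
    show ?case using CCop_bounded(1)[OF Suc(1) bound r_nonneg] by simp }
  { case 2
    have "l2norm (CCop \<omega> \<phi> ((CCop \<omega> \<phi> ^^ n) (ebasis \<mu>))) \<le> r * l2norm ((CCop \<omega> \<phi> ^^ n) (ebasis \<mu>))"
      by (rule CCop_bounded(2)[OF Suc(1) bound r_nonneg])
    also have "\<dots> \<le> r * r ^ n" by (rule mult_left_mono[OF Suc(2) r_nonneg])
    finally show ?case by simp }
qed auto

lemma Gr_summable: "summable (\<lambda>n. (CCop \<omega> \<phi> ^^ n) (ebasis \<mu>) \<nu>)"
proof (rule summable_comparison_test)
  show "\<exists>N. \<forall>n\<ge>N. norm ((CCop \<omega> \<phi> ^^ n) (ebasis \<mu>) \<nu>) \<le> r ^ n"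
    using order_trans[OF cmod_le_l2norm[OF CCop_pow_bound(1)] CCop_pow_bound(2)] by blast
  show "summable (\<lambda>n. r ^ n)" using r r_nonneg by (intro summable_geometric) simp
qed

lemma Gr_ell2: "ell2 (Gr \<omega> \<phi> \<mu>)" "l2norm (Gr \<omega> \<phi> \<mu>) \<le> 1 / (1 - r)"
proof -
  define s where "s N = (\<lambda>\<nu>. \<Sum>n<N. (CCop \<omega> \<phi> ^^ n) (ebasis \<mu>) \<nu>)" for N
  have s: "ell2 (s N)" for N unfolding s_def by (rule ell2_sum) (rule CCop_pow_bound)
  have n: "l2norm (s N) \<le> 1 / (1 - r)" for N
  proof -
    have "l2norm (s N) \<le> (\<Sum>n<N. l2norm ((CCop \<omega> \<phi> ^^ n) (ebasis \<mu>)))"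
      unfolding s_def by (rule l2norm_sum) (rule CCop_pow_bound)
    also have "\<dots> \<le> (\<Sum>n<N. r ^ n)" by (rule sum_mono) (rule CCop_pow_bound)
    also have "\<dots> \<le> (\<Sum>n. r ^ n)"
      using r r_nonneg by (intro sum_le_suminf summable_geometric) auto
    also have "\<dots> = 1 / (1 - r)" using r r_nonneg by (intro suminf_geometric) simp
    finally show ?thesis .
  qed
  have lim: "(\<lambda>N. s N \<nu>) \<longlonglongrightarrow> Gr \<omega> \<phi> \<mu> \<nu>" for \<nu>
    unfolding s_def Gr_def by (rule summable_LIMSEQ[OF Gr_summable])
  have *: "L2_set (\<lambda>\<nu>. cmod (Gr \<omega> \<phi> \<mu> \<nu>)) B \<le> 1 / (1 - r)" if B: "finite B" for B
  proof (rule LIMSEQ_le_const2)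
    show "(\<lambda>N. L2_set (\<lambda>\<nu>. cmod (s N \<nu>)) B) \<longlonglongrightarrow> L2_set (\<lambda>\<nu>. cmod (Gr \<omega> \<phi> \<mu> \<nu>)) B"
      unfolding L2_set_def by (intro tendsto_intros lim)
    show "\<exists>N. \<forall>n\<ge>N. L2_set (\<lambda>\<nu>. cmod (s n \<nu>)) B \<le> 1 / (1 - r)"
      using order_trans[OF L2_set_le_l2norm[OF s B] n] by blast
  qed
  show "ell2 (Gr \<omega> \<phi> \<mu>)" by (rule ell2_L2_setI(1)[OF *])
  show "l2norm (Gr \<omega> \<phi> \<mu>) \<le> 1 / (1 - r)" by (rule ell2_L2_setI(2)[OF *])
qed

text \<open>\<open>Gr \<omega> \<phi> \<mu>\<close> is the column of the inverse of 1 - U with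
  source \<open>\<mu>\<close>. The equation x = e + U x, with uniqueness from the contraction
  \<open>r < 1\<close>, is the working characterisation in what follows.\<close>

lemma Gr_fixpoint: "Gr \<omega> \<phi> \<mu> = (\<lambda>\<nu>. ebasis \<mu> \<nu> + CCop \<omega> \<phi> (Gr \<omega> \<phi> \<mu>) \<nu>)"
proof
  fix \<nu>
  let ?p = "\<lambda>n \<nu>. (CCop \<omega> \<phi> ^^ n) (ebasis \<mu>) \<nu>"
  have "(\<lambda>n. CCop \<omega> \<phi> (?p n) \<nu>) sums CCop \<omega> \<phi> (Gr \<omega> \<phi> \<mu>) \<nu>"
    unfolding CCop_def Sop_def Gr_def
    by (intro sums_mult sums_add summable_sums Gr_summable[unfolded CCop_def Sop_def])
  then have "(\<lambda>n. ?p (Suc n) \<nu>) sums CCop \<omega> \<phi> (Gr \<omega> \<phi> \<mu>) \<nu>" by simp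
  then have "(\<lambda>n. ?p n \<nu>) sums (CCop \<omega> \<phi> (Gr \<omega> \<phi> \<mu>) \<nu> + ebasis \<mu> \<nu>)"
    by (subst (asm) sums_Suc_iff) simp
  then show "Gr \<omega> \<phi> \<mu> \<nu> = ebasis \<mu> \<nu> + CCop \<omega> \<phi> (Gr \<omega> \<phi> \<mu>) \<nu>"
    unfolding Gr_def by (simp add: sums_iff)
qed

lemma fixpoint_unique:
  assumes "ell2 x" "ell2 y" "x = (\<lambda>\<nu>. b \<nu> + CCop \<omega> \<phi> x \<nu>)" "y = (\<lambda>\<nu>. b \<nu> + CCop \<omega> \<phi> y \<nu>)"
  shows "x = y"
proof -
  define d where "d = (\<lambda>\<nu>. x \<nu> - y \<nu>)"
  have d: "ell2 d" unfolding d_def by (rule ell2_diff[OF assms(1,2)])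
  have "d \<nu> = CCop \<omega> \<phi> d \<nu>" for \<nu>
    unfolding d_def CCop_diff using fun_cong[OF assms(3), of \<nu>] fun_cong[OF assms(4), of \<nu>] by simp
  then have "CCop \<omega> \<phi> d = d" by (intro ext) simp
  then have "l2norm d \<le> r * l2norm d" using CCop_bounded(2)[of d \<omega> r \<phi>, OF d bound r_nonneg] by simp
  then have "(1 - r) * l2norm d \<le> 0" by (simp add: algebra_simps)
  then have "l2norm d = 0" using r l2norm_nonneg[of d] by (simp add: mult_le_0_iff)
  from fun_cong[OF l2norm_eq_0[OF d this]] show ?thesis unfolding d_def by (intro ext) simp
qed

lemma Gr_eqI: "ell2 x \<Longrightarrow> x = (\<lambda>\<nu>. ebasis \<mu> \<nu> + CCop \<omega> \<phi> x \<nu>) \<Longrightarrow> Gr \<omega> \<phi> \<mu> = x"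
  using fixpoint_unique[OF Gr_ell2(1) _ Gr_fixpoint] by blast

text \<open>Writing the inverse of 1 - U as 1 plus itself times U lets U act on the source instead
  of the target; the source has two images, hence two terms. The proof checks that the right-hand
  side solves the fixed point equation.\<close>

lemma Gr_step:
  "Gr \<omega> \<phi> \<mu> = (\<lambda>\<nu>. ebasis \<mu> \<nu> + (complex_of_real (cos \<phi>) * \<omega> (fwdL \<mu>) * Gr \<omega> \<phi> (fwdL \<mu>) \<nu>
     + \<i> * complex_of_real (sin \<phi>) * \<omega> (fwdR \<mu>) * Gr \<omega> \<phi> (fwdR \<mu>) \<nu>))"
proof (rule Gr_eqI)
  let ?a = "complex_of_real (cos \<phi>) * \<omega> (fwdL \<mu>)"
  let ?b = "\<i> * complex_of_real (sin \<phi>) * \<omega> (fwdR \<mu>)"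
  let ?x = "\<lambda>\<nu>. ?a * Gr \<omega> \<phi> (fwdL \<mu>) \<nu> + ?b * Gr \<omega> \<phi> (fwdR \<mu>) \<nu>"
  show "ell2 (\<lambda>\<nu>. ebasis \<mu> \<nu> + ?x \<nu>)"
    by (rule ell2_add[OF ell2_ebasis ell2_add[OF ell2_scale ell2_scale]]) (rule Gr_ell2)+
  have lin: "a * u + b * v = (a * u1 + b * v1) + (a * u2 + b * v2)"
    if "u = u1 + u2" "v = v1 + v2" for a b u u1 u2 v v1 v2 :: complex
    unfolding that by (simp add: algebra_simps)
  have *: "?x \<nu> = CCop \<omega> \<phi> (ebasis \<mu>) \<nu> + CCop \<omega> \<phi> ?x \<nu>" for \<nu>
    unfolding CCop_add CCop_scale CCop_ebasis
    by (rule lin) (rule fun_cong[OF Gr_fixpoint])+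
  show "(\<lambda>\<nu>. ebasis \<mu> \<nu> + ?x \<nu>) = (\<lambda>\<nu>. ebasis \<mu> \<nu> + CCop \<omega> \<phi> (\<lambda>\<nu>. ebasis \<mu> \<nu> + ?x \<nu>) \<nu>)"
    unfolding CCop_add[of _ _ "ebasis \<mu>"] by (intro ext arg_cong2[where f = "(+)"] refl *)
qed

text \<open>With phase 0 at \<open>\<mu>\<close> nothing returns there, so the source entry stays 1
  and whatever \<open>Sop\<close> sends to \<open>\<mu>\<close> is lost. Elsewhere x is a phase of
  modulus at most r times \<open>Sop \<phi> x\<close>, which has the norm of x; balancing the
  squared norms gives the inequality.\<close>

lemma Gr_removed_energy:
  assumes "\<omega> \<mu> = 0"
  shows "Gr \<omega> \<phi> \<mu> \<mu> = 1"
    and "(1 - r\<^sup>2) * (l2norm (Gr \<omega> \<phi> \<mu>))\<^sup>2 \<le> 1 - r\<^sup>2 * (cmod (Sop \<phi> (Gr \<omega> \<phi> \<mu>) \<mu>))\<^sup>2"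
proof -
  define x y where "x = Gr \<omega> \<phi> \<mu>" and "y = Sop \<phi> x"
  have x: "ell2 x" "x = (\<lambda>\<nu>. ebasis \<mu> \<nu> + \<omega> \<nu> * y \<nu>)"
    using Gr_ell2(1)[of \<mu>] Gr_fixpoint[of \<mu>] unfolding x_def y_def CCop_def by auto
  have y: "ell2 y" "l2norm y = l2norm x" unfolding y_def by (auto intro: ell2_Sop l2norm_Sop x)
  have x\<mu>: "x \<mu> = 1" using fun_cong[OF x(2), of \<mu>] assms by (simp add: ebasis_def)
  then show "Gr \<omega> \<phi> \<mu> \<mu> = 1" by (simp add: x_def)
  have "(\<Sum>\<nu>\<in>B. (cmod (x \<nu>))\<^sup>2) \<le> 1 + r\<^sup>2 * ((l2norm x)\<^sup>2 - (cmod (y \<mu>))\<^sup>2)" if B: "finite B" for B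
  proof -
    have "(\<Sum>\<nu>\<in>B. (cmod (x \<nu>))\<^sup>2) \<le> (\<Sum>\<nu>\<in>insert \<mu> B. (cmod (x \<nu>))\<^sup>2)"
      using B by (intro sum_mono2) auto
    also have "\<dots> = 1 + (\<Sum>\<nu>\<in>B - {\<mu>}. (cmod (x \<nu>))\<^sup>2)"
      using B by (simp add: sum.insert_remove x\<mu>)
    also have "(\<Sum>\<nu>\<in>B - {\<mu>}. (cmod (x \<nu>))\<^sup>2) \<le> (\<Sum>\<nu>\<in>B - {\<mu>}. r\<^sup>2 * (cmod (y \<nu>))\<^sup>2)"
    proof (rule sum_mono)
      fix \<nu> assume "\<nu> \<in> B - {\<mu>}"
      then have "x \<nu> = \<omega> \<nu> * y \<nu>" using fun_cong[OF x(2), of \<nu>] by (simp add: ebasis_def)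
      then show "(cmod (x \<nu>))\<^sup>2 \<le> r\<^sup>2 * (cmod (y \<nu>))\<^sup>2"
        using bound[of \<nu>] by (simp add: norm_mult power_mult_distrib mult_right_mono power_mono)
    qed
    also have "(\<Sum>\<nu>\<in>B - {\<mu>}. r\<^sup>2 * (cmod (y \<nu>))\<^sup>2) = r\<^sup>2 * ((\<Sum>\<nu>\<in>insert \<mu> B. (cmod (y \<nu>))\<^sup>2) - (cmod (y \<mu>))\<^sup>2)"
      using B by (simp add: sum.insert_remove sum_distrib_left)
    also have "\<dots> \<le> r\<^sup>2 * ((l2norm x)\<^sup>2 - (cmod (y \<mu>))\<^sup>2)"
      using sum_le_l2norm[OF y(1), of "insert \<mu> B"] B y(2) by (intro mult_left_mono) auto
    finally show ?thesis by simp
  qed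
  then have "(l2norm x)\<^sup>2 \<le> 1 + r\<^sup>2 * ((l2norm x)\<^sup>2 - (cmod (y \<mu>))\<^sup>2)" by (rule ell2I(2))
  then show "(1 - r\<^sup>2) * (l2norm (Gr \<omega> \<phi> \<mu>))\<^sup>2 \<le> 1 - r\<^sup>2 * (cmod (Sop \<phi> (Gr \<omega> \<phi> \<mu>) \<mu>))\<^sup>2"
    unfolding x_def[symmetric] y_def[symmetric] by (simp add: algebra_simps)
qed

end

section \<open>Dependence on a single phase, and the Poisson identity\<close>

text \<open>Changing the phase at \<open>\<mu>\<close> alters the operator only in its output at
  \<open>\<mu>\<close>. Hence applying 1 - U to the vector \<open>x0\<close> of the reduced model
  gives a scalar multiple of the basis vector, and dividing by this scalar solves the
  equation.\<close>

lemma Gr_rank_one: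
  fixes \<omega> :: vec and r \<phi> :: real and t :: complex and \<mu> \<nu> :: site
  assumes bound: "\<And>\<kappa>. cmod (\<omega> \<kappa>) \<le> r" "cmod t \<le> r" and r: "r < 1"
  defines "x0 \<equiv> Gr (\<omega> (\<mu> := 0)) \<phi> \<mu>"
  shows "Gr (\<omega> (\<mu> := t)) \<phi> \<mu> \<nu> = x0 \<nu> / (1 - t * Sop \<phi> x0 \<mu>)"
proof -
  let ?w\<^sub>0 = "\<omega> (\<mu> := 0)" and ?\<omega> = "\<omega> (\<mu> := t)"
  let ?d = "1 - t * Sop \<phi> x0 \<mu>"
  have r0: "0 \<le> r" using order_trans[OF norm_ge_zero bound(2)] .
  have b0: "cmod (?w\<^sub>0 \<kappa>) \<le> r" and b: "cmod (?\<omega> \<kappa>) \<le> r" for \<kappa> using bound r0 by auto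
  have x0: "ell2 x0" "x0 \<mu> = 1" unfolding x0_def
    using Gr_ell2(1)[of ?w\<^sub>0, OF b0 r] Gr_removed_energy(1)[of ?w\<^sub>0, OF b0 r] by auto
  have *: "CCop ?\<omega> \<phi> x0 \<kappa> = x0 \<kappa> - ?d * ebasis \<mu> \<kappa>" for \<kappa>
  proof -
    have "CCop ?\<omega> \<phi> x0 \<kappa> = CCop ?w\<^sub>0 \<phi> x0 \<kappa> + t * Sop \<phi> x0 \<mu> * ebasis \<mu> \<kappa>"
      by (simp add: CCop_def ebasis_def)
    moreover have "x0 \<kappa> = ebasis \<mu> \<kappa> + CCop ?w\<^sub>0 \<phi> x0 \<kappa>"
      using fun_cong[OF Gr_fixpoint[of ?w\<^sub>0 r \<phi> \<mu>, OF b0 r], of \<kappa>] unfolding x0_def .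
    ultimately show ?thesis by (simp add: algebra_simps)
  qed
  \<comment> \<open>If the scalar vanished, \<open>x0\<close> would be fixed by a strict contraction
    and so be zero, against \<open>x0 \<mu> = 1\<close>.\<close>
  have d: "?d \<noteq> 0"
  proof
    assume "?d = 0"
    then have "CCop ?\<omega> \<phi> x0 = x0" using * by auto
    then have "l2norm x0 \<le> r * l2norm x0" using CCop_bounded(2)[of x0 ?\<omega> r \<phi>, OF x0(1) b r0] by simp
    then have "(1 - r) * l2norm x0 \<le> 0" by (simp add: algebra_simps)
    then have "l2norm x0 = 0" using r l2norm_nonneg[of x0] by (simp add: mult_le_0_iff)
    from l2norm_eq_0[OF x0(1) this] x0(2) show False by simp
  qed
  have "Gr ?\<omega> \<phi> \<mu> = (\<lambda>\<kappa>. inverse ?d * x0 \<kappa>)"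
  proof (rule Gr_eqI[OF b r ell2_scale[OF x0(1)]])
    show "(\<lambda>\<kappa>. inverse ?d * x0 \<kappa>) = (\<lambda>\<kappa>. ebasis \<mu> \<kappa> + CCop ?\<omega> \<phi> (\<lambda>\<kappa>. inverse ?d * x0 \<kappa>) \<kappa>)"
    proof
      fix \<kappa>
      have "inverse ?d * (?d * ebasis \<mu> \<kappa>) = ebasis \<mu> \<kappa>"
        by (simp only: mult.assoc[symmetric] left_inverse[OF d] mult_1)
      then show "inverse ?d * x0 \<kappa> = ebasis \<mu> \<kappa> + CCop ?\<omega> \<phi> (\<lambda>\<kappa>. inverse ?d * x0 \<kappa>) \<kappa>"
        unfolding CCop_scale * right_diff_distrib by simp
    qed
  qed
  then show ?thesis by (simp add: divide_inverse mult.commute)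
qed

text \<open>Entrywise form of (1 - |z|^2) G' G = G + G' - 1, with G' the adjoint of G. It follows
  from z U x = x - e and the isometry of U, which gives |z|^2 times the inner product of two columns
  as that of the columns minus their sources.\<close>

lemma Gr_Poisson:
  fixes \<omega> :: vec and \<phi> :: real and z :: complex and \<mu> \<nu> :: site
  assumes unit: "\<And>\<kappa>. cmod (\<omega> \<kappa>) = 1" and z: "cmod z < 1"
  defines "x \<equiv> Gr (\<lambda>\<kappa>. z * \<omega> \<kappa>) \<phi>"
  shows "(1 - (complex_of_real (cmod z))\<^sup>2) * ip (x \<mu>) (x \<nu>)
    = cnj (x \<mu> \<nu>) + x \<nu> \<mu> - ebasis \<nu> \<mu>"
proof -
  have b: "cmod (z * \<omega> \<kappa>) \<le> cmod z" for \<kappa> by (simp add: norm_mult unit)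
  have x: "ell2 (x \<mu>)" for \<mu> unfolding x_def by (rule Gr_ell2(1)[OF b z])
  have u: "ell2 (CCop \<omega> \<phi> (x \<mu>))" for \<mu> by (rule CCop_bounded(1)[OF x, of _ 1]) (simp_all add: unit)
  have fx: "(\<lambda>\<kappa>. z * CCop \<omega> \<phi> (x \<mu>) \<kappa>) = (\<lambda>\<kappa>. x \<mu> \<kappa> - ebasis \<mu> \<kappa>)" for \<mu>
    using Gr_fixpoint[of "\<lambda>\<kappa>. z * \<omega> \<kappa>" "cmod z" \<phi> \<mu>, OF b z] unfolding x_def CCop_phase by (metis (no_types) add_diff_cancel_left')
  have "(complex_of_real (cmod z))\<^sup>2 * ip (x \<mu>) (x \<nu>)
      = ip (\<lambda>\<kappa>. z * CCop \<omega> \<phi> (x \<mu>) \<kappa>) (\<lambda>\<kappa>. z * CCop \<omega> \<phi> (x \<nu>) \<kappa>)"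
    unfolding ip_scale_left ip_scale_right ip_CCop_CCop[OF x x unit]
    by (simp add: complex_norm_square[of z, unfolded of_real_power])
  also have "\<dots> = ip (\<lambda>\<kappa>. x \<mu> \<kappa> - ebasis \<mu> \<kappa>) (\<lambda>\<kappa>. x \<nu> \<kappa> - ebasis \<nu> \<kappa>)" unfolding fx ..
  also have "\<dots> = ip (x \<mu>) (x \<nu>) - cnj (x \<mu> \<nu>) - (x \<nu> \<mu> - ebasis \<nu> \<mu>)"
    unfolding ip_diff_left[OF ell2_diff[OF x ell2_ebasis] x ell2_ebasis]
      ip_diff_right[OF x x ell2_ebasis] ip_ebasis_right ip_ebasis_left by simp
  finally show ?thesis by (simp add: algebra_simps)
qed

subsection \<open>Normalised Lebesgue measure on the circle\<close>

lemma circ_measure_density: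
  "circ_measure = distr (density lborel (\<lambda>x. ennreal (indicator {0..<2*pi} x / (2*pi)))) borel cis"
proof -
  have "uniform_measure lborel {0..<2*pi} = density lborel (\<lambda>x. ennreal (indicator {0..<2*pi} x / (2*pi)))"
    unfolding uniform_measure_def
    by (rule density_cong) (auto intro!: AE_I2 simp: divide_ennreal indicator_def simp flip: ennreal_1)
  then show ?thesis unfolding circ_measure_def by simp
qed

lemma sets_circ_measure [simp, measurable_cong]: "sets circ_measure = sets borel"
  and space_circ_measure [simp]: "space circ_measure = UNIV"
  by (auto simp: circ_measure_def)

lemma measurable_cis [measurable]: "cis \<in> borel_measurable borel"
  by (intro borel_measurable_continuous_onI continuous_intros)

lemma measurable_cnj [measurable]: "cnj \<in> borel_measurable borel"
  by (intro borel_measurable_continuous_onI continuous_intros)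

lemma prob_space_circ: "prob_space circ_measure"
proof -
  have "prob_space (uniform_measure lborel {0..<2*pi})"
    by (rule prob_space_uniform_measure) auto
  then show ?thesis unfolding circ_measure_def
    by (rule prob_space.prob_space_distr) simp
qed

interpretation circ: prob_space circ_measure by (rule prob_space_circ)

lemma circ_prob [simp]: "measure circ_measure UNIV = 1" "emeasure circ_measure UNIV = 1"
  using circ.prob_space circ.emeasure_space_1 by auto

text \<open>\<open>circ_measure\<close> is a measure on the whole plane, so facts that need |w| = 1
  enter as almost-everywhere statements.\<close>

lemma AE_circ: "AE w in circ_measure. cmod w = 1"
  unfolding circ_measure_def by (subst AE_distr_iff) auto

lemma circ_moment:
  assumes "0 < n" shows "(\<integral>w. w ^ n \<partial>circ_measure) = 0"
proof -
  let ?F = "\<lambda>\<theta>::real. cis (real n * \<theta>) / (\<i> * of_nat n)"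
  have F: "(?F has_vector_derivative cis (real n * \<theta>)) (at \<theta> within {0..2*pi})" for \<theta>
  proof -
    have "((\<lambda>z. exp (\<i> * of_nat n * z) / (\<i> * of_nat n)) has_field_derivative
        (exp (\<i> * of_nat n * complex_of_real \<theta>))) (at (complex_of_real \<theta>))"
      using assms by (auto intro!: derivative_eq_intros)
    from has_vector_derivative_real_field[OF this]
    have "((\<lambda>x. exp (\<i> * of_nat n * complex_of_real x) / (\<i> * of_nat n)) has_vector_derivative
        (exp (\<i> * of_nat n * complex_of_real \<theta>))) (at \<theta> within {0..2*pi})" .
    then show ?thesis by (simp add: cis_conv_exp mult.assoc)
  qed
  have "has_bochner_integral lborel (\<lambda>\<theta>. indicator {0..2*pi} \<theta> *\<^sub>R cis (real n * \<theta>)) (?F (2*pi) - ?F 0)"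
    by (rule has_bochner_integral_FTC_Icc) (auto intro!: F continuous_intros)
  moreover have "cis (real n * (2 * pi)) = 1"
    using cis_multiple_2pi[of "of_nat n"] by (simp add: mult_ac)
  ultimately have I: "has_bochner_integral lborel (\<lambda>\<theta>. indicator {0..2*pi} \<theta> *\<^sub>R cis (real n * \<theta>)) 0"
    by simp
  have "(\<integral>w. w ^ n \<partial>circ_measure) = (\<integral>\<theta>. (indicator {0..<2*pi} \<theta> / (2*pi)) *\<^sub>R cis \<theta> ^ n \<partial>lborel)"
    unfolding circ_measure_density by (subst integral_distr) (auto simp: integral_density)
  \<comment> \<open>The fundamental theorem of calculus is applied on the closed interval; the
    half-open one differs by a null point.\<close>
  also have "\<dots> = (\<integral>\<theta>. (1 / (2*pi)) *\<^sub>R (indicator {0..2*pi} \<theta> *\<^sub>R cis (real n * \<theta>)) \<partial>lborel)"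
    by (rule integral_cong_AE)
       (use AE_lborel_singleton[of "2*pi"] in \<open>auto elim!: eventually_mono simp: Complex.DeMoivre indicator_def\<close>)
  also have "\<dots> = 0" using I by (subst integral_scaleR_right) (auto simp: has_bochner_integral_iff)
  finally show ?thesis .
qed

lemma circ_moment_cnj: "(\<integral>w. w ^ n * cnj w ^ m \<partial>circ_measure) = (if n = m then 1 else 0)"
proof -
  have ge: "(\<integral>w. w ^ n * cnj w ^ m \<partial>circ_measure) = (if n = m then 1 else 0)" if "m \<le> n" for n m
  proof -
    have "(\<integral>w. w ^ n * cnj w ^ m \<partial>circ_measure) = (\<integral>w. w ^ (n - m) \<partial>circ_measure)"
    proof (rule integral_cong_AE)
      show "AE w in circ_measure. w ^ n * cnj w ^ m = w ^ (n - m)"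
        using AE_circ
      proof (rule eventually_mono)
        fix w :: complex assume "cmod w = 1"
        then have "w * cnj w = 1" using complex_norm_square[of w] by simp
        then have "(w * cnj w) ^ m = 1" by simp
        moreover have "w ^ n = w ^ (n - m) * w ^ m" using that by (simp flip: power_add)
        ultimately show "w ^ n * cnj w ^ m = w ^ (n - m)" by (simp add: power_mult_distrib)
      qed
    qed measurable
    then show ?thesis using that circ_moment[of "n - m"] by (cases "n = m") (auto simp: circ.prob_space)
  qed
  show ?thesis
  proof (cases "m \<le> n")
    case False
    have "(\<integral>w. w ^ n * cnj w ^ m \<partial>circ_measure) = (\<integral>w. cnj (w ^ m * cnj w ^ n) \<partial>circ_measure)"
      by (simp add: mult.commute)
    also have "\<dots> = cnj (\<integral>w. w ^ m * cnj w ^ n \<partial>circ_measure)" by (rule Bochner_Integration.integral_cnj)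
    finally show ?thesis using ge[of n m] False by simp
  qed (rule ge)
qed

text \<open>Absolute summability justifies termwise integration, and only the index n with n + j = k
  survives. The case j = k = 0 gives the mean value property; general j and k read off Fourier
  coefficients of Poisson kernels.\<close>

lemma circ_coeff:
  fixes c :: "nat \<Rightarrow> complex"
  assumes "summable (\<lambda>n. cmod (c n))"
  shows "integrable circ_measure (\<lambda>w. w ^ j * cnj w ^ k * (\<Sum>n. c n * w ^ n))"
    and "(\<integral>w. w ^ j * cnj w ^ k * (\<Sum>n. c n * w ^ n) \<partial>circ_measure) = (if j \<le> k then c (k - j) else 0)"
proof -
  let ?f = "\<lambda>n w. c n * (w ^ (n + j) * cnj w ^ k)"
  have AEn: "AE w in circ_measure. norm (?f n w) = cmod (c n)" for n
    using AE_circ by (rule eventually_mono) (simp add: norm_mult norm_power)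
  have int: "integrable circ_measure (?f n)" for n
    by (rule circ.integrable_const_bound[of _ "cmod (c n)"]) (use AEn[of n] in \<open>auto elim: eventually_mono\<close>)
  have "(\<integral>w. norm (?f n w) \<partial>circ_measure) = cmod (c n)" for n
  proof -
    have "(\<integral>w. norm (?f n w) \<partial>circ_measure) = (\<integral>w. cmod (c n) \<partial>circ_measure)"
      by (rule integral_cong_AE) (use AEn[of n] in auto)
    then show ?thesis by (simp add: circ.prob_space)
  qed
  then have s1: "summable (\<lambda>n. \<integral>w. norm (?f n w) \<partial>circ_measure)" using assms by simp
  have s2: "AE w in circ_measure. summable (\<lambda>n. norm (?f n w))"
  proof -
    have "AE w in circ_measure. \<forall>n. norm (?f n w) = cmod (c n)" using AEn by (simp add: AE_all_countable)
    then show ?thesis by (rule eventually_mono) (simp add: assms)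
  qed
  have eq: "AE w in circ_measure. (\<Sum>n. ?f n w) = w ^ j * cnj w ^ k * (\<Sum>n. c n * w ^ n)"
    using AE_circ
  proof (rule eventually_mono)
    fix w :: complex assume w: "cmod w = 1"
    have "summable (\<lambda>n. c n * w ^ n)"
      by (rule summable_norm_cancel) (simp add: norm_mult norm_power w assms)
    from suminf_mult[OF this, of "w ^ j * cnj w ^ k"]
    show "(\<Sum>n. ?f n w) = w ^ j * cnj w ^ k * (\<Sum>n. c n * w ^ n)"
      by (simp add: power_add mult_ac)
  qed
  have I: "integrable circ_measure (\<lambda>w. \<Sum>n. ?f n w)" by (rule integrable_suminf[OF int s2 s1])
  show "integrable circ_measure (\<lambda>w. w ^ j * cnj w ^ k * (\<Sum>n. c n * w ^ n))"
    by (subst integrable_cong_AE[OF _ _ eq[THEN AE_symmetric]]) (use I in auto)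
  have "(\<integral>w. w ^ j * cnj w ^ k * (\<Sum>n. c n * w ^ n) \<partial>circ_measure) = (\<integral>w. (\<Sum>n. ?f n w) \<partial>circ_measure)"
    by (rule integral_cong_AE) (use eq in \<open>auto elim: eventually_mono\<close>)
  also have "\<dots> = (\<Sum>n. \<integral>w. ?f n w \<partial>circ_measure)" by (rule integral_suminf[OF int s2 s1])
  also have "\<dots> = (\<Sum>n. c n * (if n + j = k then 1 else 0))"
    by (simp add: circ_moment_cnj del: mult_eq_0_iff)
  also have "\<dots> = (\<Sum>n. if n = k - j then (if j \<le> k then c (k - j) else 0) else 0)"
    by (rule suminf_cong) auto
  also have "\<dots> = (if j \<le> k then c (k - j) else 0)"
    by (subst suminf_finite[of "{k - j}"]) auto
  finally show "(\<integral>w. w ^ j * cnj w ^ k * (\<Sum>n. c n * w ^ n) \<partial>circ_measure) = (if j \<le> k then c (k - j) else 0)" .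
qed

lemma circ_mean_value:
  assumes hol: "f holomorphic_on ball 0 R" and R: "1 < R" and [measurable]: "f \<in> borel_measurable borel"
  shows "integrable circ_measure f" "(\<integral>w. f w \<partial>circ_measure) = f 0"
proof -
  define c where "c n = (deriv ^^ n) f 0 / fact n" for n
  have s: "(\<lambda>n. c n * w ^ n) sums f w" if "cmod w < R" for w
    using holomorphic_power_series[OF hol, of w] that by (simp add: c_def)
  have c: "summable (\<lambda>n. cmod (c n))"
  proof -
    \<comment> \<open>Convergence at a point strictly between 1 and \<open>R\<close> gives absolute
      convergence on the unit circle.\<close>
    define q where "q = (1 + R) / 2"
    have q: "1 < q" "q < R" using R by (auto simp: q_def)
    have "summable (\<lambda>n. c n * complex_of_real q ^ n)" using s[of "complex_of_real q"] q by (auto simp: sums_iff)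
    from powser_insidea[OF this, of 1] q show ?thesis by simp
  qed
  have eq: "AE w in circ_measure. f w = (\<Sum>n. c n * w ^ n)"
    using AE_circ by (rule eventually_mono) (use s R in \<open>auto simp: sums_iff\<close>)
  have [measurable]: "(\<lambda>w. \<Sum>n. c n * w ^ n) \<in> borel_measurable borel" by measurable
  show "integrable circ_measure f"
    by (subst integrable_cong_AE[OF _ _ eq]) (use circ_coeff(1)[OF c, of 0 0] in auto)
  have "(\<integral>w. f w \<partial>circ_measure) = (\<integral>w. (\<Sum>n. c n * w ^ n) \<partial>circ_measure)"
    by (rule integral_cong_AE) (use eq in auto)
  also have "\<dots> = c 0" using circ_coeff(2)[OF c, of 0 0] by simp
  finally show "(\<integral>w. f w \<partial>circ_measure) = f 0" by (simp add: c_def)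
qed

lemma Re_one_minus_pos:
  assumes "cmod (a * w) < 1" shows "0 < Re (1 - a * w)" "1 - a * w \<noteq> 0" "1 - a * w \<notin> \<real>\<^sub>\<le>\<^sub>0"
proof -
  have "Re (a * w) < 1" using complex_Re_le_cmod[of "a * w"] assms by linarith
  then show *: "0 < Re (1 - a * w)" by simp
  then show "1 - a * w \<noteq> 0" by force
  show "1 - a * w \<notin> \<real>\<^sub>\<le>\<^sub>0" using * by (auto simp: complex_nonpos_Reals_iff)
qed

text \<open>The mean value property is proved for functions holomorphic beyond the closed disc, so
  room up to radius 1 / |a| is needed. The case a = 0 is separate, as 1 / 0 is 0.\<close>

lemma circ_mean_value_disc:
  assumes a: "cmod a < 1"
  obtains R where "1 < R" "\<And>w. w \<in> ball 0 R \<Longrightarrow> cmod (a * w) < 1"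
proof (cases "a = 0")
  case False
  show ?thesis
  proof (rule that)
    show "1 < 1 / cmod a" using a False by simp
    show "cmod (a * w) < 1" if "w \<in> ball 0 (1 / cmod a)" for w
      using that False by (simp add: norm_mult field_simps)
  qed
qed (rule that[of 2], auto)

text \<open>Kolmogorov's device: \<open>1 / csqrt (1 - a w)\<close> takes values in the sector of half-angle
  \<open>\<pi> / 4\<close>, so its modulus is controlled by its real part, whose mean is the value at 0.\<close>

lemma circ_fractional_moment:
  assumes a: "cmod a < 1"
  shows "(\<integral>\<^sup>+ w. ennreal (1 / sqrt (cmod (1 - a * w))) \<partial>circ_measure) \<le> ennreal (sqrt 2)"
proof -
  obtain R where R: "1 < R" "\<And>w. w \<in> ball 0 R \<Longrightarrow> cmod (a * w) < 1"
    using circ_mean_value_disc[OF a] by blast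
  let ?f = "\<lambda>w. 1 / csqrt (1 - a * w)"
  have hol: "?f holomorphic_on ball 0 R"
    by (intro holomorphic_intros) (use Re_one_minus_pos[OF R(2)] in auto)
  \<comment> \<open>\<open>csqrt\<close> jumps across the negative axis, so measurability is read
    from explicit real and imaginary parts.\<close>
  have [measurable]: "csqrt \<in> borel_measurable borel"
  proof -
    show ?thesis unfolding csqrt.code[abs_def] Complex_eq by measurable
  qed
  note mv = circ_mean_value[OF hol R(1)]
  have int: "integrable circ_measure (\<lambda>w. sqrt 2 * Re (?f w))"
    by (intro integrable_mult_right integrable_Re mv) measurable
  have pos: "1 / sqrt (cmod (1 - a * w)) \<le> sqrt 2 * Re (?f w)" if "cmod w = 1" for w
  proof -
    define s where "s = csqrt (1 - a * w)"
    have aw: "cmod (a * w) < 1" using a that by (simp add: norm_mult)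
    have s2: "s\<^sup>2 = 1 - a * w" by (simp add: s_def)
    have s0: "s \<noteq> 0" using Re_one_minus_pos(2)[OF aw] s2 by force
    have x: "0 \<le> Re s" unfolding s_def using csqrt_principal[of "1 - a * w"] by linarith
    \<comment> \<open>A square with positive real part has |Im s| < |Re s|, so |s|^2 is below 2 (Re
      s)^2: this is the origin of \<open>sqrt 2\<close>.\<close>
    have "0 < Re (s\<^sup>2)" using Re_one_minus_pos(1)[OF aw] s2 by simp
    then have "(Im s)\<^sup>2 < (Re s)\<^sup>2" by (simp add: power2_eq_square)
    then have "(cmod s)\<^sup>2 \<le> (sqrt 2 * Re s)\<^sup>2" by (simp add: cmod_power2 power_mult_distrib)
    then have le: "cmod s \<le> sqrt 2 * Re s" by (rule power2_le_imp_le) (use x in simp)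
    have "cmod s = sqrt (cmod (1 - a * w))" unfolding s_def by simp
    then have "1 / sqrt (cmod (1 - a * w)) = 1 / cmod s" by (simp only:)
    also have "\<dots> = cmod s / (cmod s)\<^sup>2" using s0 by (simp add: power2_eq_square)
    also have "\<dots> \<le> sqrt 2 * Re s / (cmod s)\<^sup>2" by (rule divide_right_mono[OF le]) simp
    also have "\<dots> = sqrt 2 * Re (1 / s)" by (simp add: Re_divide cmod_power2)
    finally show ?thesis by (simp add: s_def)
  qed
  have "(\<integral>\<^sup>+ w. ennreal (1 / sqrt (cmod (1 - a * w))) \<partial>circ_measure) \<le> (\<integral>\<^sup>+ w. ennreal (sqrt 2 * Re (?f w)) \<partial>circ_measure)"
    by (rule nn_integral_mono_AE) (use AE_circ pos in \<open>auto elim!: eventually_mono intro!: ennreal_leI\<close>)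
  also have "\<dots> = ennreal (\<integral>w. sqrt 2 * Re (?f w) \<partial>circ_measure)"
  proof (rule nn_integral_eq_integral[OF int])
    show "AE w in circ_measure. 0 \<le> sqrt 2 * Re (?f w)"
      using AE_circ by (rule eventually_mono) (rule order_trans[OF _ pos], simp_all)
  qed
  also have "(\<integral>w. sqrt 2 * Re (?f w) \<partial>circ_measure) = sqrt 2 * Re (\<integral>w. ?f w \<partial>circ_measure)"
    using mv(1) by simp
  also have "\<dots> = sqrt 2" using mv(2) by simp
  finally show ?thesis .
qed

text \<open>On the unit circle (1 - |a|^2) / |1 - a w|^2 equals 2 Re (1 / (1 - a w)) - 1, the
  Poisson kernel, whose mean is its value 1 at the origin.\<close>

lemma circ_Poisson:
  assumes a: "cmod a < 1"
  shows "(\<integral>\<^sup>+ w. ennreal (1 / (cmod (1 - a * w))\<^sup>2) \<partial>circ_measure) = ennreal (1 / (1 - (cmod a)\<^sup>2))"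
proof -
  obtain R where R: "1 < R" "\<And>w. w \<in> ball 0 R \<Longrightarrow> cmod (a * w) < 1"
    using circ_mean_value_disc[OF a] by blast
  let ?f = "\<lambda>w. 1 / (1 - a * w)"
  have hol: "?f holomorphic_on ball 0 R"
    by (intro holomorphic_intros) (use Re_one_minus_pos[OF R(2)] in auto)
  note mv = circ_mean_value[OF hol R(1)]
  have a2: "0 < 1 - (cmod a)\<^sup>2" using a by (simp add: power_less_one_iff abs_square_less_1)
  let ?g = "\<lambda>w. (2 * Re (?f w) - 1) / (1 - (cmod a)\<^sup>2)"
  have eq: "1 / (cmod (1 - a * w))\<^sup>2 = ?g w" if w: "cmod w = 1" for w
  proof -
    have aw: "cmod (a * w) < 1" using a that by (simp add: norm_mult)
    let ?u = "1 - a * w"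
    have u0: "cmod ?u \<noteq> 0" using Re_one_minus_pos(2)[OF aw] by simp
    have id: "2 * Re (1 - b) - (cmod (1 - b))\<^sup>2 = 1 - (cmod b)\<^sup>2" for b
      unfolding cmod_power2 by (simp add: power2_eq_square algebra_simps)
    have *: "2 * Re ?u - (cmod ?u)\<^sup>2 = 1 - (cmod a)\<^sup>2"
      using id[of "a * w"] w by (simp only: norm_mult mult_1_right)
    have "Re (1 / ?u) = Re ?u / (cmod ?u)\<^sup>2" by (simp add: Re_divide cmod_power2)
    then have "2 * Re (1 / ?u) - 1 = (2 * Re ?u - (cmod ?u)\<^sup>2) / (cmod ?u)\<^sup>2"
      using u0 by (simp add: diff_divide_distrib)
    then show ?thesis unfolding * using a2 by simp
  qed
  have int: "integrable circ_measure ?g"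
    by (intro integrable_divide Bochner_Integration.integrable_diff integrable_mult_right integrable_Re mv) simp_all
  have "(\<integral>\<^sup>+ w. ennreal (1 / (cmod (1 - a * w))\<^sup>2) \<partial>circ_measure) = (\<integral>\<^sup>+ w. ennreal (?g w) \<partial>circ_measure)"
    by (rule nn_integral_cong_AE) (use AE_circ eq in \<open>auto elim!: eventually_mono\<close>)
  also have "\<dots> = ennreal (\<integral>w. ?g w \<partial>circ_measure)"
  proof (rule nn_integral_eq_integral[OF int])
    show "AE w in circ_measure. 0 \<le> ?g w"
      using AE_circ by (rule eventually_mono) (simp flip: eq)
  qed
  also have "(\<integral>w. ?g w \<partial>circ_measure) = (2 * Re (\<integral>w. ?f w \<partial>circ_measure) - 1) / (1 - (cmod a)\<^sup>2)"
    using mv(1) by (simp add: circ.prob_space)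
  also have "\<dots> = 1 / (1 - (cmod a)\<^sup>2)" using mv(2) by simp
  finally show ?thesis .
qed

subsection \<open>Averaging over a single site\<close>

interpretation P: prob_space Pmeas
  unfolding Pmeas_def by (intro prob_space_PiM prob_space_circ)

lemma measurable_Pmeas_component: "(\<lambda>\<omega>. \<omega> \<kappa>) \<in> borel_measurable Pmeas"
  using measurable_component_singleton[of \<kappa> UNIV "\<lambda>_. circ_measure"]
  by (simp add: Pmeas_def measurable_cong_sets[OF refl sets_circ_measure])

lemma AE_Pmeas: "AE \<omega> in Pmeas. \<forall>\<kappa>. cmod (\<omega> \<kappa>) = 1"
  unfolding AE_all_countable Pmeas_def
  by (intro allI AE_PiM_component[where P = "\<lambda>z. cmod z = 1"] prob_space_circ AE_circ) auto

text \<open>Replacing one coordinate by an independent copy preserves the product measure. This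
  expresses conditioning on all other phases as an inner integral, without splitting the index
  set.\<close>

lemma nn_integral_Pmeas_resample:
  assumes f [measurable]: "f \<in> borel_measurable Pmeas"
  shows "(\<integral>\<^sup>+ \<omega>. f \<omega> \<partial>Pmeas) = (\<integral>\<^sup>+ \<omega>. (\<integral>\<^sup>+ t. f (\<omega> (\<mu> := t)) \<partial>circ_measure) \<partial>Pmeas)"
proof -
  let ?h = "\<lambda>(t, \<omega>). (\<omega> :: vec) (\<mu> := t)"
  have distr: "distr (circ_measure \<Otimes>\<^sub>M Pmeas) Pmeas ?h = Pmeas"
    using distr_pair_PiM_eq_PiM[of UNIV "\<lambda>_. circ_measure" \<mu>] prob_space_circ by (simp add: Pmeas_def)
  have h [measurable]: "?h \<in> circ_measure \<Otimes>\<^sub>M Pmeas \<rightarrow>\<^sub>M Pmeas"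
    unfolding Pmeas_def split_beta' by (rule measurable_fun_upd[where I = UNIV]) auto
  interpret pair_sigma_finite circ_measure Pmeas ..
  have "(\<integral>\<^sup>+ \<omega>. f \<omega> \<partial>Pmeas) = (\<integral>\<^sup>+ x. f (?h x) \<partial>(circ_measure \<Otimes>\<^sub>M Pmeas))"
    by (subst distr[symmetric]) (rule nn_integral_distr, measurable)
  also have "\<dots> = (\<integral>\<^sup>+ \<omega>. (\<integral>\<^sup>+ t. f (?h (t, \<omega>)) \<partial>circ_measure) \<partial>Pmeas)"
    by (rule nn_integral_snd[symmetric]) measurable
  finally show ?thesis by simp
qed

lemma measurable_CCop_pow:
  assumes "\<And>\<kappa>. (\<lambda>x. g x \<kappa>) \<in> borel_measurable M"
  shows "(\<lambda>x. (CCop (g x) \<phi> ^^ n) (ebasis \<mu>) \<nu>) \<in> borel_measurable M"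
proof (induction n arbitrary: \<nu>)
  case (Suc n)
  have "(CCop (g x) \<phi> ^^ Suc n) (ebasis \<mu>) \<nu> = g x \<nu> *
      (complex_of_real (cos \<phi>) * (CCop (g x) \<phi> ^^ n) (ebasis \<mu>) (bwdL \<nu>)
        + \<i> * complex_of_real (sin \<phi>) * (CCop (g x) \<phi> ^^ n) (ebasis \<mu>) (bwdR \<nu>))" for x
    by (simp add: CCop_def[of _ _ "(CCop (g x) \<phi> ^^ n) (ebasis \<mu>)"] Sop_def)
  then show ?case
    by (simp only:) (intro borel_measurable_times borel_measurable_add borel_measurable_const assms Suc)
qed simp

lemma measurable_Gr:
  assumes "\<And>\<kappa>. (\<lambda>x. g x \<kappa>) \<in> borel_measurable M"
  shows "(\<lambda>x. Gr (g x) \<phi> \<mu> \<nu>) \<in> borel_measurable M"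
  unfolding Gr_def by (rule borel_measurable_suminf) (rule measurable_CCop_pow[OF assms])

text \<open>A vanishing phase decouples a site, so that \<open>\<Lambda>\<close> is removed from the lattice.\<close>

definition rem :: "site set \<Rightarrow> complex \<Rightarrow> vec \<Rightarrow> vec" where
  "rem \<Lambda> z \<omega> = (\<lambda>\<kappa>. if \<kappa> \<in> \<Lambda> then 0 else z * \<omega> \<kappa>)"

lemma measurable_Gr_rem [measurable]: "(\<lambda>\<omega>. Gr (rem \<Lambda> z \<omega>) \<phi> \<mu> \<nu>) \<in> borel_measurable Pmeas"
proof (rule measurable_Gr)
  show "(\<lambda>\<omega>. rem \<Lambda> z \<omega> \<kappa>) \<in> borel_measurable Pmeas" for \<kappa>
    by (cases "\<kappa> \<in> \<Lambda>") (auto simp: rem_def intro!: borel_measurable_times measurable_Pmeas_component)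
qed

lemma rem_upd: "\<mu> \<notin> \<Lambda> \<Longrightarrow> rem \<Lambda> z (\<omega> (\<mu> := t)) = (rem \<Lambda> z \<omega>) (\<mu> := z * t)"
  by (auto simp: rem_def)

lemma rem_insert: "rem (insert \<mu> \<Lambda>) z \<omega> = (rem \<Lambda> z \<omega>) (\<mu> := 0)"
  by (auto simp: rem_def)

lemma rem_bound: "(\<And>\<kappa>. cmod (\<omega> \<kappa>) = 1) \<Longrightarrow> cmod (rem \<Lambda> z \<omega> \<kappa>) \<le> cmod z"
  by (simp add: rem_def norm_mult)

context
  fixes \<omega> :: vec and z :: complex and \<Lambda> :: "site set" and \<mu> \<nu> :: site and \<phi> :: real
  assumes unit: "\<And>\<kappa>. cmod (\<omega> \<kappa>) = 1" and z: "cmod z < 1" and \<mu>: "\<mu> \<notin> \<Lambda>"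
begin

text \<open>Since \<open>\<mu>\<close> is among the removed sites, \<open>x0\<close> and
  \<open>a0\<close> do not depend on the phase at \<open>\<mu>\<close>: they are constants for the
  integral over that phase.\<close>

definition "x0 = Gr (rem (insert \<mu> \<Lambda>) z \<omega>) \<phi> \<mu>"
definition "a0 = z * Sop \<phi> x0 \<mu>"

text \<open>The energy inequality has two uses. As the norm of \<open>x0\<close> is at least |x0
  \<mu>| = 1, it gives |a0| < 1 strictly; and it bounds below the quantity 1 - |a0|^2 by which the
  Poisson mean divides.\<close>

lemma x0_props:
  "ell2 x0" "x0 \<mu> = 1" "(1 - (cmod z)\<^sup>2) * (l2norm x0)\<^sup>2 \<le> 1 - (cmod a0)\<^sup>2" "cmod a0 < 1"
proof -
  have b: "cmod (rem (insert \<mu> \<Lambda>) z \<omega> \<kappa>) \<le> cmod z" for \<kappa> by (rule rem_bound[OF unit])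
  show "ell2 x0" unfolding x0_def by (rule Gr_ell2(1)[OF b z])
  have 0: "rem (insert \<mu> \<Lambda>) z \<omega> \<mu> = 0" by (simp add: rem_def)
  note e = Gr_removed_energy[of "rem (insert \<mu> \<Lambda>) z \<omega>" "cmod z" \<mu> \<phi>, OF b z 0]
  show x1: "x0 \<mu> = 1" using e(1) by (simp add: x0_def)
  show le: "(1 - (cmod z)\<^sup>2) * (l2norm x0)\<^sup>2 \<le> 1 - (cmod a0)\<^sup>2"
    using e(2) by (simp add: x0_def a0_def norm_mult power_mult_distrib)
  have "0 < 1 - (cmod z)\<^sup>2" using z by (simp add: abs_square_less_1)
  moreover have "1 \<le> (l2norm x0)\<^sup>2" using cmod_le_l2norm[OF \<open>ell2 x0\<close>, of \<mu>] x1 by simp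
  ultimately have "0 < (1 - (cmod z)\<^sup>2) * (l2norm x0)\<^sup>2" by (intro mult_pos_pos) auto
  with le have "(cmod a0)\<^sup>2 < 1" by linarith
  then show "cmod a0 < 1" by (simp add: abs_square_less_1)
qed

lemma Gr_one_site:
  assumes "cmod t = 1"
  shows "Gr (rem \<Lambda> z (\<omega> (\<mu> := t))) \<phi> \<mu> \<nu> = x0 \<nu> / (1 - a0 * t)"
proof -
  have "cmod (z * t) \<le> cmod z" by (simp add: norm_mult assms)
  from Gr_rank_one[of "rem \<Lambda> z \<omega>" "cmod z" "z * t" \<mu> \<phi> \<nu>, OF rem_bound[OF unit] this z] show ?thesis
    unfolding rem_upd[OF \<mu>] by (simp add: x0_def a0_def rem_insert mult_ac)
qed

lemma one_site_fractional_moment: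
  "(\<integral>\<^sup>+ t. ennreal (sqrt (cmod (Gr (rem \<Lambda> z (\<omega> (\<mu> := t))) \<phi> \<mu> \<nu>))) \<partial>circ_measure)
    \<le> ennreal (sqrt 2) * ennreal (sqrt (cmod (x0 \<nu>)))"
proof -
  have "(\<integral>\<^sup>+ t. ennreal (sqrt (cmod (Gr (rem \<Lambda> z (\<omega> (\<mu> := t))) \<phi> \<mu> \<nu>))) \<partial>circ_measure)
      = (\<integral>\<^sup>+ t. ennreal (sqrt (cmod (x0 \<nu>))) * ennreal (1 / sqrt (cmod (1 - a0 * t))) \<partial>circ_measure)"
    by (rule nn_integral_cong_AE)
       (use AE_circ in \<open>auto elim!: eventually_mono simp: Gr_one_site norm_divide real_sqrt_divide simp flip: ennreal_mult\<close>)
  also have "\<dots> = ennreal (sqrt (cmod (x0 \<nu>))) * (\<integral>\<^sup>+ t. ennreal (1 / sqrt (cmod (1 - a0 * t))) \<partial>circ_measure)"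
    by (rule nn_integral_cmult) measurable
  also have "\<dots> \<le> ennreal (sqrt (cmod (x0 \<nu>))) * ennreal (sqrt 2)"
    by (intro mult_left_mono circ_fractional_moment x0_props) auto
  finally show ?thesis by (simp add: mult.commute)
qed

text \<open>The Poisson mean divides by 1 - |a0|^2, and the energy inequality reduces the result to
  (q / n)^2, with q = |x0 \<nu>| and n \<ge> 1 the norm of \<open>x0\<close>. Since q \<le> n, this
  is at most 1 and at most q^2, hence at most \<open>sqrt q\<close>. So a second moment, weighted by
  1 - |z|^2, is controlled by a fractional one, uniformly in z.\<close>

lemma one_site_second_moment:
  "(\<integral>\<^sup>+ t. ennreal ((1 - (cmod z)\<^sup>2) * (cmod (Gr (rem \<Lambda> z (\<omega> (\<mu> := t))) \<phi> \<mu> \<nu>))\<^sup>2) \<partial>circ_measure)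
    \<le> ennreal (sqrt (cmod (x0 \<nu>)))"
proof -
  have z2: "0 < 1 - (cmod z)\<^sup>2" using z by (simp add: abs_square_less_1)
  have a2: "0 < 1 - (cmod a0)\<^sup>2" using x0_props(4) by (simp add: abs_square_less_1)
  have n1: "1 \<le> l2norm x0" using cmod_le_l2norm[OF x0_props(1), of \<mu>] x0_props(2) by simp
  have "(\<integral>\<^sup>+ t. ennreal ((1 - (cmod z)\<^sup>2) * (cmod (Gr (rem \<Lambda> z (\<omega> (\<mu> := t))) \<phi> \<mu> \<nu>))\<^sup>2) \<partial>circ_measure)
      = (\<integral>\<^sup>+ t. ennreal ((1 - (cmod z)\<^sup>2) * (cmod (x0 \<nu>))\<^sup>2) * ennreal (1 / (cmod (1 - a0 * t))\<^sup>2) \<partial>circ_measure)"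
    by (rule nn_integral_cong_AE)
       (use AE_circ z2 in \<open>auto elim!: eventually_mono simp: Gr_one_site norm_divide power_divide simp flip: ennreal_mult\<close>)
  also have "\<dots> = ennreal ((1 - (cmod z)\<^sup>2) * (cmod (x0 \<nu>))\<^sup>2) * ennreal (1 / (1 - (cmod a0)\<^sup>2))"
    by (subst nn_integral_cmult) (auto simp: circ_Poisson[OF x0_props(4)])
  also have "\<dots> = ennreal ((1 - (cmod z)\<^sup>2) * (cmod (x0 \<nu>))\<^sup>2 / (1 - (cmod a0)\<^sup>2))"
    using z2 a2 by (simp flip: ennreal_mult)
  also have "\<dots> \<le> ennreal (sqrt (cmod (x0 \<nu>)))"
  proof (rule ennreal_leI)
    define q where "q = cmod (x0 \<nu>)"
    have q0: "0 \<le> q" and ql: "q \<le> l2norm x0" unfolding q_def using cmod_le_l2norm[OF x0_props(1)] by auto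
    have "(1 - (cmod z)\<^sup>2) * q\<^sup>2 / (1 - (cmod a0)\<^sup>2) \<le> (1 - (cmod z)\<^sup>2) * q\<^sup>2 / ((1 - (cmod z)\<^sup>2) * (l2norm x0)\<^sup>2)"
      using z2 a2 n1 by (intro divide_left_mono x0_props(3) mult_nonneg_nonneg mult_pos_pos) auto
    also have "\<dots> = (q / l2norm x0)\<^sup>2" using z2 by (simp add: power_divide)
    also have "\<dots> \<le> sqrt q"
    proof (cases "q \<le> 1")
      case True
      have "(q / l2norm x0)\<^sup>2 \<le> q\<^sup>2"
        using n1 q0 by (intro power_mono) (auto simp: divide_le_eq mult_le_cancel_left1)
      also have "\<dots> \<le> q" using q0 True by (simp add: power2_eq_square mult_left_le)
      also have "\<dots> \<le> sqrt q" using q0 True by (intro real_le_rsqrt) (simp add: power2_eq_square mult_left_le)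
      finally show ?thesis .
    next
      case False
      have "(q / l2norm x0)\<^sup>2 \<le> 1" using n1 q0 ql by (intro power_le_one) (auto simp: divide_le_eq)
      also have "\<dots> \<le> sqrt q" using False by simp
      finally show ?thesis .
    qed
    finally show "(1 - (cmod z)\<^sup>2) * (cmod (x0 \<nu>))\<^sup>2 / (1 - (cmod a0)\<^sup>2) \<le> sqrt (cmod (x0 \<nu>))"
      unfolding q_def .
  qed
  finally show ?thesis .
qed

text \<open>Subadditivity of the square root in \<open>Gr_step\<close>. A removed neighbour enters
  with phase 0, so its term is absent; the other phases have modulus at most 1 and are
  dropped.\<close>

lemma sqrt_x0_le:
  "sqrt (cmod (x0 \<nu>)) \<le> (if \<mu> = \<nu> then 1 else 0)
    + sqrt \<bar>cos \<phi>\<bar> * (if fwdL \<mu> \<in> insert \<mu> \<Lambda> then 0 else sqrt (cmod (Gr (rem (insert \<mu> \<Lambda>) z \<omega>) \<phi> (fwdL \<mu>) \<nu>)))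
    + sqrt \<bar>sin \<phi>\<bar> * (if fwdR \<mu> \<in> insert \<mu> \<Lambda> then 0 else sqrt (cmod (Gr (rem (insert \<mu> \<Lambda>) z \<omega>) \<phi> (fwdR \<mu>) \<nu>)))"
proof -
  let ?w = "rem (insert \<mu> \<Lambda>) z \<omega>"
  define u where "u = complex_of_real (cos \<phi>) * ?w (fwdL \<mu>) * Gr ?w \<phi> (fwdL \<mu>) \<nu>"
  define v where "v = \<i> * complex_of_real (sin \<phi>) * ?w (fwdR \<mu>) * Gr ?w \<phi> (fwdR \<mu>) \<nu>"
  have b: "cmod (?w \<kappa>) \<le> cmod z" for \<kappa> by (rule rem_bound[OF unit])
  then have b1: "cmod (?w \<kappa>) \<le> 1" for \<kappa> using z order_trans[OF b] by (meson less_imp_le)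
  have x: "x0 \<nu> = ebasis \<mu> \<nu> + (u + v)"
    using fun_cong[OF Gr_step[of ?w "cmod z" \<phi> \<mu>, OF b z], of \<nu>] by (simp add: x0_def u_def v_def)
  have "cmod (x0 \<nu>) \<le> cmod (ebasis \<mu> \<nu>) + (cmod u + cmod v)"
    unfolding x by (meson add_left_mono norm_triangle_ineq order_trans)
  then have "sqrt (cmod (x0 \<nu>)) \<le> sqrt (cmod (ebasis \<mu> \<nu>) + (cmod u + cmod v))" by simp
  also have "\<dots> \<le> sqrt (cmod (ebasis \<mu> \<nu>)) + sqrt (cmod u + cmod v)"
    by (rule sqrt_add_le_add_sqrt) auto
  also have "sqrt (cmod u + cmod v) \<le> sqrt (cmod u) + sqrt (cmod v)"
    by (rule sqrt_add_le_add_sqrt) auto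
  finally have main: "sqrt (cmod (x0 \<nu>)) \<le> sqrt (cmod (ebasis \<mu> \<nu>)) + sqrt (cmod u) + sqrt (cmod v)" by simp
  have le: "sqrt (s * cmod (?w \<kappa>) * g) \<le> sqrt s * (if \<kappa> \<in> insert \<mu> \<Lambda> then 0 else sqrt g)"
    if "0 \<le> s" "0 \<le> g" for s g \<kappa>
  proof (cases "\<kappa> \<in> insert \<mu> \<Lambda>")
    case True
    then have "?w \<kappa> = 0" by (auto simp: rem_def)
    then show ?thesis using True by auto
  next
    case False
    have "sqrt (cmod (?w \<kappa>)) \<le> 1" using b1 by simp
    then have "sqrt s * sqrt (cmod (?w \<kappa>)) * sqrt g \<le> sqrt s * 1 * sqrt g"
      using that by (intro mult_right_mono mult_left_mono) auto
    with False show ?thesis by (simp add: real_sqrt_mult)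
  qed
  have "sqrt (cmod u) \<le> sqrt \<bar>cos \<phi>\<bar> * (if fwdL \<mu> \<in> insert \<mu> \<Lambda> then 0 else sqrt (cmod (Gr ?w \<phi> (fwdL \<mu>) \<nu>)))"
    unfolding u_def norm_mult norm_of_real by (rule le) auto
  moreover have "sqrt (cmod v) \<le> sqrt \<bar>sin \<phi>\<bar> * (if fwdR \<mu> \<in> insert \<mu> \<Lambda> then 0 else sqrt (cmod (Gr ?w \<phi> (fwdR \<mu>) \<nu>)))"
    unfolding v_def norm_mult norm_of_real norm_ii mult_1 by (rule le) auto
  moreover have "sqrt (cmod (ebasis \<mu> \<nu>)) = (if \<mu> = \<nu> then 1 else 0)" by (auto simp: ebasis_def)
  ultimately show ?thesis using main by linarith
qed

end

subsection \<open>Decay of fractional moments\<close>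

text \<open>On removed sites the resolvent itself does not vanish: its diagonal entry is 1. The
  value 0 is a convention, consistent because in \<open>Gr_step\<close> such a site is multiplied by
  a vanishing phase.\<close>

definition FM :: "real \<Rightarrow> complex \<Rightarrow> site \<Rightarrow> site set \<Rightarrow> site \<Rightarrow> ennreal" where
  "FM \<phi> z \<nu> \<Lambda> \<mu> = (if \<mu> \<in> \<Lambda> then 0 else \<integral>\<^sup>+ \<omega>. ennreal (sqrt (cmod (Gr (rem \<Lambda> z \<omega>) \<phi> \<mu> \<nu>))) \<partial>Pmeas)"

text \<open>Kept apart from \<open>FM_step\<close> because the second moment, after averaging over
  the source phase, is bounded by the same integral.\<close>

lemma FM_expand:
  assumes z: "cmod z < 1" and \<mu>: "\<mu> \<notin> \<Lambda>"
  shows "(\<integral>\<^sup>+ \<omega>. ennreal (sqrt (cmod (Gr (rem (insert \<mu> \<Lambda>) z \<omega>) \<phi> \<mu> \<nu>))) \<partial>Pmeas)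
    \<le> ennreal (if \<mu> = \<nu> then 1 else 0) + ennreal (sqrt \<bar>cos \<phi>\<bar>) * FM \<phi> z \<nu> (insert \<mu> \<Lambda>) (fwdL \<mu>)
      + ennreal (sqrt \<bar>sin \<phi>\<bar>) * FM \<phi> z \<nu> (insert \<mu> \<Lambda>) (fwdR \<mu>)"
proof -
  define \<Lambda>' where "\<Lambda>' = insert \<mu> \<Lambda>"
  define g where "g \<kappa> \<omega> = (if \<kappa> \<in> \<Lambda>' then 0 else sqrt (cmod (Gr (rem \<Lambda>' z \<omega>) \<phi> \<kappa> \<nu>)))" for \<kappa> \<omega>
  define e :: real where "e = (if \<mu> = \<nu> then 1 else 0)"
  have [measurable]: "g \<kappa> \<in> borel_measurable Pmeas" for \<kappa>
    unfolding g_def by (cases "\<kappa> \<in> \<Lambda>'") simp_all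
  have pos: "0 \<le> g \<kappa> \<omega>" "0 \<le> e" for \<kappa> \<omega> by (auto simp: g_def e_def)
  have FM: "FM \<phi> z \<nu> \<Lambda>' \<kappa> = (\<integral>\<^sup>+ \<omega>. ennreal (g \<kappa> \<omega>) \<partial>Pmeas)" for \<kappa> by (simp add: FM_def g_def)
  have "(\<integral>\<^sup>+ \<omega>. ennreal (sqrt (cmod (Gr (rem \<Lambda>' z \<omega>) \<phi> \<mu> \<nu>))) \<partial>Pmeas)
    \<le> (\<integral>\<^sup>+ \<omega>. ennreal e + ennreal (sqrt \<bar>cos \<phi>\<bar>) * ennreal (g (fwdL \<mu>) \<omega>)
        + ennreal (sqrt \<bar>sin \<phi>\<bar>) * ennreal (g (fwdR \<mu>) \<omega>) \<partial>Pmeas)"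
  proof (rule nn_integral_mono_AE, use AE_Pmeas in \<open>rule eventually_mono\<close>)
    fix \<omega> :: vec assume "\<forall>\<kappa>. cmod (\<omega> \<kappa>) = 1"
    then have unit: "\<And>\<kappa>. cmod (\<omega> \<kappa>) = 1" by blast
    have "sqrt (cmod (Gr (rem \<Lambda>' z \<omega>) \<phi> \<mu> \<nu>))
        \<le> e + sqrt \<bar>cos \<phi>\<bar> * g (fwdL \<mu>) \<omega> + sqrt \<bar>sin \<phi>\<bar> * g (fwdR \<mu>) \<omega>"
      using sqrt_x0_le[of \<omega> z \<mu> \<Lambda> \<phi> \<nu>, OF unit z \<mu>]
      unfolding x0_def[of \<omega> z \<mu> \<Lambda> \<phi>, OF unit z \<mu>] \<Lambda>'_def[symmetric] g_def e_def .
    from ennreal_leI[OF this]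
    show "ennreal (sqrt (cmod (Gr (rem \<Lambda>' z \<omega>) \<phi> \<mu> \<nu>))) \<le> ennreal e
       + ennreal (sqrt \<bar>cos \<phi>\<bar>) * ennreal (g (fwdL \<mu>) \<omega>) + ennreal (sqrt \<bar>sin \<phi>\<bar>) * ennreal (g (fwdR \<mu>) \<omega>)"
      by (simp add: ennreal_plus ennreal_mult pos)
  qed
  also have "\<dots> = ennreal e + ennreal (sqrt \<bar>cos \<phi>\<bar>) * FM \<phi> z \<nu> \<Lambda>' (fwdL \<mu>)
      + ennreal (sqrt \<bar>sin \<phi>\<bar>) * FM \<phi> z \<nu> \<Lambda>' (fwdR \<mu>)"
    unfolding FM by (simp add: nn_integral_add nn_integral_cmult P.emeasure_space_1[simplified])
  finally show ?thesis unfolding \<Lambda>'_def e_def .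
qed

text \<open>Averaging over the phase at \<open>\<mu>\<close> costs \<open>sqrt 2\<close> and leaves
  \<open>\<mu>\<close> removed; only then is the resolvent expanded. The growing set of removed
  sites makes the recursion self-avoiding.\<close>

lemma FM_step:
  assumes z: "cmod z < 1"
  shows "FM \<phi> z \<nu> \<Lambda> \<mu> \<le> ennreal (sqrt 2) * (ennreal (if \<mu> = \<nu> then 1 else 0)
      + ennreal (sqrt \<bar>cos \<phi>\<bar>) * FM \<phi> z \<nu> (insert \<mu> \<Lambda>) (fwdL \<mu>)
      + ennreal (sqrt \<bar>sin \<phi>\<bar>) * FM \<phi> z \<nu> (insert \<mu> \<Lambda>) (fwdR \<mu>))"
proof (cases "\<mu> \<in> \<Lambda>")
  case False
  let ?f = "\<lambda>\<Lambda> \<omega>. ennreal (sqrt (cmod (Gr (rem \<Lambda> z \<omega>) \<phi> \<mu> \<nu>)))"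
  have "FM \<phi> z \<nu> \<Lambda> \<mu> = (\<integral>\<^sup>+ \<omega>. (\<integral>\<^sup>+ t. ?f \<Lambda> (\<omega> (\<mu> := t)) \<partial>circ_measure) \<partial>Pmeas)"
    using False by (simp add: FM_def) (rule nn_integral_Pmeas_resample, measurable)
  also have "\<dots> \<le> (\<integral>\<^sup>+ \<omega>. ennreal (sqrt 2) * ?f (insert \<mu> \<Lambda>) \<omega> \<partial>Pmeas)"
  proof (rule nn_integral_mono_AE, use AE_Pmeas in \<open>rule eventually_mono\<close>)
    fix \<omega> :: vec assume "\<forall>\<kappa>. cmod (\<omega> \<kappa>) = 1"
    then have unit: "\<And>\<kappa>. cmod (\<omega> \<kappa>) = 1" by blast
    show "(\<integral>\<^sup>+ t. ?f \<Lambda> (\<omega> (\<mu> := t)) \<partial>circ_measure) \<le> ennreal (sqrt 2) * ?f (insert \<mu> \<Lambda>) \<omega>"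
      using one_site_fractional_moment[of \<omega> z \<mu> \<Lambda> \<phi> \<nu>, OF unit z False]
      unfolding x0_def[of \<omega> z \<mu> \<Lambda> \<phi>, OF unit z False] .
  qed
  also have "\<dots> = ennreal (sqrt 2) * (\<integral>\<^sup>+ \<omega>. ?f (insert \<mu> \<Lambda>) \<omega> \<partial>Pmeas)"
    by (rule nn_integral_cmult) measurable
  also have "\<dots> \<le> ennreal (sqrt 2) * (ennreal (if \<mu> = \<nu> then 1 else 0)
      + ennreal (sqrt \<bar>cos \<phi>\<bar>) * FM \<phi> z \<nu> (insert \<mu> \<Lambda>) (fwdL \<mu>)
      + ennreal (sqrt \<bar>sin \<phi>\<bar>) * FM \<phi> z \<nu> (insert \<mu> \<Lambda>) (fwdR \<mu>))"
    by (intro mult_left_mono FM_expand z False) auto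
  finally show ?thesis .
qed (simp add: FM_def)

text \<open>An a priori bound, useless as |z| tends to 1. It makes the moments finite and starts an
  iteration whose limit no longer sees it.\<close>

lemma FM_bounded:
  assumes z: "cmod z < 1"
  shows "FM \<phi> z \<nu> \<Lambda> \<mu> \<le> ennreal (sqrt (1 / (1 - cmod z)))"
proof (cases "\<mu> \<in> \<Lambda>")
  case False
  have "(\<integral>\<^sup>+ \<omega>. ennreal (sqrt (cmod (Gr (rem \<Lambda> z \<omega>) \<phi> \<mu> \<nu>))) \<partial>Pmeas)
      \<le> (\<integral>\<^sup>+ \<omega>. ennreal (sqrt (1 / (1 - cmod z))) \<partial>Pmeas)"
  proof (rule nn_integral_mono_AE, use AE_Pmeas in \<open>rule eventually_mono\<close>)
    fix \<omega> :: vec assume "\<forall>\<kappa>. cmod (\<omega> \<kappa>) = 1"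
    then have b: "cmod (rem \<Lambda> z \<omega> \<kappa>) \<le> cmod z" for \<kappa> by (intro rem_bound) auto
    have "cmod (Gr (rem \<Lambda> z \<omega>) \<phi> \<mu> \<nu>) \<le> 1 / (1 - cmod z)"
      using cmod_le_l2norm[OF Gr_ell2(1)[of "rem \<Lambda> z \<omega>" "cmod z" \<phi> \<mu>, OF b z], of \<nu>]
        Gr_ell2(2)[of "rem \<Lambda> z \<omega>" "cmod z" \<phi> \<mu>, OF b z] by linarith
    then show "ennreal (sqrt (cmod (Gr (rem \<Lambda> z \<omega>) \<phi> \<mu> \<nu>))) \<le> ennreal (sqrt (1 / (1 - cmod z)))"
      by (intro ennreal_leI) simp
  qed
  then show ?thesis using False by (simp add: FM_def P.emeasure_space_1[simplified])
qed (simp add: FM_def)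

text \<open>In the self-avoiding recursion four consecutive moves of the same kind close up on a removed
  site. So every surviving chain of length four contains a factor \<open>a * b\<close>.\<close>

lemma chain_bound:
  fixes y :: "'s set \<Rightarrow> 's \<Rightarrow> real" and f g :: "'s \<Rightarrow> 's" and e :: "'s \<Rightarrow> real"
  assumes C: "1 \<le> C" and a: "0 \<le> a" "a \<le> 1" and b: "0 \<le> b" and E: "0 \<le> E" "0 \<le> B"
    and y0: "\<And>\<Lambda> \<mu>. 0 \<le> y \<Lambda> \<mu>" and dead: "\<And>\<Lambda> \<mu>. \<mu> \<in> \<Lambda> \<Longrightarrow> y \<Lambda> \<mu> = 0"
    and step: "\<And>\<Lambda> \<mu>. y \<Lambda> \<mu> \<le> C * (e \<mu> + a * y (insert \<mu> \<Lambda>) (f \<mu>) + b * y (insert \<mu> \<Lambda>) (g \<mu>))"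
  shows "(f ^^ k) \<mu> \<in> \<Lambda> \<Longrightarrow> (\<And>j. j < k \<Longrightarrow> e ((f ^^ j) \<mu>) \<le> E) \<Longrightarrow>
    (\<And>j \<Lambda>. j < k \<Longrightarrow> y \<Lambda> (g ((f ^^ j) \<mu>)) \<le> B) \<Longrightarrow> a * y \<Lambda> \<mu> \<le> real k * C ^ k * (E + a * b * B)"
proof (induction k arbitrary: \<mu> \<Lambda>)
  case (Suc k)
  let ?F = "E + a * b * B"
  have F: "0 \<le> ?F" using a b E by simp
  have IH: "a * y (insert \<mu> \<Lambda>) (f \<mu>) \<le> real k * C ^ k * ?F"
  proof (rule Suc.IH)
    show "(f ^^ k) (f \<mu>) \<in> insert \<mu> \<Lambda>" using Suc.prems(1) by (simp add: funpow_swap1)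
    show "e ((f ^^ j) (f \<mu>)) \<le> E" if "j < k" for j
      using Suc.prems(2)[of "Suc j"] that by (simp add: funpow_swap1)
    show "y \<Lambda>' (g ((f ^^ j) (f \<mu>))) \<le> B" if "j < k" for j \<Lambda>'
      using Suc.prems(3)[of "Suc j"] that by (simp add: funpow_swap1)
  qed
  have e: "e \<mu> \<le> E" and g: "y (insert \<mu> \<Lambda>) (g \<mu>) \<le> B" using Suc.prems(2,3)[of 0] by simp_all
  \<comment> \<open>The factor \<open>a\<close> is carried through the induction: leaving the chain
    by \<open>g\<close> then has weight \<open>a * b\<close>, while staying on it reproduces the
    claim with a further factor at most 1.\<close>
  have "a * y \<Lambda> \<mu> \<le> a * (C * (e \<mu> + a * y (insert \<mu> \<Lambda>) (f \<mu>) + b * y (insert \<mu> \<Lambda>) (g \<mu>)))"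
    by (intro mult_left_mono step a)
  also have "\<dots> = C * (a * e \<mu> + a * (a * y (insert \<mu> \<Lambda>) (f \<mu>)) + a * b * y (insert \<mu> \<Lambda>) (g \<mu>))"
    by (simp add: algebra_simps)
  also have "\<dots> \<le> C * (E + real k * C ^ k * ?F + a * b * B)"
  proof (intro mult_left_mono add_mono)
    have "a * e \<mu> \<le> a * E" using e a by (intro mult_left_mono)
    also have "\<dots> \<le> E" using a E by (simp add: mult_left_le_one_le)
    finally show "a * e \<mu> \<le> E" .
    have "a * (a * y (insert \<mu> \<Lambda>) (f \<mu>)) \<le> a * y (insert \<mu> \<Lambda>) (f \<mu>)"
      using a y0 by (simp add: mult_left_le_one_le)
    with IH show "a * (a * y (insert \<mu> \<Lambda>) (f \<mu>)) \<le> real k * C ^ k * ?F" by linarith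
  qed (use a b C g in auto)
  also have "\<dots> = C * 1 * ?F + real k * C ^ Suc k * ?F" by (simp add: algebra_simps)
  also have "C * 1 * ?F \<le> C * C ^ k * ?F" using C F by (intro mult_right_mono mult_left_mono) auto
  finally show ?case by (simp add: algebra_simps)
qed (simp add: dead)

section \<open>Lattice distance and the four-step estimate\<close>

text \<open>The l1 distance: integer-valued, changed by at most one in each step, additive in the
  coordinates for the lattice sums, and an upper bound for the Euclidean distance.\<close>

definition sdist :: "site \<Rightarrow> site \<Rightarrow> nat" where
  "sdist \<mu> \<nu> = nat (\<bar>fst \<mu> - fst \<nu>\<bar> + \<bar>snd \<mu> - snd \<nu>\<bar>)"

lemma sdist_simps [simp]: "sdist \<mu> \<mu> = 0" "sdist \<mu> \<nu> = 0 \<longleftrightarrow> \<mu> = \<nu>"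
  by (auto simp: sdist_def prod_eq_iff)

lemma sdist_commute: "sdist \<mu> \<nu> = sdist \<nu> \<mu>" unfolding sdist_def by linarith

lemma sdist_triangle: "sdist \<mu> \<nu> \<le> sdist \<mu> \<kappa> + sdist \<kappa> \<nu>" unfolding sdist_def by linarith

lemma sdist_step: "sdist (fwdL \<mu>) \<mu> = 1" "sdist (fwdR \<mu>) \<mu> = 1"
  by (cases \<mu>; simp add: step_defs sdist_def)+

lemma sdist_funpow:
  assumes "\<And>\<mu>. sdist (f \<mu>) \<mu> = 1" shows "sdist ((f ^^ j) \<mu>) \<mu> \<le> j"
proof (induction j)
  case (Suc j)
  show ?case using sdist_triangle[of "(f ^^ Suc j) \<mu>" \<mu> "(f ^^ j) \<mu>"] assms[of "(f ^^ j) \<mu>"] Suc by simp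
qed simp

text \<open>After one step of either kind, three more of that kind return to the removed
  \<open>\<mu>\<close>, so \<open>chain_bound\<close> applies with length 3. The source and the two
  chains give 1 + 3 + 3 = 7, and three steps followed by one branch stay within distance 4.\<close>

lemma four_steps_bound:
  fixes y :: "site set \<Rightarrow> site \<Rightarrow> real" and e :: "site \<Rightarrow> real"
  assumes C: "1 \<le> C" and a: "0 \<le> a" "a \<le> 1" and b: "0 \<le> b" "b \<le> 1" and E: "0 \<le> E" "0 \<le> B"
    and y0: "\<And>\<Lambda> \<mu>. 0 \<le> y \<Lambda> \<mu>" and dead: "\<And>\<Lambda> \<mu>. \<mu> \<in> \<Lambda> \<Longrightarrow> y \<Lambda> \<mu> = 0"
    and step: "\<And>\<Lambda> \<mu>. y \<Lambda> \<mu> \<le> C * (e \<mu> + a * y (insert \<mu> \<Lambda>) (fwdL \<mu>) + b * y (insert \<mu> \<Lambda>) (fwdR \<mu>))"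
    and e: "\<And>\<kappa>. sdist \<kappa> \<mu> \<le> 4 \<Longrightarrow> e \<kappa> \<le> E" and B: "\<And>\<Lambda> \<kappa>. sdist \<kappa> \<mu> \<le> 4 \<Longrightarrow> y \<Lambda> \<kappa> \<le> B"
  shows "y \<Lambda> \<mu> \<le> 7 * C ^ 4 * (E + a * b * B)"
proof -
  let ?F = "E + a * b * B"
  have F: "0 \<le> ?F" "E \<le> ?F" using a b E by simp_all
  have near: "sdist ((f ^^ j) (f \<mu>)) \<mu> \<le> 3" "sdist (g ((f ^^ j) (f \<mu>))) \<mu> \<le> 4"
    if f: "\<And>\<mu>. sdist (f \<mu>) \<mu> = 1" and g: "\<And>\<mu>. sdist (g \<mu>) \<mu> = 1" and j: "j < 3" for f g j
  proof -
    show *: "sdist ((f ^^ j) (f \<mu>)) \<mu> \<le> 3"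
      using sdist_funpow[of f "Suc j" \<mu>, OF f] j by (simp add: funpow_swap1)
    show "sdist (g ((f ^^ j) (f \<mu>))) \<mu> \<le> 4"
      using sdist_triangle[of "g ((f ^^ j) (f \<mu>))" \<mu> "(f ^^ j) (f \<mu>)"] g[of "(f ^^ j) (f \<mu>)"] * by linarith
  qed
  have L: "a * y (insert \<mu> \<Lambda>) (fwdL \<mu>) \<le> real 3 * C ^ 3 * (E + a * b * B)"
  proof (rule chain_bound[where e = e and f = fwdL and g = fwdR])
    show "(fwdL ^^ 3) (fwdL \<mu>) \<in> insert \<mu> \<Lambda>" by (simp add: step_four numeral_3_eq_3)
    show "e ((fwdL ^^ j) (fwdL \<mu>)) \<le> E" if "j < 3" for j
      using near(1)[OF sdist_step that] by (intro e) linarith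
    show "y \<Lambda> (fwdR ((fwdL ^^ j) (fwdL \<mu>))) \<le> B" if "j < 3" for j \<Lambda>
      using near(2)[OF sdist_step that] by (intro B)
  qed (use assms in auto)
  have R: "b * y (insert \<mu> \<Lambda>) (fwdR \<mu>) \<le> real 3 * C ^ 3 * (E + b * a * B)"
  proof (rule chain_bound[where e = e and f = fwdR and g = fwdL])
    show "(fwdR ^^ 3) (fwdR \<mu>) \<in> insert \<mu> \<Lambda>" by (simp add: step_four numeral_3_eq_3)
    show "e ((fwdR ^^ j) (fwdR \<mu>)) \<le> E" if "j < 3" for j
      using near(1)[OF sdist_step(2,1) that] by (intro e) linarith
    show "y \<Lambda> (fwdL ((fwdR ^^ j) (fwdR \<mu>))) \<le> B" if "j < 3" for j \<Lambda>
      using near(2)[OF sdist_step(2,1) that] by (intro B)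
    show "y \<Lambda> \<mu> \<le> C * (e \<mu> + b * y (insert \<mu> \<Lambda>) (fwdR \<mu>) + a * y (insert \<mu> \<Lambda>) (fwdL \<mu>))" for \<Lambda> \<mu>
      using step[of \<Lambda> \<mu>] by (simp add: algebra_simps)
  qed (use assms in auto)
  have "y \<Lambda> \<mu> \<le> C * (e \<mu> + a * y (insert \<mu> \<Lambda>) (fwdL \<mu>) + b * y (insert \<mu> \<Lambda>) (fwdR \<mu>))" by (rule step)
  also have "\<dots> \<le> C * (?F + 3 * C ^ 3 * ?F + 3 * C ^ 3 * ?F)"
    using L R e[of \<mu>] F C by (intro mult_left_mono add_mono) (auto simp: mult.commute)
  also have "\<dots> \<le> C * (C ^ 3 * ?F + 3 * C ^ 3 * ?F + 3 * C ^ 3 * ?F)"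
    using C F mult_right_mono[of 1 "C ^ 3" ?F] by (intro mult_left_mono add_right_mono) auto
  also have "\<dots> = 7 * C ^ 4 * ?F" by (simp add: power_numeral_reduce)
  finally show ?thesis .
qed

context
  fixes \<phi> :: real and z :: complex and \<nu> :: site
  assumes z: "cmod z < 1" and small: "sqrt \<bar>cos \<phi>\<bar> * sqrt \<bar>sin \<phi>\<bar> \<le> 1 / 56"
begin

definition fmom :: "site set \<Rightarrow> site \<Rightarrow> real" where "fmom \<Lambda> \<mu> = enn2real (FM \<phi> z \<nu> \<Lambda> \<mu>)"

lemma FM_fmom: "FM \<phi> z \<nu> \<Lambda> \<mu> = ennreal (fmom \<Lambda> \<mu>)"
  unfolding fmom_def by (rule ennreal_enn2real[symmetric]) (rule le_less_trans[OF FM_bounded[OF z]], simp)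

lemma fmom_nonneg: "0 \<le> fmom \<Lambda> \<mu>" by (simp add: fmom_def)

lemma fmom_le_real: "FM \<phi> z \<nu> \<Lambda> \<mu> \<le> ennreal B \<Longrightarrow> 0 \<le> B \<Longrightarrow> fmom \<Lambda> \<mu> \<le> B"
  by (simp add: FM_fmom)

lemma fmom_step: "fmom \<Lambda> \<mu> \<le> sqrt 2 * ((if \<mu> = \<nu> then 1 else 0) + sqrt \<bar>cos \<phi>\<bar> * fmom (insert \<mu> \<Lambda>) (fwdL \<mu>)
    + sqrt \<bar>sin \<phi>\<bar> * fmom (insert \<mu> \<Lambda>) (fwdR \<mu>))"
proof (rule fmom_le_real)
  show "FM \<phi> z \<nu> \<Lambda> \<mu> \<le> ennreal (sqrt 2 * ((if \<mu> = \<nu> then 1 else 0) + sqrt \<bar>cos \<phi>\<bar> * fmom (insert \<mu> \<Lambda>) (fwdL \<mu>)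
    + sqrt \<bar>sin \<phi>\<bar> * fmom (insert \<mu> \<Lambda>) (fwdR \<mu>)))"
    using FM_step[OF z, of \<phi> \<nu> \<Lambda> \<mu>] by (simp add: FM_fmom ennreal_mult ennreal_plus fmom_nonneg)
qed (simp add: fmom_nonneg)

text \<open>With \<open>C = sqrt 2\<close> the constant is 7 * 4 = 28, so the threshold 1/56 makes
  the coefficient of \<open>B\<close> equal to 1/2.\<close>

lemma fmom_round:
  assumes "0 \<le> E" "0 \<le> B"
    and "\<And>\<kappa>. sdist \<kappa> \<mu> \<le> 4 \<Longrightarrow> (if \<kappa> = \<nu> then 1 else 0) \<le> E" "\<And>\<Lambda> \<kappa>. sdist \<kappa> \<mu> \<le> 4 \<Longrightarrow> fmom \<Lambda> \<kappa> \<le> B"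
  shows "fmom \<Lambda> \<mu> \<le> 28 * E + B / 2"
proof -
  have "fmom \<Lambda> \<mu> \<le> 7 * sqrt 2 ^ 4 * (E + sqrt \<bar>cos \<phi>\<bar> * sqrt \<bar>sin \<phi>\<bar> * B)"
    by (rule four_steps_bound[where e = "\<lambda>\<kappa>. if \<kappa> = \<nu> then 1 else 0"])
       (use assms fmom_step in \<open>auto simp: fmom_nonneg fmom_def FM_def\<close>)
  also have "sqrt 2 ^ 4 = (4::real)"
    using power_mult[of "sqrt 2" 2 2] by simp
  also have "7 * 4 * (E + sqrt \<bar>cos \<phi>\<bar> * sqrt \<bar>sin \<phi>\<bar> * B) \<le> 7 * 4 * (E + 1 / 56 * B)"
    using assms(2) small by (intro mult_left_mono add_left_mono mult_right_mono) auto
  finally show ?thesis by simp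
qed

text \<open>56 is the fixed point of B -> 28 + B / 2, the map of one round with source bound 1. The
  excess \<open>B0\<close>, which depends on z, is halved in each round and vanishes in the
  limit.\<close>

lemma fmom_uniform: "fmom \<Lambda> \<mu> \<le> 56"
proof -
  define B0 where "B0 = sqrt (1 / (1 - cmod z))"
  have B0: "0 \<le> B0" using z by (simp add: B0_def)
  have iter: "fmom \<Lambda> \<mu> \<le> 56 + B0 / 2 ^ n" for n \<Lambda> \<mu>
  proof (induction n arbitrary: \<Lambda> \<mu>)
    case 0
    have "fmom \<Lambda> \<mu> \<le> B0" unfolding B0_def by (rule fmom_le_real[OF FM_bounded[OF z]]) (use z in simp)
    then show ?case by simp
  next
    case (Suc n)
    have "fmom \<Lambda> \<mu> \<le> 28 * 1 + (56 + B0 / 2 ^ n) / 2"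
      by (rule fmom_round) (use B0 Suc in auto)
    then show ?case by (simp add: add_divide_distrib)
  qed
  have "(\<lambda>n. 56 + B0 * inverse (2 ^ n)) \<longlonglongrightarrow> 56 + B0 * 0"
    by (intro tendsto_intros LIMSEQ_inverse_realpow_zero) simp
  moreover have "\<exists>N. \<forall>n\<ge>N. fmom \<Lambda> \<mu> \<le> 56 + B0 * inverse (2 ^ n)"
    using iter by (auto simp: divide_inverse)
  ultimately have "fmom \<Lambda> \<mu> \<le> 56 + B0 * 0" by (rule LIMSEQ_le_const)
  then show ?thesis by simp
qed

text \<open>Blocks of length five: moving by at most 4 from a site at distance at least 5 (k + 1)
  from \<open>\<nu>\<close> leaves more than 5 k. So the source is not met, \<open>E = 0\<close>,
  and each block halves the bound.\<close>

lemma fmom_decay: "5 * k \<le> sdist \<mu> \<nu> \<Longrightarrow> fmom \<Lambda> \<mu> \<le> 56 / 2 ^ k"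
proof (induction k arbitrary: \<mu> \<Lambda>)
  case (Suc k)
  have far: "5 * k < sdist \<kappa> \<nu>" if "sdist \<kappa> \<mu> \<le> 4" for \<kappa>
    using sdist_triangle[of \<mu> \<nu> \<kappa>] sdist_commute[of \<mu> \<kappa>] Suc.prems that by simp
  have "fmom \<Lambda> \<mu> \<le> 28 * 0 + 56 / 2 ^ k / 2"
  proof (rule fmom_round)
    show "(if \<kappa> = \<nu> then 1 else 0) \<le> (0::real)" if "sdist \<kappa> \<mu> \<le> 4" for \<kappa> using far[OF that] by auto
    show "fmom \<Lambda> \<kappa> \<le> 56 / 2 ^ k" if "sdist \<kappa> \<mu> \<le> 4" for \<Lambda> \<kappa> using far[OF that] by (intro Suc.IH) simp
  qed auto
  then show ?case by simp
qed (simp add: fmom_uniform)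

text \<open>Halving every five sites is the rate \<open>ln 2 / 5\<close>; doubling 56 to 112 pays
  for rounding the distance down to a multiple of five.\<close>

lemma fmom_exp_decay: "fmom \<Lambda> \<mu> \<le> 112 * exp (- (ln 2 / 5) * real (sdist \<mu> \<nu>))"
proof -
  define k where "k = sdist \<mu> \<nu> div 5"
  have k: "5 * k \<le> sdist \<mu> \<nu>" "sdist \<mu> \<nu> \<le> 5 * k + 5" unfolding k_def by presburger+
  have "exp (- (real k + 1) * ln 2) \<le> exp (- (ln 2 / 5) * real (sdist \<mu> \<nu>))"
  proof -
    have "real (sdist \<mu> \<nu>) \<le> 5 * (real k + 1)" using of_nat_mono[OF k(2), where 'a = real] by simp
    then have "ln 2 / 5 * real (sdist \<mu> \<nu>) \<le> ln 2 / 5 * (5 * (real k + 1))" by (intro mult_left_mono) auto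
    then show ?thesis by (simp add: algebra_simps)
  qed
  moreover have "exp (- (real k + 1) * ln 2) = 1 / 2 ^ Suc k"
  proof -
    have "- (real k + 1) * ln 2 = - (real (Suc k) * ln 2)" by (simp add: algebra_simps)
    then have "exp (- (real k + 1) * ln 2) = inverse (exp (real (Suc k) * ln 2))" by (simp only: exp_minus)
    also have "exp (real (Suc k) * ln 2) = exp (ln 2) ^ Suc k" by (rule exp_of_nat_mult)
    also have "exp (ln 2) = (2::real)" by simp
    finally show ?thesis by (simp only: divide_inverse mult_1)
  qed
  moreover have "fmom \<Lambda> \<mu> \<le> 56 / 2 ^ k" by (rule fmom_decay[OF k(1)])
  moreover have "56 / 2 ^ k = 112 * (1 / 2 ^ Suc k :: real)" by simp
  ultimately show ?thesis by linarith
qed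

text \<open>One averaging at the source reduces to fractional moments with only \<open>\<mu>\<close>
  removed. Passing to a neighbour costs at most exp (ln 2 / 5) \<le> 2, so each of the two gives 2 *
  112 = 224, and the source term adds 1.\<close>

lemma second_moment_decay:
  "(\<integral>\<^sup>+ \<omega>. ennreal ((1 - (cmod z)\<^sup>2) * (cmod (Gr (\<lambda>\<kappa>. z * \<omega> \<kappa>) \<phi> \<mu> \<nu>))\<^sup>2) \<partial>Pmeas)
    \<le> ennreal (449 * exp (- (ln 2 / 5) * real (sdist \<mu> \<nu>)))"
proof -
  let ?g = "ln 2 / 5 :: real"
  have r: "(\<lambda>\<kappa>. z * \<omega> \<kappa>) = rem {} z \<omega>" for \<omega> by (simp add: rem_def)
  let ?f = "\<lambda>\<omega>. ennreal ((1 - (cmod z)\<^sup>2) * (cmod (Gr (rem {} z \<omega>) \<phi> \<mu> \<nu>))\<^sup>2)"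
  have "(\<integral>\<^sup>+ \<omega>. ?f \<omega> \<partial>Pmeas) = (\<integral>\<^sup>+ \<omega>. (\<integral>\<^sup>+ t. ?f (\<omega> (\<mu> := t)) \<partial>circ_measure) \<partial>Pmeas)"
    by (rule nn_integral_Pmeas_resample) measurable
  also have "\<dots> \<le> (\<integral>\<^sup>+ \<omega>. ennreal (sqrt (cmod (Gr (rem {\<mu>} z \<omega>) \<phi> \<mu> \<nu>))) \<partial>Pmeas)"
  proof (rule nn_integral_mono_AE, use AE_Pmeas in \<open>rule eventually_mono\<close>)
    fix \<omega> :: vec assume "\<forall>\<kappa>. cmod (\<omega> \<kappa>) = 1"
    then have unit: "\<And>\<kappa>. cmod (\<omega> \<kappa>) = 1" by blast
    have 0: "\<mu> \<notin> {}" by simp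
    show "(\<integral>\<^sup>+ t. ?f (\<omega> (\<mu> := t)) \<partial>circ_measure) \<le> ennreal (sqrt (cmod (Gr (rem {\<mu>} z \<omega>) \<phi> \<mu> \<nu>)))"
      using one_site_second_moment[of \<omega> z \<mu> "{}" \<phi> \<nu>, OF unit z 0]
      unfolding x0_def[of \<omega> z \<mu> "{}" \<phi>, OF unit z 0] .
  qed
  also have "\<dots> \<le> ennreal (if \<mu> = \<nu> then 1 else 0) + ennreal (sqrt \<bar>cos \<phi>\<bar>) * FM \<phi> z \<nu> {\<mu>} (fwdL \<mu>)
      + ennreal (sqrt \<bar>sin \<phi>\<bar>) * FM \<phi> z \<nu> {\<mu>} (fwdR \<mu>)"
    by (rule FM_expand[OF z]) simp
  also have "\<dots> = ennreal ((if \<mu> = \<nu> then 1 else 0) + sqrt \<bar>cos \<phi>\<bar> * fmom {\<mu>} (fwdL \<mu>) + sqrt \<bar>sin \<phi>\<bar> * fmom {\<mu>} (fwdR \<mu>))"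
    by (simp add: FM_fmom ennreal_mult ennreal_plus fmom_nonneg)
  also have "\<dots> \<le> ennreal (449 * exp (- ?g * real (sdist \<mu> \<nu>)))"
  proof (rule ennreal_leI)
    let ?e = "exp (- ?g * real (sdist \<mu> \<nu>))"
    have nb: "fmom {\<mu>} \<kappa> \<le> 224 * ?e" if "sdist \<kappa> \<mu> = 1" for \<kappa>
    proof -
      have "real (sdist \<mu> \<nu>) \<le> real (sdist \<kappa> \<nu>) + 1"
        using sdist_triangle[of \<mu> \<nu> \<kappa>] sdist_commute[of \<mu> \<kappa>] that by linarith
      then have "?g * real (sdist \<mu> \<nu>) \<le> ?g * (real (sdist \<kappa> \<nu>) + 1)" by (intro mult_left_mono) auto
      then have "exp (- ?g * real (sdist \<kappa> \<nu>)) \<le> exp (?g + - ?g * real (sdist \<mu> \<nu>))"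
        by (simp add: algebra_simps)
      also have "\<dots> = exp ?g * ?e" by (rule exp_add)
      also have "\<dots> \<le> 2 * ?e"
      proof (rule mult_right_mono)
        have "exp ?g \<le> exp (ln 2)" by (subst exp_le_cancel_iff) simp
        then show "exp ?g \<le> 2" by simp
      qed simp
      finally show ?thesis using fmom_exp_decay[of "{\<mu>}" \<kappa>] by linarith
    qed
    have w: "s * fmom {\<mu>} \<kappa> \<le> 224 * ?e" if "0 \<le> s" "s \<le> 1" "sdist \<kappa> \<mu> = 1" for s \<kappa>
      using mult_left_le_one_le[of "fmom {\<mu>} \<kappa>" s] nb[OF that(3)] that fmom_nonneg[of "{\<mu>}" \<kappa>] by linarith
    have "(if \<mu> = \<nu> then 1 else 0) \<le> ?e" by simp
    moreover have "sqrt \<bar>cos \<phi>\<bar> * fmom {\<mu>} (fwdL \<mu>) \<le> 224 * ?e" by (rule w) (auto simp: sdist_step)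
    moreover have "sqrt \<bar>sin \<phi>\<bar> * fmom {\<mu>} (fwdR \<mu>) \<le> 224 * ?e" by (rule w) (auto simp: sdist_step)
    ultimately show "(if \<mu> = \<nu> then 1 else 0) + sqrt \<bar>cos \<phi>\<bar> * fmom {\<mu>} (fwdL \<mu>) + sqrt \<bar>sin \<phi>\<bar> * fmom {\<mu>} (fwdR \<mu>)
      \<le> 449 * ?e" by linarith
  qed
  finally show ?thesis unfolding r .
qed

end

subsection \<open>Exponential sums over the lattice\<close>

text \<open>\<open>int_encode k\<close> is at most 2 |k|, so transporting the sum to the naturals
  bounds it by a geometric series of ratio exp (- c / 2).\<close>

lemma nn_sum_exp_int:
  assumes "0 < c"
  shows "(\<integral>\<^sup>+ k. ennreal (exp (- c * real_of_int \<bar>k\<bar>)) \<partial>count_space (UNIV :: int set)) \<noteq> \<top>"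
proof -
  have enc: "real (int_encode k) \<le> 2 * real_of_int \<bar>k\<bar>" for k
    by (auto simp: int_encode_def sum_encode_def)
  have "(\<integral>\<^sup>+ k. ennreal (exp (- c * real_of_int \<bar>k\<bar>)) \<partial>count_space (UNIV :: int set))
      \<le> (\<integral>\<^sup>+ k. ennreal (exp (- (c / 2)) ^ int_encode k) \<partial>count_space UNIV)"
  proof (intro nn_integral_mono ennreal_leI)
    fix k :: int
    have "c * real (int_encode k) \<le> c * (2 * real_of_int \<bar>k\<bar>)" using enc assms by (intro mult_left_mono) auto
    then have "exp (- c * real_of_int \<bar>k\<bar>) \<le> exp (real (int_encode k) * (- (c / 2)))"
      by (simp add: algebra_simps)
    then show "exp (- c * real_of_int \<bar>k\<bar>) \<le> exp (- (c / 2)) ^ int_encode k" by (simp only: exp_of_nat_mult)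
  qed
  also have "\<dots> = (\<integral>\<^sup>+ n. ennreal (exp (- (c / 2)) ^ n) \<partial>count_space (UNIV :: nat set))"
    by (rule nn_integral_bij_count_space[where g = int_encode]) (rule bij_int_encode)
  also have "\<dots> = (\<Sum>n. ennreal (exp (- (c / 2)) ^ n))" by (rule nn_integral_count_space_nat)
  finally have le: "(\<integral>\<^sup>+ k. ennreal (exp (- c * real_of_int \<bar>k\<bar>)) \<partial>count_space (UNIV :: int set))
      \<le> (\<Sum>n. ennreal (exp (- (c / 2)) ^ n))" .
  have "summable (\<lambda>n. exp (- (c / 2)) ^ n)" using assms by (intro summable_geometric) simp
  then have "(\<Sum>n. ennreal (exp (- (c / 2)) ^ n)) \<noteq> \<top>"
    by (rule ennreal_suminf_neq_top) (rule zero_le_power, rule exp_ge_zero)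
  from neq_top_trans[OF this le] show ?thesis .
qed

lemma nn_sum_exp_sdist:
  assumes "0 < c"
  obtains S where "0 < S" "\<And>\<mu>. (\<integral>\<^sup>+ \<kappa>. ennreal (exp (- c * real (sdist \<mu> \<kappa>))) \<partial>count_space UNIV) \<le> ennreal S"
proof -
  define g where "g k = ennreal (exp (- c * real_of_int \<bar>k\<bar>))" for k :: int
  define T where "T = (\<integral>\<^sup>+ k. g k \<partial>count_space UNIV)"
  have T: "T \<noteq> \<top>" unfolding T_def g_def by (rule nn_sum_exp_int[OF assms])
  have shift: "(\<integral>\<^sup>+ k. g (m - k) \<partial>count_space UNIV) = T" for m
    unfolding T_def
    by (rule nn_integral_bij_count_space[where g = "\<lambda>k. m - k"], rule bij_betw_byWitness[where f' = "\<lambda>k. m - k"]) auto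
  have TT: "(\<integral>\<^sup>+ \<kappa>. ennreal (exp (- c * real (sdist \<mu> \<kappa>))) \<partial>count_space UNIV) = T * T" for \<mu>
  proof -
    have "(\<integral>\<^sup>+ \<kappa>. ennreal (exp (- c * real (sdist \<mu> \<kappa>))) \<partial>count_space UNIV)
        = (\<integral>\<^sup>+ \<kappa>. g (fst \<mu> - fst \<kappa>) * g (snd \<mu> - snd \<kappa>) \<partial>count_space UNIV)"
    proof (rule nn_integral_cong)
      fix \<kappa> :: site
      have "real (sdist \<mu> \<kappa>) = real_of_int \<bar>fst \<mu> - fst \<kappa>\<bar> + real_of_int \<bar>snd \<mu> - snd \<kappa>\<bar>"
        by (simp add: sdist_def)
      then show "ennreal (exp (- c * real (sdist \<mu> \<kappa>))) = g (fst \<mu> - fst \<kappa>) * g (snd \<mu> - snd \<kappa>)"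
        unfolding g_def ennreal_mult[symmetric, OF exp_ge_zero exp_ge_zero] exp_add[symmetric]
        by (simp add: algebra_simps)
    qed
    also have "\<dots> = (\<integral>\<^sup>+ a. \<integral>\<^sup>+ b. g (fst \<mu> - a) * g (snd \<mu> - b) \<partial>count_space UNIV \<partial>count_space UNIV)"
      using nn_integral_fst_count_space[of "\<lambda>\<kappa>. g (fst \<mu> - fst \<kappa>) * g (snd \<mu> - snd \<kappa>)"] by simp
    also have "\<dots> = T * T" by (simp add: nn_integral_cmult nn_integral_multc shift)
    finally show ?thesis .
  qed
  have "T * T \<noteq> \<top>" using T by (simp add: ennreal_mult_eq_top_iff)
  then obtain S where S: "0 \<le> S" "T * T = ennreal S" by (cases "T * T") auto
  \<comment> \<open>Only \<open>0 \<le> S\<close> is known here; adding 1 makes the constant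
    strictly positive.\<close>
  have "(\<integral>\<^sup>+ \<kappa>. ennreal (exp (- c * real (sdist \<mu> \<kappa>))) \<partial>count_space UNIV) \<le> ennreal (S + 1)" for \<mu>
    unfolding TT S(2) by (rule ennreal_leI) simp
  moreover have "0 < S + 1" using S(1) by simp
  ultimately show ?thesis by (rule that[rotated])
qed

lemma nn_integral_infsum:
  fixes f :: "site \<Rightarrow> real"
  assumes "f summable_on UNIV" "\<And>\<kappa>. 0 \<le> f \<kappa>"
  shows "(\<integral>\<^sup>+ \<kappa>. ennreal (f \<kappa>) \<partial>count_space UNIV) = ennreal (infsum f UNIV)"
proof -
  have a: "Infinite_Set_Sum.abs_summable_on f UNIV"
    using assms by (simp add: abs_summable_equivalent[symmetric])
  from nn_integral_conv_infsetsum[OF a] assms(2) show ?thesis by (simp add: infsetsum_infsum[OF a])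
qed

text \<open>The difference of the two sides is a multiple of a square. The free weight
  \<open>t\<close> will balance two unequal exponential rates.\<close>

lemma weighted_AM_GM:
  fixes q t u v :: real
  assumes "0 < q" "0 < t"
  shows "q * (u * v) \<le> t / 2 * (q * u\<^sup>2) + 1 / (2 * t) * (q * v\<^sup>2)"
proof -
  have "t / 2 * (q * u\<^sup>2) + 1 / (2 * t) * (q * v\<^sup>2) - q * (u * v) = q / (2 * t) * (t * u - v)\<^sup>2"
    using assms by (simp add: field_simps power2_eq_square)
  moreover have "0 \<le> q / (2 * t) * (t * u - v)\<^sup>2" using assms by simp
  ultimately show ?thesis by linarith
qed

subsection \<open>The eigenfunction correlator\<close>

text \<open>For unimodular \<open>\<omega>\<close> these are the entries of \<open>(1 - cmod z ^ 2) G\<^sup>* G\<close>, \<open>G = (1 - z U)\<^sup>-\<^sup>1\<close>: the first form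
  pairs well with Laurent polynomials, the second one is controlled by second moments.\<close>

definition Pk :: "real \<Rightarrow> site \<Rightarrow> site \<Rightarrow> vec \<Rightarrow> complex \<Rightarrow> complex" where
  "Pk \<phi> \<mu> \<nu> \<omega> z = cnj (Gr (\<lambda>\<kappa>. z * \<omega> \<kappa>) \<phi> \<mu> \<nu>) + Gr (\<lambda>\<kappa>. z * \<omega> \<kappa>) \<phi> \<nu> \<mu> - ebasis \<nu> \<mu>"

lemma measurable_Pk:
  "(\<lambda>(\<omega>, w). Pk \<phi> \<mu> \<nu> \<omega> (complex_of_real r * w)) \<in> borel_measurable (Pmeas \<Otimes>\<^sub>M circ_measure)"
proof -
  have m: "(\<lambda>x. complex_of_real r * snd x * fst x \<kappa>) \<in> borel_measurable (Pmeas \<Otimes>\<^sub>M circ_measure)" for \<kappa>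
    by (intro borel_measurable_times borel_measurable_const
        measurable_compose[OF measurable_fst measurable_Pmeas_component]) measurable
  note [measurable] = measurable_Gr[of "\<lambda>x \<kappa>. complex_of_real r * snd x * fst x \<kappa>", OF m]
  show ?thesis unfolding Pk_def split_beta' by measurable
qed

text \<open>The kernel is at most 1 - |z|^2 times the sum over \<open>\<kappa>\<close> of the
  products of entries from \<open>\<mu>\<close> and from \<open>\<nu>\<close>. Second moments give
  decay s / 2 in the sum of the distances to \<open>\<kappa>\<close>; half of it pays for the
  distance of \<open>\<mu>\<close> and \<open>\<nu>\<close> by the triangle inequality, the rest for
  the sum over \<open>\<kappa>\<close>. Hence the rate falls from ln 2 / 5 to ln 2 / 20.\<close>

lemma Pk_decay:
  assumes small: "sqrt \<bar>cos \<phi>\<bar> * sqrt \<bar>sin \<phi>\<bar> \<le> 1 / 56" and z: "cmod z < 1"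
    and S: "\<And>\<mu>. (\<integral>\<^sup>+ \<kappa>. ennreal (exp (- (ln 2 / 20) * real (sdist \<mu> \<kappa>))) \<partial>count_space UNIV) \<le> ennreal S"
  shows "(\<integral>\<^sup>+ \<omega>. ennreal (cmod (Pk \<phi> \<mu> \<nu> \<omega> z)) \<partial>Pmeas)
    \<le> ennreal (449 * S * exp (- (ln 2 / 20) * real (sdist \<mu> \<nu>)))"
proof -
  define s where "s = ln 2 / (5::real)"
  define q where "q = 1 - (cmod z)\<^sup>2"
  have q: "0 < q" using z by (simp add: q_def abs_square_less_1)
  define G where "G \<mu> \<omega> \<kappa> = cmod (Gr (\<lambda>\<kappa>. z * \<omega> \<kappa>) \<phi> \<mu> \<kappa>)" for \<mu> \<omega> \<kappa>
  have [measurable]: "(\<lambda>\<omega>. G \<mu> \<omega> \<kappa>) \<in> borel_measurable Pmeas" for \<mu> \<kappa>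
  proof -
    note [measurable] = measurable_Gr[of "\<lambda>\<omega> \<kappa>. z * \<omega> \<kappa>" Pmeas, OF borel_measurable_times[OF borel_measurable_const measurable_Pmeas_component]]
    show ?thesis unfolding G_def by measurable
  qed
  have G0: "0 \<le> G \<mu> \<omega> \<kappa>" for \<mu> \<omega> \<kappa> by (simp add: G_def)
  have Gd: "(\<integral>\<^sup>+ \<omega>. ennreal (q * (G \<mu> \<omega> \<kappa>)\<^sup>2) \<partial>Pmeas) \<le> ennreal (449 * exp (- s * real (sdist \<mu> \<kappa>)))" for \<mu> \<kappa>
    unfolding G_def q_def s_def by (rule second_moment_decay[OF z small])
  have "(\<integral>\<^sup>+ \<omega>. ennreal (cmod (Pk \<phi> \<mu> \<nu> \<omega> z)) \<partial>Pmeas)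
      \<le> (\<integral>\<^sup>+ \<omega>. (\<integral>\<^sup>+ \<kappa>. ennreal (q * (G \<mu> \<omega> \<kappa> * G \<nu> \<omega> \<kappa>)) \<partial>count_space UNIV) \<partial>Pmeas)"
  proof (rule nn_integral_mono_AE, use AE_Pmeas in \<open>rule eventually_mono\<close>)
    fix \<omega> :: vec assume "\<forall>\<kappa>. cmod (\<omega> \<kappa>) = 1"
    then have unit: "\<And>\<kappa>. cmod (\<omega> \<kappa>) = 1" by blast
    have b: "cmod (z * \<omega> \<kappa>) \<le> cmod z" for \<kappa> by (simp add: norm_mult unit)
    note e = Gr_ell2(1)[of "\<lambda>\<kappa>. z * \<omega> \<kappa>" "cmod z" \<phi>, OF b z]
    let ?x = "Gr (\<lambda>\<kappa>. z * \<omega> \<kappa>) \<phi>"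
    have sm: "(\<lambda>\<kappa>. G \<mu> \<omega> \<kappa> * G \<nu> \<omega> \<kappa>) summable_on UNIV"
      using ip_abs_summable[OF e e, of \<mu> \<nu>] by (simp add: G_def norm_mult)
    have "Pk \<phi> \<mu> \<nu> \<omega> z = complex_of_real q * ip (?x \<mu>) (?x \<nu>)"
      using Gr_Poisson[of \<omega> z \<phi> \<mu> \<nu>, OF unit z] by (simp add: Pk_def q_def)
    then have "cmod (Pk \<phi> \<mu> \<nu> \<omega> z) = q * cmod (ip (?x \<mu>) (?x \<nu>))" using q by (simp add: norm_mult)
    also have "\<dots> \<le> q * infsum (\<lambda>\<kappa>. G \<mu> \<omega> \<kappa> * G \<nu> \<omega> \<kappa>) UNIV"
      using ip_le_abs[OF e e, of \<mu> \<nu>] q unfolding G_def by (intro mult_left_mono) auto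
    also have "\<dots> = infsum (\<lambda>\<kappa>. q * (G \<mu> \<omega> \<kappa> * G \<nu> \<omega> \<kappa>)) UNIV" by (rule infsum_cmult_right'[symmetric])
    finally have "cmod (Pk \<phi> \<mu> \<nu> \<omega> z) \<le> infsum (\<lambda>\<kappa>. q * (G \<mu> \<omega> \<kappa> * G \<nu> \<omega> \<kappa>)) UNIV" .
    moreover have "(\<integral>\<^sup>+ \<kappa>. ennreal (q * (G \<mu> \<omega> \<kappa> * G \<nu> \<omega> \<kappa>)) \<partial>count_space UNIV)
        = ennreal (infsum (\<lambda>\<kappa>. q * (G \<mu> \<omega> \<kappa> * G \<nu> \<omega> \<kappa>)) UNIV)"
      by (rule nn_integral_infsum) (use sm q G0 in \<open>auto intro: summable_on_cmult_right\<close>)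
    ultimately show "ennreal (cmod (Pk \<phi> \<mu> \<nu> \<omega> z)) \<le> (\<integral>\<^sup>+ \<kappa>. ennreal (q * (G \<mu> \<omega> \<kappa> * G \<nu> \<omega> \<kappa>)) \<partial>count_space UNIV)"
      by (simp add: ennreal_leI)
  qed
  also have "\<dots> = (\<integral>\<^sup>+ \<kappa>. (\<integral>\<^sup>+ \<omega>. ennreal (q * (G \<mu> \<omega> \<kappa> * G \<nu> \<omega> \<kappa>)) \<partial>Pmeas) \<partial>count_space UNIV)"
  proof -
    interpret c: sigma_finite_measure "count_space (UNIV :: site set)"
      by (rule sigma_finite_measure_count_space_countable) auto
    interpret pair_sigma_finite "count_space (UNIV :: site set)" Pmeas ..
    have "(\<lambda>(\<kappa>, \<omega>). ennreal (q * (G \<mu> \<omega> \<kappa> * G \<nu> \<omega> \<kappa>))) \<in> borel_measurable (count_space UNIV \<Otimes>\<^sub>M Pmeas)"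
      by (rule measurable_pair_measure_countable1) auto
    from Fubini[OF this] show ?thesis by simp
  qed
  also have "\<dots> \<le> (\<integral>\<^sup>+ \<kappa>. ennreal (449 * exp (- (s / 4) * real (sdist \<mu> \<nu>))) * ennreal (exp (- (s / 4) * real (sdist \<mu> \<kappa>))) \<partial>count_space UNIV)"
  proof (rule nn_integral_mono)
    fix \<kappa> :: site
    \<comment> \<open>This weight makes both terms of the inequality equal to the geometric mean of
      the two bounds.\<close>
    define t where "t = exp (s / 2 * (real (sdist \<mu> \<kappa>) - real (sdist \<nu> \<kappa>)))"
    have t: "0 < t" by (simp add: t_def)
    have "(\<integral>\<^sup>+ \<omega>. ennreal (q * (G \<mu> \<omega> \<kappa> * G \<nu> \<omega> \<kappa>)) \<partial>Pmeas)
        \<le> (\<integral>\<^sup>+ \<omega>. ennreal (t / 2) * ennreal (q * (G \<mu> \<omega> \<kappa>)\<^sup>2) + ennreal (1 / (2 * t)) * ennreal (q * (G \<nu> \<omega> \<kappa>)\<^sup>2) \<partial>Pmeas)"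
    proof (rule nn_integral_mono)
      fix \<omega>
      have "q * (G \<mu> \<omega> \<kappa> * G \<nu> \<omega> \<kappa>) \<le> t / 2 * (q * (G \<mu> \<omega> \<kappa>)\<^sup>2) + 1 / (2 * t) * (q * (G \<nu> \<omega> \<kappa>)\<^sup>2)"
        by (rule weighted_AM_GM[OF q t])
      then show "ennreal (q * (G \<mu> \<omega> \<kappa> * G \<nu> \<omega> \<kappa>))
        \<le> ennreal (t / 2) * ennreal (q * (G \<mu> \<omega> \<kappa>)\<^sup>2) + ennreal (1 / (2 * t)) * ennreal (q * (G \<nu> \<omega> \<kappa>)\<^sup>2)"
        using t q by (simp add: ennreal_leI flip: ennreal_mult ennreal_plus)
    qed
    also have "\<dots> = ennreal (t / 2) * (\<integral>\<^sup>+ \<omega>. ennreal (q * (G \<mu> \<omega> \<kappa>)\<^sup>2) \<partial>Pmeas)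
        + ennreal (1 / (2 * t)) * (\<integral>\<^sup>+ \<omega>. ennreal (q * (G \<nu> \<omega> \<kappa>)\<^sup>2) \<partial>Pmeas)"
      by (simp add: nn_integral_add nn_integral_cmult)
    also have "\<dots> \<le> ennreal (t / 2) * ennreal (449 * exp (- s * real (sdist \<mu> \<kappa>)))
        + ennreal (1 / (2 * t)) * ennreal (449 * exp (- s * real (sdist \<nu> \<kappa>)))"
      by (intro add_mono mult_left_mono Gd) auto
    also have "\<dots> = ennreal (t / 2 * (449 * exp (- s * real (sdist \<mu> \<kappa>))) + 1 / (2 * t) * (449 * exp (- s * real (sdist \<nu> \<kappa>))))"
      using t by (simp flip: ennreal_mult ennreal_plus)
    also have "t / 2 * (449 * exp (- s * real (sdist \<mu> \<kappa>))) + 1 / (2 * t) * (449 * exp (- s * real (sdist \<nu> \<kappa>)))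
        = 449 * exp (- (s / 2) * (real (sdist \<mu> \<kappa>) + real (sdist \<nu> \<kappa>)))"
    proof -
      let ?a = "real (sdist \<mu> \<kappa>)" and ?b = "real (sdist \<nu> \<kappa>)"
      have "t * exp (- s * ?a) = exp (- (s / 2) * (?a + ?b))"
        unfolding t_def exp_add[symmetric] by (rule arg_cong[where f = exp]) (simp add: algebra_simps)
      moreover have "1 / t * exp (- s * ?b) = exp (- (s / 2) * (?a + ?b))"
        unfolding t_def divide_inverse exp_minus[symmetric] mult_1 exp_add[symmetric]
        by (rule arg_cong[where f = exp]) (simp add: algebra_simps)
      ultimately show ?thesis by simp
    qed
    also have "ennreal (449 * exp (- (s / 2) * (real (sdist \<mu> \<kappa>) + real (sdist \<nu> \<kappa>))))
        \<le> ennreal (449 * exp (- (s / 4) * real (sdist \<mu> \<nu>)) * exp (- (s / 4) * real (sdist \<mu> \<kappa>)))"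
    proof (rule ennreal_leI)
      have "real (sdist \<mu> \<nu>) \<le> real (sdist \<mu> \<kappa>) + real (sdist \<nu> \<kappa>)"
        using sdist_triangle[of \<mu> \<nu> \<kappa>] sdist_commute[of \<nu> \<kappa>] by simp
      then have "s / 4 * (real (sdist \<mu> \<nu>) + real (sdist \<mu> \<kappa>)) \<le> s / 4 * (2 * (real (sdist \<mu> \<kappa>) + real (sdist \<nu> \<kappa>)))"
        by (intro mult_left_mono) (auto simp: s_def)
      then show "449 * exp (- (s / 2) * (real (sdist \<mu> \<kappa>) + real (sdist \<nu> \<kappa>)))
          \<le> 449 * exp (- (s / 4) * real (sdist \<mu> \<nu>)) * exp (- (s / 4) * real (sdist \<mu> \<kappa>))"
        by (simp add: algebra_simps flip: exp_add)
    qed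
    finally show "(\<integral>\<^sup>+ \<omega>. ennreal (q * (G \<mu> \<omega> \<kappa> * G \<nu> \<omega> \<kappa>)) \<partial>Pmeas)
        \<le> ennreal (449 * exp (- (s / 4) * real (sdist \<mu> \<nu>))) * ennreal (exp (- (s / 4) * real (sdist \<mu> \<kappa>)))"
      by (simp add: ennreal_mult)
  qed
  also have "\<dots> = ennreal (449 * exp (- (s / 4) * real (sdist \<mu> \<nu>))) * (\<integral>\<^sup>+ \<kappa>. ennreal (exp (- (s / 4) * real (sdist \<mu> \<kappa>))) \<partial>count_space UNIV)"
    by (rule nn_integral_cmult) simp
  also have "\<dots> \<le> ennreal (449 * exp (- (s / 4) * real (sdist \<mu> \<nu>))) * ennreal S"
    using S[of \<mu>] by (intro mult_left_mono) (auto simp: s_def)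
  also have "\<dots> = ennreal (449 * S * exp (- (ln 2 / 20) * real (sdist \<mu> \<nu>)))"
    by (simp add: s_def mult_ac flip: ennreal_mult'')
  finally show ?thesis .
qed

text \<open>The Poisson kernels approximate the spectral measures, so this bounds a total variation norm.\<close>

definition corr :: "real \<Rightarrow> site \<Rightarrow> site \<Rightarrow> vec \<Rightarrow> ennreal" where
  "corr \<phi> \<mu> \<nu> \<omega> = liminf (\<lambda>j. \<integral>\<^sup>+ w. ennreal (cmod (Pk \<phi> \<mu> \<nu> \<omega> (complex_of_real (1 - 1 / real (j + 2)) * w))) \<partial>circ_measure)"

lemma measurable_Pk_avg [measurable]:
  "(\<lambda>\<omega>. \<integral>\<^sup>+ w. ennreal (cmod (Pk \<phi> \<mu> \<nu> \<omega> (complex_of_real r * w))) \<partial>circ_measure) \<in> borel_measurable Pmeas"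
proof -
  note [measurable] = measurable_Pk[of \<phi> \<mu> \<nu> r]
  show ?thesis by measurable
qed

lemma measurable_corr [measurable]: "corr \<phi> \<mu> \<nu> \<in> borel_measurable Pmeas"
  unfolding corr_def[abs_def] by (intro borel_measurable_liminf measurable_Pk_avg)

text \<open>Fatou moves the lower limit out of the expectation, and Tonelli moves the expectation
  inside the average over \<open>w\<close>, where \<open>Pk_decay\<close> holds with a constant
  independent of the radius and of \<open>w\<close>.\<close>

lemma corr_decay:
  assumes small: "sqrt \<bar>cos \<phi>\<bar> * sqrt \<bar>sin \<phi>\<bar> \<le> 1 / 56"
  obtains c where "0 < c" "\<And>\<mu> \<nu>. (\<integral>\<^sup>+ \<omega>. corr \<phi> \<mu> \<nu> \<omega> \<partial>Pmeas) \<le> ennreal (c * exp (- (ln 2 / 20) * real (sdist \<mu> \<nu>)))"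
proof -
  have "0 < ln 2 / (20::real)" by simp
  from nn_sum_exp_sdist[OF this] obtain S where S: "0 < S"
    "\<And>\<mu>. (\<integral>\<^sup>+ \<kappa>. ennreal (exp (- (ln 2 / 20) * real (sdist \<mu> \<kappa>))) \<partial>count_space UNIV) \<le> ennreal S" by blast
  have "(\<integral>\<^sup>+ \<omega>. corr \<phi> \<mu> \<nu> \<omega> \<partial>Pmeas) \<le> ennreal (449 * S * exp (- (ln 2 / 20) * real (sdist \<mu> \<nu>)))" for \<mu> \<nu>
  proof -
    let ?B = "ennreal (449 * S * exp (- (ln 2 / 20) * real (sdist \<mu> \<nu>)))"
    let ?r = "\<lambda>j. 1 - 1 / real (j + 2)"
    have "(\<integral>\<^sup>+ \<omega>. corr \<phi> \<mu> \<nu> \<omega> \<partial>Pmeas)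
        \<le> liminf (\<lambda>j. \<integral>\<^sup>+ \<omega>. (\<integral>\<^sup>+ w. ennreal (cmod (Pk \<phi> \<mu> \<nu> \<omega> (complex_of_real (?r j) * w))) \<partial>circ_measure) \<partial>Pmeas)"
      unfolding corr_def by (rule nn_integral_liminf) measurable
    also have "\<dots> \<le> liminf (\<lambda>j. ?B)"
    proof (rule Liminf_mono, rule always_eventually, rule allI)
      fix j
      interpret pair_sigma_finite Pmeas circ_measure ..
      have "(\<lambda>(\<omega>, w). ennreal (cmod (Pk \<phi> \<mu> \<nu> \<omega> (complex_of_real (?r j) * w)))) \<in> borel_measurable (Pmeas \<Otimes>\<^sub>M circ_measure)"
      proof -
        note [measurable] = measurable_Pk[of \<phi> \<mu> \<nu> "?r j"]
        show ?thesis by measurable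
      qed
      from Fubini'[OF this]
      have "(\<integral>\<^sup>+ \<omega>. (\<integral>\<^sup>+ w. ennreal (cmod (Pk \<phi> \<mu> \<nu> \<omega> (complex_of_real (?r j) * w))) \<partial>circ_measure) \<partial>Pmeas)
          = (\<integral>\<^sup>+ w. (\<integral>\<^sup>+ \<omega>. ennreal (cmod (Pk \<phi> \<mu> \<nu> \<omega> (complex_of_real (?r j) * w))) \<partial>Pmeas) \<partial>circ_measure)" by simp
      also have "\<dots> \<le> (\<integral>\<^sup>+ w. ?B \<partial>circ_measure)"
      proof (rule nn_integral_mono_AE, use AE_circ in \<open>rule eventually_mono\<close>)
        fix w :: complex assume "cmod w = 1"
        moreover have "\<bar>?r j\<bar> < 1" by (simp add: field_simps)
        ultimately have "cmod (complex_of_real (?r j) * w) < 1" unfolding norm_mult norm_of_real by simp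
        from Pk_decay[OF small this S(2)]
        show "(\<integral>\<^sup>+ \<omega>. ennreal (cmod (Pk \<phi> \<mu> \<nu> \<omega> (complex_of_real (?r j) * w))) \<partial>Pmeas) \<le> ?B" .
      qed
      finally show "(\<integral>\<^sup>+ \<omega>. (\<integral>\<^sup>+ w. ennreal (cmod (Pk \<phi> \<mu> \<nu> \<omega> (complex_of_real (?r j) * w))) \<partial>circ_measure) \<partial>Pmeas) \<le> ?B"
        by simp
    qed
    finally show ?thesis by (simp add: Liminf_const)
  qed
  with S(1) show ?thesis by (intro that[of "449 * S"]) auto
qed

text \<open>Negative powers of U are entries of forward powers conjugated and transposed, the form
  in which they occur in the Poisson kernel.\<close>

lemma CCadj_pow_entry:
  assumes unit: "\<And>\<kappa>. cmod (\<omega> \<kappa>) = 1"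
  shows "(CCadj \<omega> \<phi> ^^ n) (ebasis \<nu>) \<mu> = cnj ((CCop \<omega> \<phi> ^^ n) (ebasis \<mu>) \<nu>)"
proof -
  have e1: "ell2 ((CCop \<omega> \<phi> ^^ n) (ebasis \<mu>))" for n
    by (induction n) (auto intro: CCop_bounded(1)[where r = 1] simp: unit)
  have e2: "ell2 ((CCadj \<omega> \<phi> ^^ n) (ebasis \<nu>))" for n
    by (induction n) (auto intro!: ell2_Sadj ell2_mult_bounded(1)[where r = 1] simp: CCadj_def unit)
  \<comment> \<open>A second exponent \<open>m\<close> is carried along so that powers can cross the
    inner product one at a time.\<close>
  have "ip ((CCop \<omega> \<phi> ^^ n) (ebasis \<mu>)) ((CCadj \<omega> \<phi> ^^ m) (ebasis \<nu>)) = ip (ebasis \<mu>) ((CCadj \<omega> \<phi> ^^ (n + m)) (ebasis \<nu>))" for m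
  proof (induction n arbitrary: m)
    case (Suc n)
    have "ip ((CCop \<omega> \<phi> ^^ Suc n) (ebasis \<mu>)) ((CCadj \<omega> \<phi> ^^ m) (ebasis \<nu>))
        = ip ((CCop \<omega> \<phi> ^^ n) (ebasis \<mu>)) ((CCadj \<omega> \<phi> ^^ Suc m) (ebasis \<nu>))"
      by (simp add: ip_CCop[OF e1 e2 unit])
    also have "\<dots> = ip (ebasis \<mu>) ((CCadj \<omega> \<phi> ^^ (n + Suc m)) (ebasis \<nu>))" by (rule Suc)
    finally show ?case by simp
  qed simp
  from this[of 0] show ?thesis by (simp add: ip_ebasis_left ip_ebasis_right)
qed

text \<open>For |w| = 1 the kernel at r w is the series of r^|k| w^k times the entry of the k-th
  power. The second resolvent supplies k \<ge> 0, the conjugated one k \<le> 0, and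
  \<open>ebasis \<nu> \<mu>\<close> removes the doubly counted k = 0.\<close>

lemma Pk_coefficient:
  assumes unit: "\<And>\<kappa>. cmod (\<omega> \<kappa>) = 1" and r: "0 \<le> r" "r < 1"
  shows "integrable circ_measure (\<lambda>w. cnj w powi k * Pk \<phi> \<mu> \<nu> \<omega> (complex_of_real r * w))"
    and "(\<integral>w. cnj w powi k * Pk \<phi> \<mu> \<nu> \<omega> (complex_of_real r * w) \<partial>circ_measure)
      = complex_of_real (r ^ nat \<bar>k\<bar>) * CCpow \<omega> \<phi> k (ebasis \<nu>) \<mu>"
proof -
  define c where "c n = complex_of_real r ^ n * (CCop \<omega> \<phi> ^^ n) (ebasis \<nu>) \<mu>" for n
  define d where "d n = complex_of_real r ^ n * (CCop \<omega> \<phi> ^^ n) (ebasis \<mu>) \<nu>" for n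
  have V1: "cmod ((CCop \<omega> \<phi> ^^ n) (ebasis \<kappa>) \<kappa>') \<le> 1" for n \<kappa> \<kappa>'
  proof -
    have "ell2 ((CCop \<omega> \<phi> ^^ n) (ebasis \<kappa>)) \<and> l2norm ((CCop \<omega> \<phi> ^^ n) (ebasis \<kappa>)) \<le> 1"
    proof (induction n)
      case (Suc n)
      then show ?case
        using CCop_bounded[of "(CCop \<omega> \<phi> ^^ n) (ebasis \<kappa>)" \<omega> 1 \<phi>] unit by auto
    qed simp
    then show ?thesis using cmod_le_l2norm order_trans by blast
  qed
  have sc: "summable (\<lambda>n. cmod (c n))" and sd: "summable (\<lambda>n. cmod (d n))"
  proof -
    have g: "summable (\<lambda>n. r ^ n)" using r by (intro summable_geometric) simp
    have le: "cmod (complex_of_real r ^ n * (CCop \<omega> \<phi> ^^ n) (ebasis \<kappa>) \<kappa>') \<le> r ^ n" for n \<kappa> \<kappa>'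
      unfolding norm_mult norm_power norm_of_real using r V1[of n \<kappa> \<kappa>'] by (simp add: mult_left_le)
    show "summable (\<lambda>n. cmod (c n))"
      by (rule summable_comparison_test'[OF g, of 0]) (use le in \<open>simp add: c_def\<close>)
    show "summable (\<lambda>n. cmod (d n))"
      by (rule summable_comparison_test'[OF g, of 0]) (use le in \<open>simp add: d_def\<close>)
  qed
  have Gc: "Gr (\<lambda>\<kappa>. complex_of_real r * w * \<omega> \<kappa>) \<phi> \<nu> \<mu> = (\<Sum>n. c n * w ^ n)" for w
    unfolding Gr_def CCop_phase_pow c_def by (simp add: power_mult_distrib mult_ac)
  have Gd: "Gr (\<lambda>\<kappa>. complex_of_real r * w * \<omega> \<kappa>) \<phi> \<mu> \<nu> = (\<Sum>n. d n * w ^ n)" for w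
    unfolding Gr_def CCop_phase_pow d_def by (simp add: power_mult_distrib mult_ac)
  define m where "m = nat \<bar>k\<bar>"
  \<comment> \<open>Exponents with \<open>cnj w powi k = w ^ a * cnj w ^ b\<close> on the circle,
    avoiding negative powers.\<close>
  define a b where "a = (if k \<ge> 0 then 0 else m)" and "b = (if k \<ge> 0 then m else 0)"
  have powi: "cnj w powi k = w ^ a * cnj w ^ b" if "cmod w = 1" for w
  proof (cases "k \<ge> 0")
    case True
    then show ?thesis by (simp add: a_def b_def m_def power_int_def)
  next
    case False
    have "inverse (cnj w) = w" using complex_norm_square[of w] that by (intro inverse_unique) (simp add: mult.commute)
    with False show ?thesis by (simp add: a_def b_def m_def power_int_def power_inverse)
  qed
  let ?A = "\<lambda>w. w ^ a * cnj w ^ b * (\<Sum>n. c n * w ^ n)"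
  let ?D = "\<lambda>w. w ^ b * cnj w ^ a * (\<Sum>n. d n * w ^ n)"
  let ?E = "\<lambda>w. ebasis \<nu> \<mu> * (w ^ a * cnj w ^ b)"
  have iE: "integrable circ_measure (\<lambda>w. w ^ a * cnj w ^ b)"
    by (rule circ.integrable_const_bound[of _ 1]) (use AE_circ in \<open>auto elim!: eventually_mono simp: norm_mult norm_power\<close>)
  note iA = circ_coeff[OF sc, of a b] and iD = circ_coeff[OF sd, of b a]
  have eq: "AE w in circ_measure. cnj w powi k * Pk \<phi> \<mu> \<nu> \<omega> (complex_of_real r * w) = cnj (?D w) + ?A w - ?E w"
    unfolding Pk_def Gc Gd using AE_circ by (rule eventually_mono) (simp add: powi algebra_simps)
  have [measurable]: "(\<lambda>w. Pk \<phi> \<mu> \<nu> \<omega> (complex_of_real r * w)) \<in> borel_measurable borel"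
    unfolding Pk_def Gc Gd by measurable
  have [measurable]: "(\<lambda>w. cnj w powi k) \<in> borel_measurable borel"
    unfolding power_int_def by measurable
  have lin: "(\<integral>w. cnj (f w) + g w - u * h w \<partial>circ_measure)
      = cnj (\<integral>w. f w \<partial>circ_measure) + (\<integral>w. g w \<partial>circ_measure) - u * (\<integral>w. h w \<partial>circ_measure)"
    if "integrable circ_measure f" "integrable circ_measure g" "integrable circ_measure h"
    for f g h :: "complex \<Rightarrow> complex" and u
    using that by simp
  have int: "integrable circ_measure (\<lambda>w. cnj (?D w) + ?A w - ?E w)"
    by (intro Bochner_Integration.integrable_diff Bochner_Integration.integrable_add integrable_cnj
        integrable_mult_right iA(1) iD(1) iE)
  show "integrable circ_measure (\<lambda>w. cnj w powi k * Pk \<phi> \<mu> \<nu> \<omega> (complex_of_real r * w))"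
    by (subst integrable_cong_AE[OF _ _ eq]) (use int in auto)
  have "(\<integral>w. cnj w powi k * Pk \<phi> \<mu> \<nu> \<omega> (complex_of_real r * w) \<partial>circ_measure)
      = (\<integral>w. cnj (?D w) + ?A w - ?E w \<partial>circ_measure)"
    by (rule integral_cong_AE[OF _ _ eq]) measurable
  also have "\<dots> = cnj (\<integral>w. ?D w \<partial>circ_measure) + (\<integral>w. ?A w \<partial>circ_measure) - ebasis \<nu> \<mu> * (\<integral>w. w ^ a * cnj w ^ b \<partial>circ_measure)"
    by (rule lin[OF iD(1) iA(1) iE])
  also have "\<dots> = cnj (if b \<le> a then d (a - b) else 0) + (if a \<le> b then c (b - a) else 0) - ebasis \<nu> \<mu> * (if a = b then 1 else 0)"
    unfolding iA(2) iD(2) circ_moment_cnj ..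
  also have "\<dots> = complex_of_real (r ^ nat \<bar>k\<bar>) * CCpow \<omega> \<phi> k (ebasis \<nu>) \<mu>"
  proof (cases "k \<ge> 0")
    case True
    then have ab: "a = 0" "b = m" and km: "nat k = m" "nat \<bar>k\<bar> = m" by (auto simp: a_def b_def m_def)
    show ?thesis
      using True unfolding ab km CCpow_def by (cases "m = 0") (auto simp: c_def d_def ebasis_def)
  next
    case False
    then have ab: "a = m" "b = 0" "m \<noteq> 0" and km: "nat (- k) = m" "nat \<bar>k\<bar> = m"
      by (auto simp: a_def b_def m_def)
    show ?thesis
      using False ab(3) unfolding ab(1,2) km CCpow_def by (simp add: d_def CCadj_pow_entry[OF unit])
  qed
  finally show "(\<integral>w. cnj w powi k * Pk \<phi> \<mu> \<nu> \<omega> (complex_of_real r * w) \<partial>circ_measure)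
      = complex_of_real (r ^ nat \<bar>k\<bar>) * CCpow \<omega> \<phi> k (ebasis \<nu>) \<mu>" .
qed

text \<open>Integrating p (cnj w) against the kernel at radius r gives the entry of p (U) with its
  k-th coefficient damped by r^|k|. If |p| \<le> 1 on the circle, this is at most the integral of
  the modulus of the kernel; then r tends to 1.\<close>

lemma Laurent_le_corr:
  assumes unit: "\<And>\<kappa>. cmod (\<omega> \<kappa>) = 1" and K: "finite K"
    and le: "\<And>x. x \<in> circle \<Longrightarrow> cmod (\<Sum>k\<in>K. a k * x powi k) \<le> 1"
  shows "ennreal (cmod (\<Sum>k\<in>K. a k * CCpow \<omega> \<phi> k (ebasis \<nu>) \<mu>)) \<le> corr \<phi> \<mu> \<nu> \<omega>"
proof -
  let ?r = "\<lambda>j. 1 - 1 / real (j + 2)"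
  let ?V = "\<lambda>k. CCpow \<omega> \<phi> k (ebasis \<nu>) \<mu>"
  let ?P = "\<lambda>j w. Pk \<phi> \<mu> \<nu> \<omega> (complex_of_real (?r j) * w)"
  have bound: "ennreal (cmod (\<Sum>k\<in>K. a k * (complex_of_real (?r j ^ nat \<bar>k\<bar>) * ?V k)))
      \<le> (\<integral>\<^sup>+ w. ennreal (cmod (?P j w)) \<partial>circ_measure)" for j
  proof -
    have r: "0 \<le> ?r j" "?r j < 1" by (simp_all add: field_simps)
    note c = Pk_coefficient[of \<omega> "?r j" _ \<phi> \<mu> \<nu>, OF unit r]
    have eq: "(\<Sum>k\<in>K. a k * (cnj w powi k * ?P j w)) = (\<Sum>k\<in>K. a k * cnj w powi k) * ?P j w" for w
      by (simp add: sum_distrib_right mult.assoc)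
    have "(\<Sum>k\<in>K. a k * (complex_of_real (?r j ^ nat \<bar>k\<bar>) * ?V k))
        = (\<Sum>k\<in>K. \<integral>w. a k * (cnj w powi k * ?P j w) \<partial>circ_measure)"
      by (intro sum.cong refl) (simp only: integral_mult_right_zero c(2))
    also have "\<dots> = (\<integral>w. (\<Sum>k\<in>K. a k * (cnj w powi k * ?P j w)) \<partial>circ_measure)"
      by (rule Bochner_Integration.integral_sum[symmetric]) (rule integrable_mult_right, rule c(1))
    finally have "ennreal (cmod (\<Sum>k\<in>K. a k * (complex_of_real (?r j ^ nat \<bar>k\<bar>) * ?V k)))
        \<le> (\<integral>\<^sup>+ w. ennreal (cmod (\<Sum>k\<in>K. a k * (cnj w powi k * ?P j w))) \<partial>circ_measure)"
      by (simp only:) (rule integral_norm_bound_ennreal,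
        rule Bochner_Integration.integrable_sum, rule integrable_mult_right, rule c(1))
    also have "\<dots> \<le> (\<integral>\<^sup>+ w. ennreal (cmod (?P j w)) \<partial>circ_measure)"
    proof (rule nn_integral_mono_AE, use AE_circ in \<open>rule eventually_mono\<close>)
      fix w :: complex assume "cmod w = 1"
      then have "cmod (\<Sum>k\<in>K. a k * cnj w powi k) \<le> 1" by (intro le) (simp add: circle_def)
      then show "ennreal (cmod (\<Sum>k\<in>K. a k * (cnj w powi k * ?P j w))) \<le> ennreal (cmod (?P j w))"
        unfolding eq norm_mult by (intro ennreal_leI mult_left_le_one_le) auto
    qed
    finally show ?thesis .
  qed
  have "(\<lambda>j. cmod (\<Sum>k\<in>K. a k * (complex_of_real (?r j ^ nat \<bar>k\<bar>) * ?V k)))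
      \<longlonglongrightarrow> cmod (\<Sum>k\<in>K. a k * (complex_of_real (1 ^ nat \<bar>k\<bar>) * ?V k))"
  proof (intro tendsto_intros)
    have "(\<lambda>j. 1 / real (j + 2)) \<longlonglongrightarrow> 0"
      using LIMSEQ_ignore_initial_segment[OF lim_1_over_n, of 2] by simp
    from tendsto_diff[OF tendsto_const this, of 1] show "?r \<longlonglongrightarrow> 1" by simp
  qed
  then have "(\<lambda>j. ennreal (cmod (\<Sum>k\<in>K. a k * (complex_of_real (?r j ^ nat \<bar>k\<bar>) * ?V k))))
      \<longlonglongrightarrow> ennreal (cmod (\<Sum>k\<in>K. a k * ?V k))"
    by (intro tendsto_ennrealI) simp
  from lim_imp_Liminf[OF _ this]
  have "ennreal (cmod (\<Sum>k\<in>K. a k * ?V k)) = liminf (\<lambda>j. ennreal (cmod (\<Sum>k\<in>K. a k * (complex_of_real (?r j ^ nat \<bar>k\<bar>) * ?V k))))"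
    by simp
  also have "\<dots> \<le> corr \<phi> \<mu> \<nu> \<omega>"
    unfolding corr_def by (rule Liminf_mono) (use bound in auto)
  finally show ?thesis .
qed

subsection \<open>Functional calculus\<close>

text \<open>Laurent polynomials as \<open>x\<^sup>-\<^sup>N p(x)\<close>.\<close>

definition Laurent :: "(complex \<Rightarrow> complex) \<Rightarrow> bool" where
  "Laurent g \<longleftrightarrow> (\<exists>N p. \<forall>x\<in>circle. x ^ N * g x = poly p x)"

lemma Laurent_add: assumes "Laurent f" "Laurent g" shows "Laurent (\<lambda>x. f x + g x)"
proof -
  obtain N p M q where *: "\<forall>x\<in>circle. x ^ N * f x = poly p x" "\<forall>x\<in>circle. x ^ M * g x = poly q x"
    using assms unfolding Laurent_def by blast
  have "x ^ (N + M) * (f x + g x) = poly (monom 1 M * p + monom 1 N * q) x" if "x \<in> circle" for x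
  proof -
    have "x ^ (N + M) * (f x + g x) = x ^ M * (x ^ N * f x) + x ^ N * (x ^ M * g x)"
      by (simp add: power_add algebra_simps)
    then show ?thesis using * that by (simp add: poly_monom)
  qed
  then show ?thesis unfolding Laurent_def by blast
qed

lemma Laurent_mult: assumes "Laurent f" "Laurent g" shows "Laurent (\<lambda>x. f x * g x)"
proof -
  obtain N p M q where *: "\<forall>x\<in>circle. x ^ N * f x = poly p x" "\<forall>x\<in>circle. x ^ M * g x = poly q x"
    using assms unfolding Laurent_def by blast
  have "x ^ (N + M) * (f x * g x) = poly (p * q) x" if "x \<in> circle" for x
  proof -
    have "x ^ (N + M) * (f x * g x) = (x ^ N * f x) * (x ^ M * g x)"
      by (simp add: power_add mult_ac)
    then show ?thesis using * that by simp
  qed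
  then show ?thesis unfolding Laurent_def by blast
qed

lemma Laurent_const: "Laurent (\<lambda>_. c)"
  unfolding Laurent_def by (intro exI[of _ 0] exI[of _ "[:c:]"]) simp

lemma circle_cnj: "x \<in> circle \<Longrightarrow> x * cnj x = 1"
  using complex_norm_square[of x] by (simp add: circle_def)

text \<open>A real linear function of x is a combination of x and \<open>cnj x\<close>. On the
  circle \<open>cnj x\<close> is the inverse of x, so multiplication by x makes it a quadratic
  polynomial; sums and products follow by closure.\<close>

lemma Laurent_real_polynomial:
  fixes q :: "complex \<Rightarrow> real"
  assumes "real_polynomial_function q" shows "Laurent (\<lambda>x. complex_of_real (q x))"
  using assms
proof (induction rule: real_polynomial_function.induct)
  case (linear f)
  let ?u = "complex_of_real (f 1)" and ?v = "complex_of_real (f \<i>)"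
  have f: "f x = Re x * f 1 + Im x * f \<i>" for x
  proof -
    have "x = Re x *\<^sub>R 1 + Im x *\<^sub>R \<i>" by (simp add: complex_eq_iff)
    then have "f x = f (Re x *\<^sub>R 1 + Im x *\<^sub>R \<i>)" by simp
    also have "\<dots> = Re x * f 1 + Im x * f \<i>"
      by (simp only: linear_simps[OF linear] real_scaleR_def)
    finally show ?thesis .
  qed
  have "x ^ 1 * complex_of_real (f x) = poly [: (?u + \<i> * ?v) / 2, 0, (?u - \<i> * ?v) / 2 :] x" if "x \<in> circle" for x
  proof -
    have re: "complex_of_real (Re x) = (x + cnj x) / 2" by (simp add: complex_eq_iff)
    have im: "complex_of_real (Im x) = (x - cnj x) / (2 * \<i>)" by (simp add: complex_eq_iff)
    have "x ^ 1 * complex_of_real (f x) = x * (complex_of_real (Re x) * ?u + complex_of_real (Im x) * ?v)"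
      unfolding f[of x] by simp
    also have "\<dots> = (x * x + x * cnj x) / 2 * ?u + (x * x - x * cnj x) / (2 * \<i>) * ?v"
      unfolding re im by (simp add: algebra_simps add_divide_distrib diff_divide_distrib)
    also have "\<dots> = poly [: (?u + \<i> * ?v) / 2, 0, (?u - \<i> * ?v) / 2 :] x"
      unfolding circle_cnj[OF that] by (simp add: field_simps)
    finally show ?thesis .
  qed
  then show ?case unfolding Laurent_def by blast
qed (auto intro: Laurent_const Laurent_add Laurent_mult)

lemma Laurent_coefficients:
  assumes "Laurent g"
  obtains a :: "int \<Rightarrow> complex" where "finite {k. a k \<noteq> 0}"
    "\<And>x. x \<in> circle \<Longrightarrow> (\<Sum>k\<in>{k. a k \<noteq> 0}. a k * x powi k) = g x"
proof -
  obtain N p where p: "\<forall>x\<in>circle. x ^ N * g x = poly p x" using assms unfolding Laurent_def by blast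
  define a where "a k = (if - int N \<le> k then coeff p (nat (k + int N)) else 0)" for k
  let ?J = "(\<lambda>i. int i - int N) ` {..degree p}"
  have sub: "{k. a k \<noteq> 0} \<subseteq> ?J"
  proof
    fix k assume "k \<in> {k. a k \<noteq> 0}"
    then have k: "- int N \<le> k" "coeff p (nat (k + int N)) \<noteq> 0" by (auto simp: a_def split: if_splits)
    then have "nat (k + int N) \<le> degree p" by (intro le_degree)
    moreover have "k = int (nat (k + int N)) - int N" using k(1) by simp
    ultimately show "k \<in> ?J" by blast
  qed
  show thesis
  proof (rule that)
    show fin: "finite {k. a k \<noteq> 0}" using sub by (rule finite_subset) simp
    fix x assume x: "x \<in> circle"
    then have x0: "x \<noteq> 0" by (auto simp: circle_def)
    have "(\<Sum>k\<in>{k. a k \<noteq> 0}. a k * x powi k) = (\<Sum>k\<in>?J. a k * x powi k)"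
      by (rule sum.mono_neutral_left) (use sub in auto)
    also have "\<dots> = (\<Sum>i\<le>degree p. a (int i - int N) * x powi (int i - int N))"
      by (subst sum.reindex) (auto simp: inj_on_def)
    also have "\<dots> = (\<Sum>i\<le>degree p. coeff p i * x ^ i / x ^ N)"
      using x0 by (intro sum.cong refl) (simp add: a_def power_int_diff)
    also have "\<dots> = poly p x / x ^ N" by (simp add: poly_altdef sum_divide_distrib)
    also have "\<dots> = g x" using p x x0 by (simp add: field_simps)
    finally show "(\<Sum>k\<in>{k. a k \<noteq> 0}. a k * x powi k) = g x" .
  qed
qed

lemma Laurent_dense:
  assumes f: "continuous_on circle f" and e: "0 < e"
  obtains a :: "int \<Rightarrow> complex" where "finite {k. a k \<noteq> 0}"
    "\<And>x. x \<in> circle \<Longrightarrow> cmod ((\<Sum>k\<in>{k. a k \<noteq> 0}. a k * x powi k) - f x) < e"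
proof -
  have eq: "circle = sphere 0 1" by (auto simp: circle_def)
  have "compact circle" unfolding eq by (rule compact_sphere)
  from Stone_Weierstrass_polynomial_function[OF this f e] obtain g where
    g: "polynomial_function g" "\<forall>x\<in>circle. cmod (f x - g x) < e" by blast
  have "real_polynomial_function (\<lambda>x. Re (g x))" "real_polynomial_function (\<lambda>x. Im (g x))"
    using g(1) bounded_linear_Re bounded_linear_Im unfolding polynomial_function_def o_def by blast+
  then have "Laurent (\<lambda>x. complex_of_real (Re (g x)) + \<i> * complex_of_real (Im (g x)))"
    by (intro Laurent_add Laurent_mult Laurent_const Laurent_real_polynomial)
  then have "Laurent g" by (simp flip: complex_eq)
  then obtain a :: "int \<Rightarrow> complex" where a: "finite {k. a k \<noteq> 0}"
    "\<And>x. x \<in> circle \<Longrightarrow> (\<Sum>k\<in>{k. a k \<noteq> 0}. a k * x powi k) = g x"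
    by (rule Laurent_coefficients) blast
  show ?thesis by (rule that[OF a(1)]) (use a(2) g(2) in \<open>simp add: norm_minus_commute\<close>)
qed

section \<open>Functional calculus on the event of finite correlators\<close>

text \<open>One event of full probability, chosen independently of functions, times and initial
  vectors. On it the bounds by the correlator are deterministic.\<close>

definition good :: "real \<Rightarrow> vec \<Rightarrow> bool" where
  "good \<phi> \<omega> \<longleftrightarrow> (\<forall>\<kappa>. cmod (\<omega> \<kappa>) = 1) \<and> (\<forall>\<mu> \<nu>. corr \<phi> \<mu> \<nu> \<omega> \<noteq> \<top>)"

abbreviation rcorr :: "real \<Rightarrow> vec \<Rightarrow> site \<Rightarrow> site \<Rightarrow> real" where
  "rcorr \<phi> \<omega> \<mu> \<nu> \<equiv> enn2real (corr \<phi> \<mu> \<nu> \<omega>)"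

lemma AE_good:
  assumes "sqrt \<bar>cos \<phi>\<bar> * sqrt \<bar>sin \<phi>\<bar> \<le> 1 / 56"
  shows "AE \<omega> in Pmeas. good \<phi> \<omega>"
proof -
  obtain c where c: "\<And>\<mu> \<nu>. (\<integral>\<^sup>+ \<omega>. corr \<phi> \<mu> \<nu> \<omega> \<partial>Pmeas) \<le> ennreal (c * exp (- (ln 2 / 20) * real (sdist \<mu> \<nu>)))"
    using corr_decay[OF assms] by blast
  have "AE \<omega> in Pmeas. corr \<phi> \<mu> \<nu> \<omega> \<noteq> \<top>" for \<mu> \<nu>
  proof -
    have "(\<integral>\<^sup>+ \<omega>. corr \<phi> \<mu> \<nu> \<omega> \<partial>Pmeas) \<noteq> \<infinity>" using neq_top_trans[OF _ c[of \<mu> \<nu>]] by simp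
    from nn_integral_PInf_AE[OF measurable_corr this] show ?thesis by simp
  qed
  then show ?thesis unfolding good_def AE_conj_iff AE_all_countable using AE_Pmeas[unfolded AE_all_countable] by blast
qed

context
  fixes \<phi> :: real and \<omega> :: vec
  assumes good: "good \<phi> \<omega>"
begin

lemma corr_rcorr: "corr \<phi> \<mu> \<nu> \<omega> = ennreal (rcorr \<phi> \<omega> \<mu> \<nu>)"
proof -
  have "corr \<phi> \<mu> \<nu> \<omega> \<noteq> \<top>" using good unfolding good_def by blast
  then show ?thesis by (simp add: less_top)
qed

lemma le_rcorr: assumes "ennreal x \<le> corr \<phi> \<mu> \<nu> \<omega>" shows "x \<le> rcorr \<phi> \<omega> \<mu> \<nu>"
  using order_trans[OF assms eq_refl[OF corr_rcorr]] by (subst (asm) ennreal_le_iff) auto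

lemma Laurent_entry_bound:
  assumes K: "finite K" and M: "0 < M"
    and le: "\<And>x. x \<in> circle \<Longrightarrow> cmod (\<Sum>k\<in>K. a k * x powi k) \<le> M"
  shows "cmod (\<Sum>k\<in>K. a k * CCpow \<omega> \<phi> k (ebasis \<nu>) \<mu>) \<le> M * rcorr \<phi> \<omega> \<mu> \<nu>"
proof -
  have unit: "\<And>\<kappa>. cmod (\<omega> \<kappa>) = 1" using good unfolding good_def by blast
  let ?b = "\<lambda>k. a k / complex_of_real M"
  have sc: "(\<Sum>k\<in>K. ?b k * v k) = (\<Sum>k\<in>K. a k * v k) / complex_of_real M" for v :: "int \<Rightarrow> complex"
    by (simp add: sum_divide_distrib)
  have "cmod (\<Sum>k\<in>K. ?b k * x powi k) \<le> 1" if "x \<in> circle" for x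
    unfolding sc using le[OF that] M by (simp add: norm_divide)
  from le_rcorr[OF Laurent_le_corr[of \<omega> K ?b \<phi> \<nu> \<mu>, OF unit K this]]
  have "cmod ((\<Sum>k\<in>K. a k * CCpow \<omega> \<phi> k (ebasis \<nu>) \<mu>) / complex_of_real M) \<le> rcorr \<phi> \<omega> \<mu> \<nu>"
    unfolding sc .
  then show ?thesis using M by (simp add: norm_divide divide_le_eq mult.commute)
qed

text \<open>Monomials have modulus 1 on the circle, so the correlator dominates all powers of U,
  uniformly in time.\<close>

lemma entry_bound: "cmod (CCpow \<omega> \<phi> n (ebasis \<nu>) \<mu>) \<le> rcorr \<phi> \<omega> \<mu> \<nu>"
  using Laurent_entry_bound[of "{n}" 1 "\<lambda>_. 1" \<nu> \<mu>]
  by (simp add: circle_def norm_power_int)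

text \<open>\<open>fcalc_entry\<close> is a definite description, so the limit must be shown to
  exist and to be the same for all approximating sequences. Both hold because p -> <e_mu, p (U)
  e_nu> is Lipschitz in the sup norm, with constant \<open>rcorr\<close>.\<close>

lemma fcalc_entry_bound:
  assumes f: "continuous_on circle f" and f1: "\<And>x. x \<in> circle \<Longrightarrow> cmod (f x) \<le> 1"
  shows "cmod (fcalc_entry \<omega> \<phi> f \<mu> \<nu>) \<le> rcorr \<phi> \<omega> \<mu> \<nu>"
proof -
  let ?S = "\<lambda>a :: int \<Rightarrow> complex. {k. a k \<noteq> 0}"
  let ?p = "\<lambda>a x. \<Sum>k\<in>?S a. a k * x powi k"
  let ?L = "\<lambda>a. \<Sum>k\<in>?S a. a k * CCpow \<omega> \<phi> k (ebasis \<nu>) \<mu>"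
  let ?h = "rcorr \<phi> \<omega> \<mu> \<nu>"
  have h0: "0 \<le> ?h" by simp
  have diff: "cmod (?L a - ?L b) \<le> M * ?h"
    if "finite (?S a)" "finite (?S b)" "0 < M" "\<And>x. x \<in> circle \<Longrightarrow> cmod (?p a x - ?p b x) \<le> M" for a b M
  proof -
    let ?K = "?S a \<union> ?S b"
    have e: "(\<Sum>k\<in>?S a. a k * v k) - (\<Sum>k\<in>?S b. b k * v k) = (\<Sum>k\<in>?K. (a k - b k) * v k)" for v :: "int \<Rightarrow> complex"
    proof -
      have "(\<Sum>k\<in>?S a. a k * v k) = (\<Sum>k\<in>?K. a k * v k)" "(\<Sum>k\<in>?S b. b k * v k) = (\<Sum>k\<in>?K. b k * v k)"
        using that by (auto intro!: sum.mono_neutral_left)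
      then show ?thesis by (simp add: sum_subtractf left_diff_distrib)
    qed
    show ?thesis unfolding e
      by (rule Laurent_entry_bound) (use that in \<open>auto simp flip: e\<close>)
  qed
  define A where "A a \<longleftrightarrow> (\<forall>n. finite (?S (a n))) \<and> uniform_limit circle (\<lambda>n. ?p (a n)) f sequentially"
    for a :: "nat \<Rightarrow> int \<Rightarrow> complex"
  have A_fin: "\<forall>n. finite (?S (a n))" and A_lim: "uniform_limit circle (\<lambda>n. ?p (a n)) f sequentially"
    if "A a" for a using that unfolding A_def by (rule conjunct1, rule conjunct2)
  have "\<exists>a. finite (?S a) \<and> (\<forall>x\<in>circle. cmod (?p a x - f x) < inverse (real (Suc n)))" for n
  proof -
    have "0 < inverse (real (Suc n))" by simp
    then show ?thesis
    proof (rule Laurent_dense[OF f])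
      fix a :: "int \<Rightarrow> complex"
      assume "finite (?S a)" "\<And>x. x \<in> circle \<Longrightarrow> cmod (?p a x - f x) < inverse (real (Suc n))"
      then show ?thesis by (intro exI[of _ a] conjI ballI)
    qed
  qed
  then have "\<forall>n. \<exists>a. finite (?S a) \<and> (\<forall>x\<in>circle. cmod (?p a x - f x) < inverse (real (Suc n)))" ..
  then have "\<exists>a. \<forall>n. finite (?S (a n)) \<and> (\<forall>x\<in>circle. cmod (?p (a n) x - f x) < inverse (real (Suc n)))"
    by (rule choice)
  then obtain a where a': "\<forall>n. finite (?S (a n)) \<and> (\<forall>x\<in>circle. cmod (?p (a n) x - f x) < inverse (real (Suc n)))" ..
  have a: "finite (?S (a n))" "\<And>x. x \<in> circle \<Longrightarrow> cmod (?p (a n) x - f x) < inverse (real (Suc n))" for n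
    using spec[OF a', of n] by auto
  have Aa: "A a"
    unfolding A_def
  proof (intro conjI allI a(1))
    show "uniform_limit circle (\<lambda>n. ?p (a n)) f sequentially"
    proof (rule uniform_limitI)
      fix e :: real assume "0 < e"
      then obtain N where N: "inverse (real (Suc N)) < e" using reals_Archimedean by blast
      have "\<forall>x\<in>circle. dist (?p (a n) x) (f x) < e" if "N \<le> n" for n
      proof
        fix x assume "x \<in> circle"
        have "inverse (real (Suc n)) \<le> inverse (real (Suc N))" using that by (simp add: field_simps)
        with a(2)[OF \<open>x \<in> circle\<close>, of n] N show "dist (?p (a n) x) (f x) < e" unfolding dist_norm by linarith
      qed
      then show "\<forall>\<^sub>F n in sequentially. \<forall>x\<in>circle. dist (?p (a n) x) (f x) < e"
        unfolding eventually_sequentially by blast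
    qed
  qed
  \<comment> \<open>Two sequences are compared at independent indices: equal sequences give the
    Cauchy property, different ones the independence of the limit.\<close>
  have close: "\<exists>N. \<forall>m\<ge>N. \<forall>n\<ge>N. cmod (?L (b m) - ?L (b' n)) < e" if "A b" "A b'" "0 < e" for b b' e
  proof -
    \<comment> \<open>\<open>?h\<close> may be 0, hence the \<open>+ 1\<close>; two errors
      \<open>d\<close> then contribute at most \<open>e / 2\<close>.\<close>
    define d where "d = e / (4 * (?h + 1))"
    have d: "0 < d" unfolding d_def by (intro divide_pos_pos mult_pos_pos add_nonneg_pos that(3) h0) simp_all
    note eventually_conj[OF uniform_limitD[OF A_lim[OF that(1)] d] uniform_limitD[OF A_lim[OF that(2)] d]]
    then obtain N where N': "\<forall>n\<ge>N. (\<forall>x\<in>circle. dist (?p (b n) x) (f x) < d) \<and> (\<forall>x\<in>circle. dist (?p (b' n) x) (f x) < d)"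
      unfolding eventually_sequentially ..
    have N: "x \<in> circle \<Longrightarrow> dist (?p (b n) x) (f x) < d" "x \<in> circle \<Longrightarrow> dist (?p (b' n) x) (f x) < d"
      if "N \<le> n" for n x
      using N' that by simp_all
    have "cmod (?L (b m) - ?L (b' n)) < e" if mn: "N \<le> m" "N \<le> n" for m n
    proof -
      have "cmod (?L (b m) - ?L (b' n)) \<le> 2 * d * ?h"
      proof (rule diff)
        fix x assume x: "x \<in> circle"
        show "cmod (?p (b m) x - ?p (b' n) x) \<le> 2 * d"
          using dist_triangle2[of "?p (b m) x" "?p (b' n) x" "f x"] N(1)[OF mn(1) x] N(2)[OF mn(2) x]
          by (simp add: dist_norm)
      qed (use A_fin[OF \<open>A b\<close>] A_fin[OF \<open>A b'\<close>] d in simp_all)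
      also have "\<dots> \<le> 2 * d * (?h + 1)" using d by (intro mult_left_mono) auto
      also have "\<dots> = e / 2"
      proof -
        have "2 * (e / (4 * u)) * u = e / 2" if "0 < u" for u :: real using that by simp
        moreover have "0 < ?h + 1" by (intro add_nonneg_pos h0) simp
        ultimately show ?thesis unfolding d_def by blast
      qed
      also have "\<dots> < e" using \<open>0 < e\<close> by simp
      finally show ?thesis .
    qed
    then show ?thesis by blast
  qed
  have "Cauchy (\<lambda>n. ?L (a n))"
    by (rule CauchyI) (rule close[OF Aa Aa])
  then obtain z where z: "(\<lambda>n. ?L (a n)) \<longlonglongrightarrow> z"
    using Cauchy_convergent convergent_def by blast
  have all: "(\<lambda>n. ?L (b n)) \<longlonglongrightarrow> z" if "A b" for b
  proof -
    have "(\<lambda>n. ?L (b n) - ?L (a n)) \<longlonglongrightarrow> 0"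
    proof (rule LIMSEQ_I)
      fix e :: real assume "0 < e"
      from close[OF that Aa this] show "\<exists>N. \<forall>n\<ge>N. cmod (?L (b n) - ?L (a n) - 0) < e" by auto
    qed
    from tendsto_add[OF this z] show ?thesis by simp
  qed
  have fc: "fcalc_entry \<omega> \<phi> f \<mu> \<nu> = z"
    unfolding fcalc_entry_def
  proof (rule the_equality)
    show "\<forall>a. (\<forall>n. finite (?S (a n))) \<and> uniform_limit circle (\<lambda>n. ?p (a n)) f sequentially
        \<longrightarrow> (\<lambda>n. ?L (a n)) \<longlonglongrightarrow> z"
      using all unfolding A_def by blast
    fix z' assume "\<forall>a. (\<forall>n. finite (?S (a n))) \<and> uniform_limit circle (\<lambda>n. ?p (a n)) f sequentially
        \<longrightarrow> (\<lambda>n. ?L (a n)) \<longlonglongrightarrow> z'"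
    then have "(\<lambda>n. ?L (a n)) \<longlonglongrightarrow> z'" using Aa unfolding A_def by blast
    then show "z' = z" using z LIMSEQ_unique by blast
  qed
  \<comment> \<open>The approximants may exceed 1 on the circle by their error, an excess that
    vanishes in the limit.\<close>
  have bd: "cmod (?L (a n)) \<le> (1 + inverse (real (Suc n))) * ?h" for n
  proof (rule Laurent_entry_bound[OF a(1)])
    fix x assume x: "x \<in> circle"
    have "cmod (?p (a n) x) \<le> cmod (?p (a n) x - f x) + cmod (f x)"
      using norm_triangle_ineq[of "?p (a n) x - f x" "f x"] by simp
    then show "cmod (?p (a n) x) \<le> 1 + inverse (real (Suc n))" using a(2)[OF x, of n] f1[OF x] by linarith
  qed (simp add: add_pos_pos)
  have "(\<lambda>n. (1 + inverse (real (Suc n))) * ?h) \<longlonglongrightarrow> (1 + 0) * ?h"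
    by (intro tendsto_intros LIMSEQ_inverse_real_of_nat)
  from LIMSEQ_le[OF tendsto_norm[OF z] this] bd show ?thesis by (simp add: fc)
qed

lemma fcalc_Sup_bound:
  "Sup {cmod (fcalc_entry \<omega> \<phi> f \<mu> \<nu>) | f. continuous_on circle f \<and> (\<forall>z\<in>circle. cmod (f z) \<le> 1)}
    \<le> rcorr \<phi> \<omega> \<mu> \<nu>"
proof (rule cSup_least)
  have "cmod (fcalc_entry \<omega> \<phi> (\<lambda>_. 0) \<mu> \<nu>)
      \<in> {cmod (fcalc_entry \<omega> \<phi> f \<mu> \<nu>) | f. continuous_on circle f \<and> (\<forall>z\<in>circle. cmod (f z) \<le> 1)}"
    by (intro CollectI exI[of _ "\<lambda>_. 0"]) simp
  then show "{cmod (fcalc_entry \<omega> \<phi> f \<mu> \<nu>) | f. continuous_on circle f \<and> (\<forall>z\<in>circle. cmod (f z) \<le> 1)} \<noteq> {}"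
    by blast
qed (auto intro: fcalc_entry_bound)

end

lemma znorm_le_sdist: "znorm (\<mu> - \<nu>) \<le> real (sdist \<mu> \<nu>)"
proof -
  have "znorm (\<mu> - \<nu>) \<le> sqrt ((real_of_int \<bar>fst \<mu> - fst \<nu>\<bar> + real_of_int \<bar>snd \<mu> - snd \<nu>\<bar>)\<^sup>2)"
    unfolding znorm_def by (rule real_sqrt_le_mono) (simp add: power2_sum)
  then show ?thesis by (simp add: sdist_def)
qed

lemma fcalc_localization:
  assumes small: "sqrt \<bar>cos \<phi>\<bar> * sqrt \<bar>sin \<phi>\<bar> \<le> 1 / 56"
  shows "\<exists>c g::real. c > 0 \<and> g > 0 \<and> (\<forall>\<mu> \<nu>::site.
        (\<integral>\<^sup>+ \<omega>. ennreal (Sup {cmod (fcalc_entry \<omega> \<phi> f \<mu> \<nu>) | f.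
              continuous_on circle f \<and> (\<forall>z\<in>circle. cmod (f z) \<le> 1)}) \<partial>Pmeas)
        \<le> ennreal (c * exp (- g * znorm (\<mu> - \<nu>))))"
proof -
  obtain c where c: "0 < c"
    "\<And>\<mu> \<nu>. (\<integral>\<^sup>+ \<omega>. corr \<phi> \<mu> \<nu> \<omega> \<partial>Pmeas) \<le> ennreal (c * exp (- (ln 2 / 20) * real (sdist \<mu> \<nu>)))"
    using corr_decay[OF small] by blast
  have "(\<integral>\<^sup>+ \<omega>. ennreal (Sup {cmod (fcalc_entry \<omega> \<phi> f \<mu> \<nu>) | f.
              continuous_on circle f \<and> (\<forall>z\<in>circle. cmod (f z) \<le> 1)}) \<partial>Pmeas)
        \<le> ennreal (c * exp (- (ln 2 / 20) * znorm (\<mu> - \<nu>)))" for \<mu> \<nu>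
  proof -
    have "(\<integral>\<^sup>+ \<omega>. ennreal (Sup {cmod (fcalc_entry \<omega> \<phi> f \<mu> \<nu>) | f.
              continuous_on circle f \<and> (\<forall>z\<in>circle. cmod (f z) \<le> 1)}) \<partial>Pmeas)
        \<le> (\<integral>\<^sup>+ \<omega>. corr \<phi> \<mu> \<nu> \<omega> \<partial>Pmeas)"
    \<comment> \<open>The supremum over uncountably many functions is treated by monotonicity alone;
      measurability enters through \<open>corr\<close>.\<close>
    proof (rule nn_integral_mono_AE, use AE_good[OF small] in \<open>rule eventually_mono\<close>)
      fix \<omega> assume g: "good \<phi> \<omega>"
      show "ennreal (Sup {cmod (fcalc_entry \<omega> \<phi> f \<mu> \<nu>) | f.
              continuous_on circle f \<and> (\<forall>z\<in>circle. cmod (f z) \<le> 1)}) \<le> corr \<phi> \<mu> \<nu> \<omega>"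
        by (subst corr_rcorr[OF g]) (rule ennreal_leI[OF fcalc_Sup_bound[OF g]])
    qed
    also have "\<dots> \<le> ennreal (c * exp (- (ln 2 / 20) * real (sdist \<mu> \<nu>)))" by (rule c(2))
    also have "\<dots> \<le> ennreal (c * exp (- (ln 2 / 20) * znorm (\<mu> - \<nu>)))"
      using c(1) znorm_le_sdist[of \<mu> \<nu>] by (intro ennreal_leI mult_left_mono) auto
    finally show ?thesis .
  qed
  with c(1) show ?thesis by (intro exI[of _ c] exI[of _ "ln 2 / 20"]) auto
qed

subsection \<open>Dynamical localization\<close>

lemma summable_on_nn_integral:
  fixes f :: "site \<Rightarrow> real"
  assumes "\<And>\<kappa>. 0 \<le> f \<kappa>" "(\<integral>\<^sup>+ \<kappa>. ennreal (f \<kappa>) \<partial>count_space UNIV) \<noteq> \<top>"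
  shows "f summable_on UNIV"
proof -
  have "integrable (count_space UNIV) f"
    by (rule integrableI_nonneg) (use assms in \<open>auto simp: less_top\<close>)
  then have "Infinite_Set_Sum.abs_summable_on f UNIV" by (simp add: abs_summable_on_def)
  then have "(\<lambda>\<kappa>. norm (f \<kappa>)) summable_on UNIV" by (simp only: abs_summable_equivalent)
  then show ?thesis using assms(1) by simp
qed

text \<open>Apply x \<le> exp x to k |mu| / (2 p) and raise to the power 2 p. The factor exp (k D)
  moves the centre from the origin to \<open>\<nu>\<close>; for p = 0 the weight is 1 and there is
  nothing to divide by.\<close>

lemma xweight_exp_bound:
  assumes p: "0 \<le> p" and k: "0 < k"
  obtains A where "0 \<le> A" "\<And>\<mu>. (xweight p \<mu>)\<^sup>2 \<le> A * exp (k * real (sdist \<mu> \<nu>))"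
proof (cases "p = 0")
  case True
  show ?thesis by (rule that[of 1]) (use True k in \<open>auto simp: xweight_def\<close>)
next
  case False
  then have q: "0 < 2 * p" using p by simp
  define D where "D = real (sdist \<nu> 0)"
  show ?thesis
  proof (rule that)
    show "0 \<le> (2 * p / k) powr (2 * p) * exp (k * D)" by simp
    fix \<mu> :: site
    have z0: "0 \<le> znorm \<mu>" by (simp add: znorm_def)
    have zs: "znorm \<mu> \<le> real (sdist \<mu> \<nu>) + D"
      using znorm_le_sdist[of \<mu> 0] sdist_triangle[of \<mu> 0 \<nu>] by (simp add: D_def)
    have "znorm \<mu> = (2 * p / k) * (k * znorm \<mu> / (2 * p))" using q k by simp
    also have "\<dots> \<le> (2 * p / k) * exp (k * znorm \<mu> / (2 * p))"
    proof (rule mult_left_mono)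
      show "k * znorm \<mu> / (2 * p) \<le> exp (k * znorm \<mu> / (2 * p))"
        using exp_ge_add_one_self[of "k * znorm \<mu> / (2 * p)"] by linarith
    qed (use q k in simp)
    finally have "znorm \<mu> powr (2 * p) \<le> ((2 * p / k) * exp (k * znorm \<mu> / (2 * p))) powr (2 * p)"
      using q z0 by (intro powr_mono2) auto
    also have "\<dots> = (2 * p / k) powr (2 * p) * exp (k * znorm \<mu>)"
    proof -
      have "(2 * p / k * exp (k * znorm \<mu> / (2 * p))) powr (2 * p)
          = (2 * p / k) powr (2 * p) * exp (k * znorm \<mu> / (2 * p)) powr (2 * p)"
        by (rule powr_mult)
      also have "exp (k * znorm \<mu> / (2 * p)) powr (2 * p) = exp (k * znorm \<mu>)"
        using q by (simp add: powr_def)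
      finally show ?thesis .
    qed
    also have "\<dots> \<le> (2 * p / k) powr (2 * p) * exp (k * (real (sdist \<mu> \<nu>) + D))"
      using zs k by (intro mult_left_mono) auto
    finally have "znorm \<mu> powr (2 * p) \<le> (2 * p / k) powr (2 * p) * exp (k * (real (sdist \<mu> \<nu>) + D))" .
    moreover have "(xweight p \<mu>)\<^sup>2 = znorm \<mu> powr (2 * p)"
      using False by (simp add: xweight_def power2_eq_square flip: powr_add)
    moreover have "exp (k * (real (sdist \<mu> \<nu>) + D)) = exp (k * D) * exp (k * real (sdist \<mu> \<nu>))"
      by (simp add: algebra_simps flip: exp_add)
    ultimately show "(xweight p \<mu>)\<^sup>2 \<le> (2 * p / k) powr (2 * p) * exp (k * D) * exp (k * real (sdist \<mu> \<nu>))"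
      by (simp add: mult.assoc)
  qed
qed

text \<open>Half of the exponential rate absorbs the squared weight, the other half makes the sum
  over sites converge. So the weighted sum has finite expectation and is almost surely finite;
  countability of the lattice puts all \<open>\<nu>\<close> on one event.\<close>

lemma AE_weighted_summable:
  assumes small: "sqrt \<bar>cos \<phi>\<bar> * sqrt \<bar>sin \<phi>\<bar> \<le> 1 / 56" and p: "0 \<le> p"
  shows "AE \<omega> in Pmeas. \<forall>\<nu>. (\<lambda>\<mu>. (xweight p \<mu>)\<^sup>2 * rcorr \<phi> \<omega> \<mu> \<nu>) summable_on UNIV"
  unfolding AE_all_countable
proof
  fix \<nu> :: site
  define g where "g = ln 2 / (20::real)"
  have g: "0 < g / 2" by (simp add: g_def)
  obtain c where c: "0 < c"
    "\<And>\<mu> \<nu>. (\<integral>\<^sup>+ \<omega>. corr \<phi> \<mu> \<nu> \<omega> \<partial>Pmeas) \<le> ennreal (c * exp (- g * real (sdist \<mu> \<nu>)))"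
    using corr_decay[OF small] unfolding g_def by blast
  obtain A where A: "0 \<le> A" "\<And>\<mu>. (xweight p \<mu>)\<^sup>2 \<le> A * exp (g / 2 * real (sdist \<mu> \<nu>))"
    by (rule xweight_exp_bound[OF p g, where \<nu> = \<nu>]) (rule that)
  obtain S where S: "0 < S" "\<And>\<mu>. (\<integral>\<^sup>+ \<kappa>. ennreal (exp (- (g / 2) * real (sdist \<mu> \<kappa>))) \<partial>count_space UNIV) \<le> ennreal S"
    by (rule nn_sum_exp_sdist[OF g]) (rule that)
  let ?F = "\<lambda>\<mu> \<omega>. ennreal ((xweight p \<mu>)\<^sup>2) * corr \<phi> \<mu> \<nu> \<omega>"
  interpret c: sigma_finite_measure "count_space (UNIV :: site set)"
    by (rule sigma_finite_measure_count_space_countable) auto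
  interpret pair_sigma_finite "count_space (UNIV :: site set)" Pmeas ..
  have m: "(\<lambda>(\<mu>, \<omega>). ?F \<mu> \<omega>) \<in> borel_measurable (count_space UNIV \<Otimes>\<^sub>M Pmeas)"
    by (rule measurable_pair_measure_countable1) auto
  have "(\<integral>\<^sup>+ \<omega>. (\<integral>\<^sup>+ \<mu>. ?F \<mu> \<omega> \<partial>count_space UNIV) \<partial>Pmeas) = (\<integral>\<^sup>+ \<mu>. (\<integral>\<^sup>+ \<omega>. ?F \<mu> \<omega> \<partial>Pmeas) \<partial>count_space UNIV)"
    using Fubini[OF m] by simp
  also have "\<dots> \<le> (\<integral>\<^sup>+ \<mu>. ennreal (A * c) * ennreal (exp (- (g / 2) * real (sdist \<nu> \<mu>))) \<partial>count_space UNIV)"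
  proof (rule nn_integral_mono)
    fix \<mu> :: site
    have "(\<integral>\<^sup>+ \<omega>. ?F \<mu> \<omega> \<partial>Pmeas) = ennreal ((xweight p \<mu>)\<^sup>2) * (\<integral>\<^sup>+ \<omega>. corr \<phi> \<mu> \<nu> \<omega> \<partial>Pmeas)"
      by (rule nn_integral_cmult) measurable
    also have "\<dots> \<le> ennreal (A * exp (g / 2 * real (sdist \<mu> \<nu>))) * ennreal (c * exp (- g * real (sdist \<mu> \<nu>)))"
      by (intro mult_mono ennreal_leI A(2) c(2)) auto
    also have "\<dots> = ennreal (A * exp (g / 2 * real (sdist \<mu> \<nu>)) * (c * exp (- g * real (sdist \<mu> \<nu>))))"
      using A(1) c(1) by (simp add: ennreal_mult)
    also have "A * exp (g / 2 * real (sdist \<mu> \<nu>)) * (c * exp (- g * real (sdist \<mu> \<nu>)))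
        = A * c * exp (- (g / 2) * real (sdist \<nu> \<mu>))"
      by (simp add: sdist_commute[of \<nu> \<mu>] mult_ac flip: exp_add)
    finally show "(\<integral>\<^sup>+ \<omega>. ?F \<mu> \<omega> \<partial>Pmeas) \<le> ennreal (A * c) * ennreal (exp (- (g / 2) * real (sdist \<nu> \<mu>)))"
      using A(1) c(1) by (simp add: ennreal_mult)
  qed
  also have "\<dots> = ennreal (A * c) * (\<integral>\<^sup>+ \<mu>. ennreal (exp (- (g / 2) * real (sdist \<nu> \<mu>))) \<partial>count_space UNIV)"
    by (rule nn_integral_cmult) simp
  also have "\<dots> \<le> ennreal (A * c) * ennreal S" by (intro mult_left_mono S(2)) auto
  finally have le: "(\<integral>\<^sup>+ \<omega>. (\<integral>\<^sup>+ \<mu>. ?F \<mu> \<omega> \<partial>count_space UNIV) \<partial>Pmeas) \<le> ennreal (A * c) * ennreal S" .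
  have "(\<integral>\<^sup>+ \<omega>. (\<integral>\<^sup>+ \<mu>. ?F \<mu> \<omega> \<partial>count_space UNIV) \<partial>Pmeas) \<noteq> \<infinity>"
    using neq_top_trans[OF _ le] by (simp add: ennreal_mult_eq_top_iff)
  moreover have "(\<lambda>\<omega>. \<integral>\<^sup>+ \<mu>. ?F \<mu> \<omega> \<partial>count_space UNIV) \<in> borel_measurable Pmeas"
  proof -
    have "(\<lambda>(\<omega>, \<mu>). ?F \<mu> \<omega>) \<in> borel_measurable (Pmeas \<Otimes>\<^sub>M count_space UNIV)"
      using measurable_pair_swap[OF m] by (simp add: case_prod_unfold)
    then show ?thesis by (rule c.borel_measurable_nn_integral)
  qed
  ultimately have "AE \<omega> in Pmeas. (\<integral>\<^sup>+ \<mu>. ?F \<mu> \<omega> \<partial>count_space UNIV) \<noteq> \<infinity>"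
    by (intro nn_integral_PInf_AE)
  with AE_good[OF small]
  show "AE \<omega> in Pmeas. (\<lambda>\<mu>. (xweight p \<mu>)\<^sup>2 * rcorr \<phi> \<omega> \<mu> \<nu>) summable_on UNIV"
  proof eventually_elim
    case (elim \<omega>)
    have "?F \<mu> \<omega> = ennreal ((xweight p \<mu>)\<^sup>2 * rcorr \<phi> \<omega> \<mu> \<nu>)" for \<mu>
      by (subst corr_rcorr[OF elim(1)]) (simp add: ennreal_mult)
    with elim(2) show ?case by (intro summable_on_nn_integral) auto
  qed
qed

lemma CCpow_entry_le_1:
  assumes unit: "\<And>\<kappa>. cmod (\<omega> \<kappa>) = 1"
  shows "cmod (CCpow \<omega> \<phi> n (ebasis \<nu>) \<mu>) \<le> 1"
proof -
  have V: "cmod ((CCop \<omega> \<phi> ^^ n) (ebasis \<nu>) \<mu>) \<le> 1" for n \<mu> \<nu>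
  proof -
    have "ell2 ((CCop \<omega> \<phi> ^^ n) (ebasis \<nu>)) \<and> l2norm ((CCop \<omega> \<phi> ^^ n) (ebasis \<nu>)) \<le> 1"
    proof (induction n)
      case (Suc n)
      then show ?case
        using CCop_bounded[of "(CCop \<omega> \<phi> ^^ n) (ebasis \<nu>)" \<omega> 1 \<phi>] unit by auto
    qed simp
    then show ?thesis using cmod_le_l2norm order_trans by blast
  qed
  then show ?thesis unfolding CCpow_def by (auto simp: CCadj_pow_entry[OF unit])
qed

lemma CCadj_zero: "CCadj \<omega> \<phi> (\<lambda>_. 0) = (\<lambda>_. 0)"
  by (simp add: CCadj_def Sadj_def)

lemma CCadj_sum: "CCadj \<omega> \<phi> (\<lambda>\<mu>. \<Sum>i\<in>I. f i \<mu>) = (\<lambda>\<mu>. \<Sum>i\<in>I. CCadj \<omega> \<phi> (f i) \<mu>)"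
  by (induction I rule: infinite_finite_induct) (simp_all add: CCadj_zero CCadj_add)

lemma CCpow_lincomb:
  "CCpow \<omega> \<phi> n (\<lambda>\<mu>. \<Sum>i\<in>I. a i * f i \<mu>) = (\<lambda>\<mu>. \<Sum>i\<in>I. a i * CCpow \<omega> \<phi> n (f i) \<mu>)"
proof -
  have "(CCop \<omega> \<phi> ^^ m) (\<lambda>\<mu>. \<Sum>i\<in>I. a i * f i \<mu>) = (\<lambda>\<mu>. \<Sum>i\<in>I. a i * (CCop \<omega> \<phi> ^^ m) (f i) \<mu>)" for m
    by (induction m) (simp_all add: CCop_sum CCop_scale)
  moreover have "(CCadj \<omega> \<phi> ^^ m) (\<lambda>\<mu>. \<Sum>i\<in>I. a i * f i \<mu>) = (\<lambda>\<mu>. \<Sum>i\<in>I. a i * (CCadj \<omega> \<phi> ^^ m) (f i) \<mu>)" for m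
    by (induction m) (simp_all add: CCadj_sum CCadj_scale)
  ultimately show ?thesis by (simp add: CCpow_def)
qed

lemma finite_support_expand:
  assumes "finite {\<mu>. \<psi> \<mu> \<noteq> (0::complex)}"
  shows "\<psi> = (\<lambda>\<mu>. \<Sum>\<nu>\<in>{\<nu>. \<psi> \<nu> \<noteq> 0}. \<psi> \<nu> * ebasis \<nu> \<mu>)"
proof
  fix \<mu>
  show "\<psi> \<mu> = (\<Sum>\<nu>\<in>{\<nu>. \<psi> \<nu> \<noteq> 0}. \<psi> \<nu> * ebasis \<nu> \<mu>)"
    using assms by (simp add: ebasis_def if_distrib[of "(*) _"] sum.delta cong: if_cong)
qed

text \<open>Of the two factors of the square one is bounded trivially by the l1 norm of
  \<open>\<psi>\<close>, the other by the correlator. The majorant is therefore linear in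
  \<open>rcorr\<close>, and first moments of the correlator suffice.\<close>

lemma orbit_domination:
  assumes good: "good \<phi> \<omega>" and fin: "finite {\<mu>. \<psi> \<mu> \<noteq> 0}"
  shows "(cmod (CCpow \<omega> \<phi> n \<psi> \<mu>))\<^sup>2
    \<le> (\<Sum>\<nu>\<in>{\<nu>. \<psi> \<nu> \<noteq> 0}. cmod (\<psi> \<nu>)) * (\<Sum>\<nu>\<in>{\<nu>. \<psi> \<nu> \<noteq> 0}. cmod (\<psi> \<nu>) * rcorr \<phi> \<omega> \<mu> \<nu>)"
proof -
  let ?T = "{\<nu>. \<psi> \<nu> \<noteq> 0}"
  let ?v = "\<lambda>\<nu>. CCpow \<omega> \<phi> n (ebasis \<nu>) \<mu>"
  have unit: "\<And>\<kappa>. cmod (\<omega> \<kappa>) = 1" using good unfolding good_def by blast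
  have e: "CCpow \<omega> \<phi> n \<psi> \<mu> = (\<Sum>\<nu>\<in>?T. \<psi> \<nu> * ?v \<nu>)"
    by (subst finite_support_expand[OF fin]) (simp only: CCpow_lincomb)
  have le: "cmod (CCpow \<omega> \<phi> n \<psi> \<mu>) \<le> (\<Sum>\<nu>\<in>?T. cmod (\<psi> \<nu>) * cmod (?v \<nu>))"
    unfolding e by (rule order_trans[OF norm_sum]) (simp add: norm_mult)
  also have "\<dots> \<le> (\<Sum>\<nu>\<in>?T. cmod (\<psi> \<nu>) * 1)"
    by (intro sum_mono mult_left_mono CCpow_entry_le_1 unit) auto
  finally have 1: "cmod (CCpow \<omega> \<phi> n \<psi> \<mu>) \<le> (\<Sum>\<nu>\<in>?T. cmod (\<psi> \<nu>))" by simp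
  have "(\<Sum>\<nu>\<in>?T. cmod (\<psi> \<nu>) * cmod (?v \<nu>)) \<le> (\<Sum>\<nu>\<in>?T. cmod (\<psi> \<nu>) * rcorr \<phi> \<omega> \<mu> \<nu>)"
    by (intro sum_mono mult_left_mono entry_bound good) auto
  with le have 2: "cmod (CCpow \<omega> \<phi> n \<psi> \<mu>) \<le> (\<Sum>\<nu>\<in>?T. cmod (\<psi> \<nu>) * rcorr \<phi> \<omega> \<mu> \<nu>)" by linarith
  show ?thesis unfolding power2_eq_square by (intro mult_mono 1 2) (auto intro: sum_nonneg)
qed

lemma summable_on_finite_sum:
  fixes f :: "'i \<Rightarrow> 'a \<Rightarrow> real"
  shows "(\<And>i. i \<in> I \<Longrightarrow> f i summable_on A) \<Longrightarrow> (\<lambda>x. \<Sum>i\<in>I. f i x) summable_on A"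
  by (induction I rule: infinite_finite_induct) (auto intro: summable_on_add)

lemma dynamical_localization:
  assumes small: "sqrt \<bar>cos \<phi>\<bar> * sqrt \<bar>sin \<phi>\<bar> \<le> 1 / 56" and p: "0 \<le> p" and fin: "finite {\<mu>. \<psi> \<mu> \<noteq> 0}"
  shows "AE \<omega> in Pmeas. \<exists>C::real. \<forall>n::int.
      (\<lambda>\<mu>. (xweight p \<mu> * cmod (CCpow \<omega> \<phi> n \<psi> \<mu>))^2) summable_on UNIV \<and>
      l2norm (\<lambda>\<mu>. complex_of_real (xweight p \<mu>) * CCpow \<omega> \<phi> n \<psi> \<mu>) \<le> C"
  using AE_good[OF small] AE_weighted_summable[OF small p]
proof eventually_elim
  case (elim \<omega>)
  let ?T = "{\<nu>. \<psi> \<nu> \<noteq> 0}"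
  define K where "K = (\<Sum>\<nu>\<in>?T. cmod (\<psi> \<nu>))"
  \<comment> \<open>A summable majorant that does not depend on n: the square root of its sum is the
    constant.\<close>
  define W where "W \<mu> = (\<Sum>\<nu>\<in>?T. K * cmod (\<psi> \<nu>) * ((xweight p \<mu>)\<^sup>2 * rcorr \<phi> \<omega> \<mu> \<nu>))" for \<mu>
  have W: "W summable_on UNIV" unfolding W_def
    by (intro summable_on_finite_sum summable_on_cmult_right spec[OF elim(2)])
  have W0: "0 \<le> W \<mu>" for \<mu> unfolding W_def K_def by (intro sum_nonneg mult_nonneg_nonneg) auto
  have le: "(xweight p \<mu> * cmod (CCpow \<omega> \<phi> n \<psi> \<mu>))\<^sup>2 \<le> W \<mu>" for \<mu> n
  proof -
    have "(xweight p \<mu>)\<^sup>2 * (cmod (CCpow \<omega> \<phi> n \<psi> \<mu>))\<^sup>2 \<le> (xweight p \<mu>)\<^sup>2 * (K * (\<Sum>\<nu>\<in>?T. cmod (\<psi> \<nu>) * rcorr \<phi> \<omega> \<mu> \<nu>))"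
      unfolding K_def by (intro mult_left_mono orbit_domination elim fin) auto
    also have "\<dots> = W \<mu>" by (simp add: W_def sum_distrib_left mult_ac)
    finally show ?thesis by (simp add: power_mult_distrib)
  qed
  have bd: "(\<Sum>\<mu>\<in>B. (cmod (complex_of_real (xweight p \<mu>) * CCpow \<omega> \<phi> n \<psi> \<mu>))\<^sup>2) \<le> infsum W UNIV" if "finite B" for B n
  proof -
    have "(\<Sum>\<mu>\<in>B. (cmod (complex_of_real (xweight p \<mu>) * CCpow \<omega> \<phi> n \<psi> \<mu>))\<^sup>2) \<le> (\<Sum>\<mu>\<in>B. W \<mu>)"
      using le by (intro sum_mono) (simp add: norm_mult power_mult_distrib)
    also have "\<dots> \<le> infsum W UNIV" using W0 by (intro finite_sum_le_infsum W that) auto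
    finally show ?thesis .
  qed
  show ?case
  proof (intro exI[of _ "sqrt (infsum W UNIV)"] allI conjI)
    fix n
    show "(\<lambda>\<mu>. (xweight p \<mu> * cmod (CCpow \<omega> \<phi> n \<psi> \<mu>))^2) summable_on UNIV"
      using ell2I(1)[OF bd, of n] by (simp add: ell2_def norm_mult power_mult_distrib)
    show "l2norm (\<lambda>\<mu>. complex_of_real (xweight p \<mu>) * CCpow \<omega> \<phi> n \<psi> \<mu>) \<le> sqrt (infsum W UNIV)"
      by (rule real_le_rsqrt) (rule ell2I(2)[OF bd])
  qed
qed

subsection \<open>Von Neumann's inequality for analytic polynomials\<close>

lemma circ_integrable_monomial [simp]: "integrable circ_measure (\<lambda>w. w ^ n * cnj w ^ m)"
  by (rule circ.integrable_const_bound[of _ 1])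
     (use AE_circ in \<open>auto elim!: eventually_mono simp: norm_mult norm_power\<close>)

lemma circ_Parseval:
  "integrable circ_measure (\<lambda>w. (cmod (\<Sum>j<n. b j * w ^ j))\<^sup>2)"
  "(\<integral>w. (cmod (\<Sum>j<n. b j * w ^ j))\<^sup>2 \<partial>circ_measure) = (\<Sum>j<n. (cmod (b j))\<^sup>2)"
proof -
  let ?B = "\<lambda>w. \<Sum>j<n. b j * w ^ j"
  have e: "complex_of_real ((cmod (?B w))\<^sup>2) = (\<Sum>i<n. \<Sum>j<n. (b i * cnj (b j)) * (w ^ i * cnj w ^ j))" for w
    unfolding complex_norm_square by (simp add: sum_product mult_ac)
  have int: "integrable circ_measure (\<lambda>w. complex_of_real ((cmod (?B w))\<^sup>2))"
    unfolding e by (intro Bochner_Integration.integrable_sum integrable_mult_right circ_integrable_monomial)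
  from integrable_Re[OF this] show int': "integrable circ_measure (\<lambda>w. (cmod (?B w))\<^sup>2)" by simp
  have "complex_of_real (\<integral>w. (cmod (?B w))\<^sup>2 \<partial>circ_measure) = (\<integral>w. complex_of_real ((cmod (?B w))\<^sup>2) \<partial>circ_measure)"
    by (rule integral_complex_of_real[symmetric])
  also have "\<dots> = (\<Sum>i<n. \<Sum>j<n. (b i * cnj (b j)) * (\<integral>w. w ^ i * cnj w ^ j \<partial>circ_measure))"
    unfolding e
    by (subst Bochner_Integration.integral_sum, intro Bochner_Integration.integrable_sum integrable_mult_right circ_integrable_monomial,
        rule sum.cong[OF refl], subst Bochner_Integration.integral_sum, intro integrable_mult_right circ_integrable_monomial,
        rule sum.cong[OF refl], rule integral_mult_right_zero)
  also have "\<dots> = (\<Sum>i<n. b i * cnj (b i))"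
    unfolding circ_moment_cnj by (intro sum.cong refl) (simp add: if_distrib[of "(*) _"] cong: if_cong)
  also have "\<dots> = complex_of_real (\<Sum>j<n. (cmod (b j))\<^sup>2)" by (simp only: of_real_sum complex_norm_square)
  finally show "(\<integral>w. (cmod (?B w))\<^sup>2 \<partial>circ_measure) = (\<Sum>j<n. (cmod (b j))\<^sup>2)" unfolding of_real_eq_iff .
qed

text \<open>The sums over k are Fourier coefficients c m of p (cnj w) B (w), where p and B have
  coefficients \<open>a\<close> and \<open>b\<close>. Pairing this product with the polynomial T of
  coefficients c m gives the sum of the |c m|^2, to be compared with the square means of T and
  B.\<close>

lemma correlation_bound:
  fixes a b :: "nat \<Rightarrow> complex"
  assumes e: "0 \<le> e" and le: "\<And>x. x \<in> circle \<Longrightarrow> cmod (\<Sum>k<N. a k * x ^ k) \<le> e"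
  shows "(\<Sum>m<M. (cmod (\<Sum>k<N. a k * b (m + k)))\<^sup>2) \<le> e\<^sup>2 * (\<Sum>j<M+N. (cmod (b j))\<^sup>2)"
proof -
  define c where "c m = (\<Sum>k<N. a k * b (m + k))" for m
  let ?T = "\<lambda>w. \<Sum>m<M. c m * w ^ m" and ?B = "\<lambda>w. \<Sum>j<M+N. b j * w ^ j"
  let ?F = "\<lambda>w. cnj (?T w) * ((\<Sum>k<N. a k * cnj w ^ k) * ?B w)"
  have ex: "?F w = (\<Sum>m<M. \<Sum>k<N. \<Sum>j<M+N. (cnj (c m) * a k * b j) * (w ^ j * cnj w ^ (m + k)))" for w
  proof -
    have "?F w = (\<Sum>m<M. cnj (c m) * cnj w ^ m) * (\<Sum>k<N. \<Sum>j<M+N. (a k * cnj w ^ k) * (b j * w ^ j))"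
      by (simp only: cnj_sum complex_cnj_mult complex_cnj_power sum_product[of "\<lambda>k. a k * cnj w ^ k"])
    also have "\<dots> = (\<Sum>m<M. \<Sum>k<N. \<Sum>j<M+N. (cnj (c m) * cnj w ^ m) * ((a k * cnj w ^ k) * (b j * w ^ j)))"
      unfolding sum_product[of "\<lambda>m. cnj (c m) * cnj w ^ m"] by (simp only: sum_distrib_left)
    also have "\<dots> = (\<Sum>m<M. \<Sum>k<N. \<Sum>j<M+N. (cnj (c m) * a k * b j) * (w ^ j * cnj w ^ (m + k)))"
      by (intro sum.cong refl) (simp add: power_add mult_ac)
    finally show ?thesis .
  qed
  have int: "integrable circ_measure ?F"
    unfolding ex by (intro Bochner_Integration.integrable_sum integrable_mult_right circ_integrable_monomial)
  have "(\<integral>w. ?F w \<partial>circ_measure)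
      = (\<Sum>m<M. \<Sum>k<N. \<Sum>j<M+N. (cnj (c m) * a k * b j) * (\<integral>w. w ^ j * cnj w ^ (m + k) \<partial>circ_measure))"
    unfolding ex
    by (subst Bochner_Integration.integral_sum, intro Bochner_Integration.integrable_sum integrable_mult_right circ_integrable_monomial,
        rule sum.cong[OF refl], subst Bochner_Integration.integral_sum, intro Bochner_Integration.integrable_sum integrable_mult_right circ_integrable_monomial,
        rule sum.cong[OF refl], subst Bochner_Integration.integral_sum, intro integrable_mult_right circ_integrable_monomial,
        rule sum.cong[OF refl], rule integral_mult_right_zero)
  also have "\<dots> = (\<Sum>m<M. \<Sum>k<N. cnj (c m) * a k * b (m + k))"
    unfolding circ_moment_cnj
    by (intro sum.cong refl) (simp add: if_distrib[of "(*) _"] cong: if_cong)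
  also have "\<dots> = (\<Sum>m<M. c m * cnj (c m))"
  proof (intro sum.cong refl)
    fix m
    have "(\<Sum>k<N. cnj (c m) * a k * b (m + k)) = cnj (c m) * (\<Sum>k<N. a k * b (m + k))"
      by (simp only: mult.assoc sum_distrib_left)
    also have "\<dots> = c m * cnj (c m)" unfolding c_def[of m, symmetric] by (rule mult.commute)
    finally show "(\<Sum>k<N. cnj (c m) * a k * b (m + k)) = c m * cnj (c m)" .
  qed
  also have "\<dots> = complex_of_real (\<Sum>m<M. (cmod (c m))\<^sup>2)" by (simp only: of_real_sum complex_norm_square)
  finally have I: "(\<integral>w. ?F w \<partial>circ_measure) = complex_of_real (\<Sum>m<M. (cmod (c m))\<^sup>2)" .
  have "(\<Sum>m<M. (cmod (c m))\<^sup>2) = cmod (\<integral>w. ?F w \<partial>circ_measure)"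
    unfolding I norm_of_real by (simp add: sum_nonneg)
  also have "\<dots> \<le> (\<integral>w. cmod (?F w) \<partial>circ_measure)" by (rule integral_norm_bound)
  \<comment> \<open>By Parseval the T-term is half of the left-hand side, so it can be absorbed
    there.\<close>
  also have "\<dots> \<le> (\<integral>w. (1 / 2) * (cmod (?T w))\<^sup>2 + (e\<^sup>2 / 2) * (cmod (?B w))\<^sup>2 \<partial>circ_measure)"
  proof (rule integral_mono_AE)
    show "integrable circ_measure (\<lambda>w. cmod (?F w))" by (rule integrable_norm[OF int])
    show "integrable circ_measure (\<lambda>w. (1 / 2) * (cmod (?T w))\<^sup>2 + (e\<^sup>2 / 2) * (cmod (?B w))\<^sup>2)"
      by (intro Bochner_Integration.integrable_add integrable_mult_right circ_Parseval)
    show "AE w in circ_measure. cmod (?F w) \<le> (1 / 2) * (cmod (?T w))\<^sup>2 + (e\<^sup>2 / 2) * (cmod (?B w))\<^sup>2"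
      using AE_circ
    proof (rule eventually_mono)
      fix w :: complex assume "cmod w = 1"
      then have "cmod (\<Sum>k<N. a k * cnj w ^ k) \<le> e" by (intro le) (simp add: circle_def)
      then have "cmod (?F w) \<le> cmod (?T w) * (e * cmod (?B w))"
        unfolding norm_mult complex_mod_cnj by (intro mult_left_mono mult_right_mono) auto
      moreover have "0 \<le> (cmod (?T w) - e * cmod (?B w))\<^sup>2" by simp
      ultimately show "cmod (?F w) \<le> (1 / 2) * (cmod (?T w))\<^sup>2 + (e\<^sup>2 / 2) * (cmod (?B w))\<^sup>2"
        by (simp add: power2_diff power_mult_distrib)
    qed
  qed
  also have "\<dots> = (1 / 2) * (\<Sum>m<M. (cmod (c m))\<^sup>2) + (e\<^sup>2 / 2) * (\<Sum>j<M+N. (cmod (b j))\<^sup>2)"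
    by (subst Bochner_Integration.integral_add)
       (auto simp only: circ_Parseval integral_mult_right_zero intro!: integrable_mult_right circ_Parseval)
  finally show ?thesis unfolding c_def by simp
qed

lemma has_sum_finite_sum:
  fixes f :: "'i \<Rightarrow> 'a \<Rightarrow> real"
  shows "(\<And>i. i \<in> I \<Longrightarrow> (f i has_sum s i) A) \<Longrightarrow> ((\<lambda>x. \<Sum>i\<in>I. f i x) has_sum (\<Sum>i\<in>I. s i)) A"
  by (induction I rule: infinite_finite_induct) (auto intro: has_sum_add)

lemma ell2_has_sum: "ell2 f \<Longrightarrow> ((\<lambda>\<mu>. (cmod (f \<mu>))\<^sup>2) has_sum (l2norm f)\<^sup>2) UNIV"
  unfolding l2norm_power2 ell2_def by (rule has_sum_infsum)

subsection \<open>Weak convergence and tails\<close>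

lemma summable_tail:
  fixes k :: "'a \<Rightarrow> real"
  assumes "k summable_on UNIV" "\<And>x. 0 \<le> k x" "0 < e"
  obtains B where "finite B" "\<And>B'. finite B' \<Longrightarrow> B' \<inter> B = {} \<Longrightarrow> sum k B' \<le> e"
proof -
  obtain B where B: "finite B" "dist (sum k B) (infsum k UNIV) \<le> e"
    using infsum_finite_approximation[OF assms(1,3)] by blast
  show ?thesis
  proof (rule that[OF B(1)])
    fix B' assume B': "finite B'" "B' \<inter> B = {}"
    have "sum k B' + sum k B = sum k (B' \<union> B)" using B' B(1) by (simp add: sum.union_disjoint)
    also have "\<dots> \<le> infsum k UNIV" using B' B(1) assms by (intro finite_sum_le_infsum) auto
    finally show "sum k B' \<le> e" using B(2) by (simp add: dist_real_def)
  qed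
qed

definition off :: "site set \<Rightarrow> vec \<Rightarrow> vec" where
  "off B f = (\<lambda>\<mu>. if \<mu> \<in> B then 0 else f \<mu>)"

lemma off_le:
  assumes "ell2 f" shows "ell2 (off B f)" "l2norm (off B f) \<le> l2norm f"
proof -
  have *: "(\<Sum>\<mu>\<in>B'. (cmod (off B f \<mu>))\<^sup>2) \<le> (l2norm f)\<^sup>2" if "finite B'" for B'
  proof -
    have "(\<Sum>\<mu>\<in>B'. (cmod (off B f \<mu>))\<^sup>2) \<le> (\<Sum>\<mu>\<in>B'. (cmod (f \<mu>))\<^sup>2)"
      by (rule sum_mono) (simp add: off_def)
    also have "\<dots> \<le> (l2norm f)\<^sup>2" by (rule sum_le_l2norm[OF assms that])
    finally show ?thesis .
  qed
  show "ell2 (off B f)" by (rule ell2I(1)[OF *])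
  show "l2norm (off B f) \<le> l2norm f" by (rule power2_le_imp_le[OF ell2I(2)[OF *]]) simp_all
qed

lemma off_add: "off B (\<lambda>\<mu>. f \<mu> + g \<mu>) = (\<lambda>\<mu>. off B f \<mu> + off B g \<mu>)"
  by (auto simp: off_def)

lemma l2norm_split:
  assumes "ell2 f" "finite B"
  shows "(l2norm f)\<^sup>2 \<le> (\<Sum>\<mu>\<in>B. (cmod (f \<mu>))\<^sup>2) + (l2norm (off B f))\<^sup>2"
proof (rule ell2I(2))
  fix B' :: "site set" assume B': "finite B'"
  have "(\<Sum>\<mu>\<in>B'. (cmod (f \<mu>))\<^sup>2) = (\<Sum>\<mu>\<in>B' \<inter> B. (cmod (f \<mu>))\<^sup>2) + (\<Sum>\<mu>\<in>B' - B. (cmod (f \<mu>))\<^sup>2)"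
    by (rule sum.Int_Diff[OF B'])
  also have "(\<Sum>\<mu>\<in>B' \<inter> B. (cmod (f \<mu>))\<^sup>2) \<le> (\<Sum>\<mu>\<in>B. (cmod (f \<mu>))\<^sup>2)"
    using assms(2) by (intro sum_mono2) auto
  also have "(\<Sum>\<mu>\<in>B' - B. (cmod (f \<mu>))\<^sup>2) = (\<Sum>\<mu>\<in>B' - B. (cmod (off B f \<mu>))\<^sup>2)"
    by (rule sum.cong) (auto simp: off_def)
  also have "\<dots> \<le> (l2norm (off B f))\<^sup>2"
    using B' by (intro sum_le_l2norm off_le assms) auto
  finally show "(\<Sum>\<mu>\<in>B'. (cmod (f \<mu>))\<^sup>2) \<le> (\<Sum>\<mu>\<in>B. (cmod (f \<mu>))\<^sup>2) + (l2norm (off B f))\<^sup>2" by simp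
qed

lemma off_dominated:
  assumes le: "\<And>\<mu>. (cmod (f \<mu>))\<^sup>2 \<le> k \<mu>" and tail: "\<And>B'. finite B' \<Longrightarrow> B' \<inter> B = {} \<Longrightarrow> sum k B' \<le> e\<^sup>2" and e: "0 \<le> e"
  shows "l2norm (off B f) \<le> e"
proof (rule power2_le_imp_le[OF ell2I(2) e])
  fix B' :: "site set" assume B': "finite B'"
  have "(\<Sum>\<mu>\<in>B'. (cmod (off B f \<mu>))\<^sup>2) = (\<Sum>\<mu>\<in>B' - B. (cmod (f \<mu>))\<^sup>2)"
    by (rule sum.mono_neutral_cong_right) (use B' in \<open>auto simp: off_def\<close>)
  also have "\<dots> \<le> sum k (B' - B)" by (rule sum_mono) (rule le)
  also have "\<dots> \<le> e\<^sup>2" using B' by (intro tail) auto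
  finally show "(\<Sum>\<mu>\<in>B'. (cmod (off B f \<mu>))\<^sup>2) \<le> e\<^sup>2" .
qed

lemma small_tail:
  assumes f: "ell2 f" and e: "0 < e"
  obtains B where "finite B" "l2norm (off B f) \<le> e"
proof -
  have s: "(\<lambda>\<mu>. (cmod (f \<mu>))\<^sup>2) summable_on UNIV" and e2: "0 < e\<^sup>2" using f e by (auto simp: ell2_def)
  obtain B where B: "finite B" "\<And>B'. finite B' \<Longrightarrow> B' \<inter> B = {} \<Longrightarrow> (\<Sum>\<mu>\<in>B'. (cmod (f \<mu>))\<^sup>2) \<le> e\<^sup>2"
    by (rule summable_tail[OF s _ e2]) (simp, rule that)
  have "l2norm (off B f) \<le> e"
    by (rule off_dominated[of f "\<lambda>\<mu>. (cmod (f \<mu>))\<^sup>2"]) (use B(2) e in auto)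
  with B(1) show ?thesis by (rule that)
qed

text \<open>Bounded norms and coordinatewise convergence give weak convergence: split
  \<open>f\<close> into finitely many coordinates and a tail of small norm, the latter being paired
  with vectors of norm at most \<open>C\<close>.\<close>

lemma weak_limit:
  assumes u: "\<And>j. ell2 (u j)" "\<And>j. l2norm (u j) \<le> C" and lim: "\<And>\<mu>. (\<lambda>j. u j \<mu>) \<longlonglongrightarrow> v \<mu>"
  shows "ell2 v" "l2norm v \<le> C" "ell2 f \<Longrightarrow> (\<lambda>j. ip (u j) f) \<longlonglongrightarrow> ip v f"
proof -
  have *: "L2_set (\<lambda>\<mu>. cmod (v \<mu>)) B \<le> C" if B: "finite B" for B
  proof (rule LIMSEQ_le_const2)
    show "(\<lambda>j. L2_set (\<lambda>\<mu>. cmod (u j \<mu>)) B) \<longlonglongrightarrow> L2_set (\<lambda>\<mu>. cmod (v \<mu>)) B"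
      unfolding L2_set_def by (intro tendsto_intros lim)
    show "\<exists>N. \<forall>n\<ge>N. L2_set (\<lambda>\<mu>. cmod (u n \<mu>)) B \<le> C"
      using order_trans[OF L2_set_le_l2norm[OF u(1) B] u(2)] by blast
  qed
  show v: "ell2 v" by (rule ell2_L2_setI(1)[OF *])
  show vC: "l2norm v \<le> C" by (rule ell2_L2_setI(2)[OF *])
  have C: "0 \<le> C" using vC l2norm_nonneg[of v] by linarith
  assume f: "ell2 f"
  show "(\<lambda>j. ip (u j) f) \<longlonglongrightarrow> ip v f"
  proof (rule LIMSEQ_I)
    fix e :: real assume e: "0 < e"
    define d where "d = e / (4 * (C + 1))"
    have d: "0 < d" using e C by (simp add: d_def)
    obtain B where B: "finite B" "l2norm (off B f) \<le> d" by (rule small_tail[OF f d])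
    have split: "ip g f = (\<Sum>\<mu>\<in>B. cnj (g \<mu>) * f \<mu>) + ip g (off B f)" if g: "ell2 g" for g
    proof -
      have ff: "f = (\<lambda>\<mu>. (\<Sum>\<nu>\<in>B. f \<nu> * ebasis \<nu> \<mu>) + off B f \<mu>)"
        using B(1) by (auto simp: off_def ebasis_def if_distrib[of "(*) _"] cong: if_cong)
      have eb: "ell2 (\<lambda>\<mu>. f \<nu> * ebasis \<nu> \<mu>)" for \<nu> by (rule ell2_scale[OF ell2_ebasis])
      have "ip g f = ip g (\<lambda>\<mu>. \<Sum>\<nu>\<in>B. f \<nu> * ebasis \<nu> \<mu>) + ip g (off B f)"
        by (subst ff, rule ip_add_right[OF g ell2_sum[OF eb] off_le(1)[OF f]])
      also have "ip g (\<lambda>\<mu>. \<Sum>\<nu>\<in>B. f \<nu> * ebasis \<nu> \<mu>) = (\<Sum>\<nu>\<in>B. ip g (\<lambda>\<mu>. f \<nu> * ebasis \<nu> \<mu>))"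
        by (rule ip_sum_right[OF g eb])
      also have "\<dots> = (\<Sum>\<mu>\<in>B. cnj (g \<mu>) * f \<mu>)" by (simp add: ip_scale_right ip_ebasis_right mult.commute)
      finally show ?thesis .
    qed
    have "(\<lambda>j. \<Sum>\<mu>\<in>B. cnj (u j \<mu>) * f \<mu>) \<longlonglongrightarrow> (\<Sum>\<mu>\<in>B. cnj (v \<mu>) * f \<mu>)"
      by (intro tendsto_intros lim)
    from LIMSEQ_D[OF this, of "e / 2"] e obtain N where
      N: "\<And>n. N \<le> n \<Longrightarrow> cmod ((\<Sum>\<mu>\<in>B. cnj (u n \<mu>) * f \<mu>) - (\<Sum>\<mu>\<in>B. cnj (v \<mu>) * f \<mu>)) < e / 2" by auto
    have tl: "cmod (ip g (off B f)) \<le> (C + 1) * d" if g: "ell2 g" "l2norm g \<le> C" for g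
    proof -
      have "cmod (ip g (off B f)) \<le> l2norm g * l2norm (off B f)" by (rule ip_Cauchy_Schwarz[OF g(1) off_le(1)[OF f]])
      also have "\<dots> \<le> (C + 1) * d" using g(2) B(2) C by (intro mult_mono) auto
      finally show ?thesis .
    qed
    have Cd: "(C + 1) * d = e / 4"
    proof -
      have "x * (e / (4 * x)) = e / 4" if "0 < x" for x :: real using that by simp
      moreover have "0 < C + 1" using C by simp
      ultimately show ?thesis unfolding d_def by blast
    qed
    have "cmod (ip (u n) f - ip v f) < e" if "N \<le> n" for n
    proof -
      have "ip (u n) f - ip v f = ((\<Sum>\<mu>\<in>B. cnj (u n \<mu>) * f \<mu>) - (\<Sum>\<mu>\<in>B. cnj (v \<mu>) * f \<mu>))
          + (ip (u n) (off B f) - ip v (off B f))"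
        unfolding split[OF u(1)] split[OF v] by simp
      then have "cmod (ip (u n) f - ip v f) \<le> cmod ((\<Sum>\<mu>\<in>B. cnj (u n \<mu>) * f \<mu>) - (\<Sum>\<mu>\<in>B. cnj (v \<mu>) * f \<mu>))
          + (cmod (ip (u n) (off B f)) + cmod (ip v (off B f)))"
        using norm_triangle_ineq norm_triangle_ineq4 by (metis (no_types) add_left_mono order_trans)
      then show ?thesis using N[OF that] tl[OF u(1)[of n] u(2)[of n]] tl[OF v vC] unfolding Cd by linarith
    qed
    then show "\<exists>N. \<forall>n\<ge>N. cmod (ip (u n) f - ip v f) < e" by blast
  qed
qed

subsection \<open>Pure point spectrum\<close>

lemma norm_ip_expand:
  assumes f: "ell2 f" and g: "ell2 g"
  shows "(l2norm (\<lambda>\<mu>. f \<mu> + a * g \<mu>))\<^sup>2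
    = (l2norm f)\<^sup>2 + 2 * Re (a * ip f g) + (cmod a)\<^sup>2 * (l2norm g)\<^sup>2"
proof -
  have ag: "ell2 (\<lambda>\<mu>. a * g \<mu>)" by (rule ell2_scale[OF g])
  have fg: "ell2 (\<lambda>\<mu>. f \<mu> + a * g \<mu>)" by (rule ell2_add[OF f ag])
  have "complex_of_real ((l2norm (\<lambda>\<mu>. f \<mu> + a * g \<mu>))\<^sup>2)
      = ip f f + a * ip f g + (cnj a * ip g f + cnj a * (a * ip g g))"
    unfolding ip_self[OF fg, symmetric] ip_add_left[OF fg f ag] ip_add_right[OF f f ag] ip_add_right[OF ag f ag]
      ip_scale_right ip_scale_left by simp
  also have "\<dots> = complex_of_real ((l2norm f)\<^sup>2) + (a * ip f g + cnj (a * ip f g))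
      + complex_of_real ((cmod a)\<^sup>2 * (l2norm g)\<^sup>2)"
    unfolding ip_self[OF f] ip_self[OF g] of_real_mult complex_norm_square[of a] complex_cnj_mult ip_cnj
    by (simp add: algebra_simps)
  also have "\<dots> = complex_of_real ((l2norm f)\<^sup>2 + 2 * Re (a * ip f g) + (cmod a)\<^sup>2 * (l2norm g)\<^sup>2)"
    unfolding complex_add_cnj by simp
  finally show ?thesis unfolding of_real_eq_iff .
qed

lemma parallelogram:
  assumes f: "ell2 f" and g: "ell2 g"
  shows "(l2norm (\<lambda>\<mu>. f \<mu> + g \<mu>))\<^sup>2 + (l2norm (\<lambda>\<mu>. f \<mu> - g \<mu>))\<^sup>2 = 2 * (l2norm f)\<^sup>2 + 2 * (l2norm g)\<^sup>2"
  using norm_ip_expand[OF f g, of 1] norm_ip_expand[OF f g, of "-1"] by simp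

context
  fixes \<omega> :: vec and \<phi> :: real
  assumes unit: "\<And>\<kappa>. cmod (\<omega> \<kappa>) = 1"
begin

abbreviation (input) "U \<equiv> CCop \<omega> \<phi>"
abbreviation (input) "V \<equiv> CCadj \<omega> \<phi>"

lemma ell2_U: "ell2 f \<Longrightarrow> ell2 (U f)"
  by (rule CCop_bounded(1)[where r = 1]) (simp_all add: unit)

lemma ell2_V: "ell2 f \<Longrightarrow> ell2 (V f)"
  unfolding CCadj_def by (intro ell2_Sadj ell2_mult_bounded(1)[where r = 1]) (simp_all add: unit)

lemma l2norm_U: assumes f: "ell2 f" shows "l2norm (U f) = l2norm f"
proof -
  have "complex_of_real ((l2norm (U f))\<^sup>2) = complex_of_real ((l2norm f)\<^sup>2)"
    unfolding ip_self[OF f, symmetric] ip_self[OF ell2_U[OF f], symmetric] by (rule ip_CCop_CCop[OF f f unit])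
  then have "(l2norm (U f))\<^sup>2 = (l2norm f)\<^sup>2" unfolding of_real_eq_iff .
  then show ?thesis by (rule power2_eq_imp_eq) simp_all
qed

lemma U_V: "U (V f) = f" by (rule CCop_CCadj[OF unit])

lemma l2norm_V: assumes f: "ell2 f" shows "l2norm (V f) = l2norm f"
  using l2norm_U[OF ell2_V[OF f]] by (simp add: U_V)

lemma Upow: assumes "ell2 f" shows "ell2 ((U ^^ n) f)" "l2norm ((U ^^ n) f) = l2norm f"
  using assms by (induction n) (simp_all add: ell2_U l2norm_U)

lemma Vpow: assumes "ell2 f" shows "ell2 ((V ^^ n) f)" "l2norm ((V ^^ n) f) = l2norm f"
  using assms by (induction n) (simp_all add: ell2_V l2norm_V)

lemma ip_V: assumes f: "ell2 f" and g: "ell2 g" shows "ip (V f) g = ip f (U g)"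
proof -
  have "ip (U g) f = ip g (V f)" by (rule ip_CCop[OF g f unit])
  from arg_cong[OF this, of cnj] show ?thesis by (simp add: ip_cnj)
qed

lemma ip_Vpow: assumes f: "ell2 f" and g: "ell2 g" shows "ip ((V ^^ n) f) g = ip f ((U ^^ n) g)"
  using g
proof (induction n arbitrary: g)
  case (Suc n)
  have "ip ((V ^^ Suc n) f) g = ip ((V ^^ n) f) (U g)" by (simp add: ip_V[OF Vpow(1)[OF f] Suc.prems])
  also have "\<dots> = ip f ((U ^^ n) (U g))" by (rule Suc.IH[OF ell2_U[OF Suc.prems]])
  finally show ?case by (simp add: funpow_swap1)
qed simp

lemma Upow_lincomb: "(U ^^ m) (\<lambda>\<mu>. \<Sum>i\<in>I. a i * f i \<mu>) = (\<lambda>\<mu>. \<Sum>i\<in>I. a i * (U ^^ m) (f i) \<mu>)"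
  by (induction m) (simp_all add: CCop_sum CCop_scale)

lemma Upow_add: "(U ^^ m) (\<lambda>\<mu>. f \<mu> + g \<mu>) = (\<lambda>\<mu>. (U ^^ m) f \<mu> + (U ^^ m) g \<mu>)"
  by (induction m) (simp_all add: CCop_add)

text \<open>Plancherel for the scalar sequences \<open>n \<mapsto> (U\<^sup>n f) \<mu>\<close>, summed over \<open>\<mu>\<close>; the boundary terms
  disappear after averaging over long time intervals.\<close>

lemma von_Neumann:
  assumes f: "ell2 f" and e: "0 \<le> e" and le: "\<And>x. x \<in> circle \<Longrightarrow> cmod (\<Sum>k<N. a k * x ^ k) \<le> e"
  shows "ell2 (\<lambda>\<mu>. \<Sum>k<N. a k * (U ^^ k) f \<mu>)" "l2norm (\<lambda>\<mu>. \<Sum>k<N. a k * (U ^^ k) f \<mu>) \<le> e * l2norm f"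
proof -
  let ?g = "\<lambda>\<mu>. \<Sum>k<N. a k * (U ^^ k) f \<mu>"
  show g: "ell2 ?g" by (rule ell2_sum, rule ell2_scale, rule Upow(1)[OF f])
  have main: "real M * (l2norm ?g)\<^sup>2 \<le> e\<^sup>2 * (real (M + N) * (l2norm f)\<^sup>2)" for M
  proof -
    have hl: "((\<lambda>\<mu>. \<Sum>m<M. (cmod ((U ^^ m) ?g \<mu>))\<^sup>2) has_sum (\<Sum>m<M. (l2norm ((U ^^ m) ?g))\<^sup>2)) UNIV"
      by (rule has_sum_finite_sum, rule ell2_has_sum, rule Upow(1)[OF g])
    have "((\<lambda>\<mu>. \<Sum>j<M+N. (cmod ((U ^^ j) f \<mu>))\<^sup>2) has_sum (\<Sum>j<M+N. (l2norm ((U ^^ j) f))\<^sup>2)) UNIV"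
      by (rule has_sum_finite_sum, rule ell2_has_sum, rule Upow(1)[OF f])
    then have hr: "((\<lambda>\<mu>. e\<^sup>2 * (\<Sum>j<M+N. (cmod ((U ^^ j) f \<mu>))\<^sup>2)) has_sum e\<^sup>2 * (\<Sum>j<M+N. (l2norm ((U ^^ j) f))\<^sup>2)) UNIV"
      by (rule has_sum_cmult_right)
    have "(\<Sum>m<M. (l2norm ((U ^^ m) ?g))\<^sup>2) \<le> e\<^sup>2 * (\<Sum>j<M+N. (l2norm ((U ^^ j) f))\<^sup>2)"
    proof (rule has_sum_mono[OF hl hr])
      fix \<mu> :: site
      have "(U ^^ m) ?g \<mu> = (\<Sum>k<N. a k * (U ^^ (m + k)) f \<mu>)" for m
        by (simp add: Upow_lincomb funpow_add)
      then show "(\<Sum>m<M. (cmod ((U ^^ m) ?g \<mu>))\<^sup>2) \<le> e\<^sup>2 * (\<Sum>j<M+N. (cmod ((U ^^ j) f \<mu>))\<^sup>2)"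
        using correlation_bound[OF e le, where b = "\<lambda>j. (U ^^ j) f \<mu>" and M = M] by simp
    qed
    then show ?thesis by (simp only: Upow(2)[OF g] Upow(2)[OF f] sum_constant card_lessThan)
  qed
  have "(\<lambda>M. e\<^sup>2 * (l2norm f)\<^sup>2 * (1 + real N * inverse (real (Suc M)))) \<longlonglongrightarrow> e\<^sup>2 * (l2norm f)\<^sup>2 * (1 + real N * 0)"
    by (intro tendsto_intros LIMSEQ_inverse_real_of_nat)
  moreover have "(l2norm ?g)\<^sup>2 \<le> e\<^sup>2 * (l2norm f)\<^sup>2 * (1 + real N * inverse (real (Suc M)))" for M
  proof -
    have s: "0 < real (Suc M)" by simp
    have "(l2norm ?g)\<^sup>2 \<le> e\<^sup>2 * (real (Suc M + N) * (l2norm f)\<^sup>2) / real (Suc M)"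
      using main[of "Suc M"] s by (simp only: le_divide_eq mult.commute if_True)
    also have "\<dots> = e\<^sup>2 * (l2norm f)\<^sup>2 * (1 + real N * inverse (real (Suc M)))"
      using s by (simp add: field_simps)
    finally show ?thesis .
  qed
  ultimately have "(l2norm ?g)\<^sup>2 \<le> e\<^sup>2 * (l2norm f)\<^sup>2 * (1 + real N * 0)"
    by (intro LIMSEQ_le_const) auto
  then have "(l2norm ?g)\<^sup>2 \<le> (e * l2norm f)\<^sup>2" by (simp add: power_mult_distrib)
  then show "l2norm ?g \<le> e * l2norm f" by (rule power2_le_imp_le) (simp add: e)
qed

definition Av :: "nat \<Rightarrow> complex \<Rightarrow> vec \<Rightarrow> vec" where
  "Av N x f = (\<lambda>\<mu>. \<Sum>n<N. (cnj x ^ n / of_nat N) * (U ^^ n) f \<mu>)"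

lemma average_bound:
  assumes h: "\<And>n. ell2 (h n)" "\<And>n. l2norm (h n) \<le> C" and C: "0 \<le> C" and x: "cmod x \<le> 1"
  shows "ell2 (\<lambda>\<mu>. \<Sum>n<N. (x ^ n / of_nat N) * h n \<mu>)" "l2norm (\<lambda>\<mu>. \<Sum>n<N. (x ^ n / of_nat N) * h n \<mu>) \<le> C"
proof -
  show "ell2 (\<lambda>\<mu>. \<Sum>n<N. (x ^ n / of_nat N) * h n \<mu>)" by (rule ell2_sum, rule ell2_scale, rule h)
  have "l2norm (\<lambda>\<mu>. \<Sum>n<N. (x ^ n / of_nat N) * h n \<mu>) \<le> (\<Sum>n<N. l2norm (\<lambda>\<mu>. (x ^ n / of_nat N) * h n \<mu>))"
    by (rule l2norm_sum) (rule ell2_scale[OF h(1)])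
  also have "\<dots> \<le> (\<Sum>n<N. 1 / real N * C)"
  proof (rule sum_mono)
    fix n
    have "cmod (x ^ n / of_nat N) \<le> 1 / real N"
      using x by (simp add: norm_divide norm_power power_le_one divide_right_mono)
    then show "l2norm (\<lambda>\<mu>. (x ^ n / of_nat N) * h n \<mu>) \<le> 1 / real N * C"
      unfolding l2norm_scale by (intro mult_mono h) auto
  qed
  also have "\<dots> \<le> C" using C by simp
  finally show "l2norm (\<lambda>\<mu>. \<Sum>n<N. (x ^ n / of_nat N) * h n \<mu>) \<le> C" .
qed

lemma Av_bound:
  assumes f: "ell2 f" and x: "x \<in> circle"
  shows "ell2 (Av N x f)" "l2norm (Av N x f) \<le> l2norm f"
proof -
  have "cmod (cnj x) \<le> 1" using x by (simp add: circle_def)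
  note b = average_bound[OF Upow(1)[OF f] eq_refl[OF Upow(2)[OF f]] l2norm_nonneg this]
  show "ell2 (Av N x f)" unfolding Av_def by (rule b(1))
  show "l2norm (Av N x f) \<le> l2norm f" unfolding Av_def by (rule b(2))
qed

text \<open>The adjoint of \<open>Av N x\<close>. Applied to \<open>g = Av N x f\<close> it yields a
  vector whose inner product with \<open>f\<close> is the squared norm of the average.\<close>

definition Bv :: "nat \<Rightarrow> complex \<Rightarrow> vec \<Rightarrow> vec" where
  "Bv N x g = (\<lambda>\<mu>. \<Sum>n<N. (x ^ n / of_nat N) * (V ^^ n) g \<mu>)"

lemma Bv_bound:
  assumes g: "ell2 g" and x: "x \<in> circle"
  shows "ell2 (Bv N x g)" "l2norm (Bv N x g) \<le> l2norm g"
proof -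
  have "cmod x \<le> 1" using x by (simp add: circle_def)
  note b = average_bound[OF Vpow(1)[OF g] eq_refl[OF Vpow(2)[OF g]] l2norm_nonneg this]
  show "ell2 (Bv N x g)" unfolding Bv_def by (rule b(1))
  show "l2norm (Bv N x g) \<le> l2norm g" unfolding Bv_def by (rule b(2))
qed

lemma ip_Bv:
  assumes f: "ell2 f" and g: "ell2 g" shows "ip (Bv N x g) f = ip g (Av N x f)"
proof -
  have "ip f (Bv N x g) = (\<Sum>n<N. (x ^ n / of_nat N) * ip f ((V ^^ n) g))"
    unfolding Bv_def by (subst ip_sum_right[OF f ell2_scale[OF Vpow(1)[OF g]]]) (simp only: ip_scale_right)
  then have "cnj (ip f (Bv N x g)) = (\<Sum>n<N. (cnj x ^ n / of_nat N) * cnj (ip f ((V ^^ n) g)))"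
    by simp
  then have "ip (Bv N x g) f = (\<Sum>n<N. (cnj x ^ n / of_nat N) * ip g ((U ^^ n) f))"
    unfolding ip_cnj by (simp only: ip_Vpow[OF g f])
  also have "\<dots> = ip g (Av N x f)"
    unfolding Av_def by (subst ip_sum_right[OF g ell2_scale[OF Upow(1)[OF f]]]) (simp only: ip_scale_right)
  finally show ?thesis .
qed

text \<open>U shifts the averaged powers by one, so the difference telescopes to two boundary terms
  of size 1 / N. A pointwise bound is enough for passing to a coordinatewise limit.\<close>

lemma Bv_almost_eigen:
  assumes g: "ell2 g" and x: "x \<in> circle" and N: "0 < N"
  shows "cmod (U (Bv N x g) \<mu> - x * Bv N x g \<mu>) \<le> 2 * l2norm g / real N"
proof -
  obtain M where M: "N = Suc M" using N by (cases N) auto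
  have UB: "U (Bv N x g) \<mu> = (\<Sum>n<N. (x ^ n / of_nat N) * U ((V ^^ n) g) \<mu>)"
    unfolding Bv_def by (simp only: CCop_sum CCop_scale)
  have "U (Bv N x g) \<mu> = (1 / of_nat N) * U g \<mu> + (\<Sum>n<M. (x ^ Suc n / of_nat N) * (V ^^ n) g \<mu>)"
    unfolding UB unfolding M by (subst sum.lessThan_Suc_shift) (simp add: U_V)
  moreover have "x * Bv N x g \<mu> = (\<Sum>n<M. (x ^ Suc n / of_nat N) * (V ^^ n) g \<mu>) + (x ^ N / of_nat N) * (V ^^ M) g \<mu>"
    unfolding Bv_def sum_distrib_left unfolding M by (simp add: mult_ac)
  ultimately have "U (Bv N x g) \<mu> - x * Bv N x g \<mu> = (1 / of_nat N) * U g \<mu> - (x ^ N / of_nat N) * (V ^^ M) g \<mu>"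
    by simp
  then have "cmod (U (Bv N x g) \<mu> - x * Bv N x g \<mu>) \<le> cmod ((1 / of_nat N) * U g \<mu>) + cmod ((x ^ N / of_nat N) * (V ^^ M) g \<mu>)"
    by (simp only: norm_triangle_ineq4)
  also have "\<dots> = (cmod (U g \<mu>) + cmod ((V ^^ M) g \<mu>)) / real N"
    using x by (simp add: norm_mult norm_divide norm_power circle_def add_divide_distrib)
  also have "\<dots> \<le> (l2norm g + l2norm g) / real N"
    using cmod_le_l2norm[OF ell2_U[OF g], of \<mu>] cmod_le_l2norm[OF Vpow(1)[OF g], of M \<mu>]
    by (intro divide_right_mono add_mono) (simp_all add: l2norm_U[OF g] Vpow(2)[OF g])
  finally show ?thesis by simp
qed

text \<open>Suppose averages of every length exceed \<open>e\<close> somewhere on the circle. A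
  subsequence of the almost eigenvectors \<open>Bv (Av f)\<close> then converges to an eigenvector v
  with |<v, f>| \<ge> e^2. The tolerance \<open>s\<close> is there because \<open>f\<close> will be
  only approximately orthogonal to the eigenvectors.\<close>

lemma uniform_mean_ergodic:
  assumes f: "ell2 f" and e: "0 < e" and s: "0 \<le> s" "s * l2norm f < e\<^sup>2"
    and eig: "\<And>v. eigvec U v \<Longrightarrow> cmod (ip v f) \<le> s * l2norm v"
  shows "\<exists>N>0. \<forall>x\<in>circle. l2norm (Av N x f) \<le> e"
proof (rule ccontr)
  assume neg: "\<not> ?thesis"
  have "\<forall>j. \<exists>x. x \<in> circle \<and> e < l2norm (Av (Suc j) x f)"
  proof (rule allI, rule ccontr)
    fix j assume "\<not> (\<exists>x. x \<in> circle \<and> e < l2norm (Av (Suc j) x f))"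
    then have "\<forall>x\<in>circle. l2norm (Av (Suc j) x f) \<le> e" by (auto simp: not_less)
    then have "\<exists>N>0. \<forall>x\<in>circle. l2norm (Av N x f) \<le> e" by (intro exI[of _ "Suc j"]) simp
    with neg show False by (rule notE)
  qed
  from choice[OF this] obtain x where x': "\<forall>j. x j \<in> circle \<and> e < l2norm (Av (Suc j) (x j) f)" ..
  then have x: "\<And>j. x j \<in> circle" "\<And>j. e < l2norm (Av (Suc j) (x j) f)" by auto
  define g where "g j = Av (Suc j) (x j) f" for j
  define u where "u j = Bv (Suc j) (x j) (g j)" for j
  have g: "ell2 (g j)" "l2norm (g j) \<le> l2norm f" for j unfolding g_def by (rule Av_bound[OF f x(1)])+
  have u: "ell2 (u j)" "l2norm (u j) \<le> l2norm f" for j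
    unfolding u_def using Bv_bound[OF g(1) x(1)] g(2) order_trans by blast+
  have uf: "ip (u j) f = complex_of_real ((l2norm (g j))\<^sup>2)" for j
    unfolding u_def ip_Bv[OF f g(1)] g_def[symmetric] by (rule ip_self[OF g(1)])
  \<comment> \<open>Spectral parameter (\<open>None\<close>) and coordinates
    (\<open>Some \<mu>\<close>) form one countable family, so that a single diagonal extraction
    suffices.\<close>
  define h where "h j i = (case i of None \<Rightarrow> x j | Some \<mu> \<Rightarrow> u j \<mu>)" for j and i :: "site option"
  have hb: "norm (h j i) \<le> max 1 (l2norm f)" for j i
  proof (cases i)
    case None
    then show ?thesis using x(1)[of j] by (simp add: h_def circle_def)
  next
    case (Some \<mu>)
    then show ?thesis using order_trans[OF cmod_le_l2norm[OF u(1)] u(2), of j \<mu>] by (simp add: h_def)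
  qed
  have "\<exists>k. strict_mono k \<and> (\<forall>i. \<exists>l. (\<lambda>n. h (k n) i) \<longlonglongrightarrow> l)"
  proof (rule function_convergent_subsequence[of UNIV h "max 1 (l2norm f)"])
    fix k :: "nat \<Rightarrow> nat"
    assume "strict_mono k" "\<And>i. i \<in> UNIV \<Longrightarrow> \<exists>l. (\<lambda>n. h (k n) i) \<longlonglongrightarrow> l"
    then show "\<exists>k. strict_mono k \<and> (\<forall>i. \<exists>l. (\<lambda>n. h (k n) i) \<longlonglongrightarrow> l)"
      by (intro exI[of _ k] conjI allI) simp_all
  qed (simp_all add: hb)
  then obtain k where k: "strict_mono k" "\<forall>i. \<exists>l. (\<lambda>n. h (k n) i) \<longlonglongrightarrow> l" by blast
  note k(2)
  from choice[OF this] obtain L where L: "\<forall>i. (\<lambda>n. h (k n) i) \<longlonglongrightarrow> L i" ..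
  define v where "v \<mu> = L (Some \<mu>)" for \<mu>
  have xl: "(\<lambda>n. x (k n)) \<longlonglongrightarrow> L None" using spec[OF L, of None] by (simp add: h_def)
  have ul: "(\<lambda>n. u (k n) \<mu>) \<longlonglongrightarrow> v \<mu>" for \<mu> using spec[OF L, of "Some \<mu>"] by (simp add: h_def v_def)
  note wl = weak_limit[of "\<lambda>n. u (k n)" "l2norm f" v, OF u(1) u(2) ul]
  have Uv: "U v = (\<lambda>\<mu>. L None * v \<mu>)"
  proof
    fix \<mu>
    have "(\<lambda>n. U (u (k n)) \<mu> - x (k n) * u (k n) \<mu>) \<longlonglongrightarrow> U v \<mu> - L None * v \<mu>"
      unfolding CCop_def Sop_def by (intro tendsto_intros xl ul)
    moreover have "(\<lambda>n. U (u (k n)) \<mu> - x (k n) * u (k n) \<mu>) \<longlonglongrightarrow> 0"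
    proof (rule Lim_null_comparison)
      have "cmod (U (u (k n)) \<mu> - x (k n) * u (k n) \<mu>) \<le> 2 * l2norm f * inverse (real (Suc (k n)))" for n
      proof -
        have "cmod (U (u (k n)) \<mu> - x (k n) * u (k n) \<mu>) \<le> 2 * l2norm (g (k n)) / real (Suc (k n))"
          unfolding u_def by (rule Bv_almost_eigen[OF g(1) x(1)]) simp
        also have "\<dots> \<le> 2 * l2norm f / real (Suc (k n))" using g(2) by (intro divide_right_mono mult_left_mono) auto
        finally show ?thesis by (simp add: divide_inverse)
      qed
      then show "\<forall>\<^sub>F n in sequentially. norm (U (u (k n)) \<mu> - x (k n) * u (k n) \<mu>) \<le> 2 * l2norm f * inverse (real (Suc (k n)))"
        by (simp add: always_eventually)
      have "(\<lambda>n. 2 * l2norm f * inverse (real (Suc (k n)))) \<longlonglongrightarrow> 2 * l2norm f * 0"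
        using LIMSEQ_subseq_LIMSEQ[OF LIMSEQ_inverse_real_of_nat k(1)] by (intro tendsto_intros) (simp add: o_def)
      then show "(\<lambda>n. 2 * l2norm f * inverse (real (Suc (k n)))) \<longlonglongrightarrow> 0" by simp
    qed
    ultimately have "U v \<mu> - L None * v \<mu> = 0" by (rule LIMSEQ_unique)
    then show "U v \<mu> = L None * v \<mu>" by simp
  qed
  have "e\<^sup>2 \<le> cmod (ip v f)"
  proof (rule LIMSEQ_le_const[OF tendsto_norm[OF wl(3)[OF f]]], intro exI allI impI)
    fix n
    have "e\<^sup>2 \<le> (l2norm (g (k n)))\<^sup>2" using x(2)[of "k n"] e by (intro power_mono) (auto simp: g_def)
    then show "e\<^sup>2 \<le> norm (ip (u (k n)) f)" unfolding uf norm_of_real by simp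
  qed
  moreover have "v \<noteq> (\<lambda>_. 0)"
  proof
    assume "v = (\<lambda>_. 0)"
    then have "ip v f = 0" by (simp add: ip_def)
    with \<open>e\<^sup>2 \<le> cmod (ip v f)\<close> e show False by simp
  qed
  then have "cmod (ip v f) \<le> s * l2norm v" using wl(1) Uv by (intro eig) (auto simp: eigvec_def)
  then have "cmod (ip v f) \<le> s * l2norm f" using mult_left_mono[OF wl(2) s(1)] by linarith
  ultimately show False using s(2) by linarith
qed

text \<open>Wiener's lemma: the mean of \<open>\<bar>c\<^sub>n\<bar>\<^sup>2\<close>, \<open>c\<^sub>n = (U\<^sup>n f) \<mu>\<close>, equals \<open>(p(U) f) \<mu>\<close> with \<open>p\<close> built from the
  conjugates of the \<open>c\<^sub>n\<close>, and on the circle \<open>\<bar>p(x)\<bar> = \<bar>Av N x f \<mu>\<bar>\<close>.\<close>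

lemma Wiener_bound:
  assumes f: "ell2 f" and e: "0 \<le> e" and le: "\<And>x. x \<in> circle \<Longrightarrow> l2norm (Av N x f) \<le> e"
  shows "(\<Sum>n<N. (cmod ((U ^^ n) f \<mu>))\<^sup>2) / real N \<le> e * l2norm f"
proof -
  define c where "c n = (U ^^ n) f \<mu>" for n
  have p: "cmod (\<Sum>k<N. (cnj (c k) / of_nat N) * x ^ k) \<le> e" if x: "x \<in> circle" for x
  proof -
    have "(\<Sum>k<N. (cnj (c k) / of_nat N) * x ^ k) = cnj (Av N x f \<mu>)"
      unfolding Av_def c_def by (simp add: mult_ac)
    then have "cmod (\<Sum>k<N. (cnj (c k) / of_nat N) * x ^ k) = cmod (Av N x f \<mu>)" by simp
    also have "\<dots> \<le> l2norm (Av N x f)" by (rule cmod_le_l2norm[OF Av_bound(1)[OF f x]])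
    finally show ?thesis using le[OF x] by linarith
  qed
  note vN = von_Neumann[OF f e p]
  have "complex_of_real ((\<Sum>n<N. (cmod (c n))\<^sup>2) / real N) = (\<Sum>k<N. (cnj (c k) / of_nat N) * (U ^^ k) f \<mu>)"
    unfolding c_def[symmetric] of_real_divide of_real_sum complex_norm_square sum_divide_distrib by (simp add: mult.commute)
  then have "cmod (complex_of_real ((\<Sum>n<N. (cmod (c n))\<^sup>2) / real N)) \<le> e * l2norm f"
    using cmod_le_l2norm[OF vN(1), of \<mu>] vN(2) by simp
  then have "\<bar>(\<Sum>n<N. (cmod (c n))\<^sup>2) / real N\<bar> \<le> e * l2norm f" unfolding norm_of_real .
  then show ?thesis unfolding c_def by linarith
qed

end

section \<open>Tight orbits and the completeness of eigenvectors\<close>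

text \<open>Cut \<open>f\<close> to finite support. The orbit of that part has the time-independent
  summable majorant of \<open>orbit_domination\<close>, and the small remainder stays small because
  U is isometric.\<close>

lemma orbit_tight:
  assumes good: "good \<phi> \<omega>" and sm: "\<And>\<nu>. (\<lambda>\<mu>. rcorr \<phi> \<omega> \<mu> \<nu>) summable_on UNIV"
    and f: "ell2 f" and e: "0 < e"
  obtains B where "finite B" "\<And>n. l2norm (off B ((CCop \<omega> \<phi> ^^ n) f)) \<le> e"
proof -
  have unit: "\<And>\<kappa>. cmod (\<omega> \<kappa>) = 1" using good unfolding good_def by blast
  have pw: "ell2 ((CCop \<omega> \<phi> ^^ n) h)" "l2norm ((CCop \<omega> \<phi> ^^ n) h) = l2norm h" if "ell2 h" for h n
    using that by (rule Upow[OF unit])+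
  have e2: "0 < e / 2" using e by simp
  obtain B0 where B0: "finite B0" "l2norm (off B0 f) \<le> e / 2" by (rule small_tail[OF f e2])
  define f0 where "f0 = (\<lambda>\<mu>. if \<mu> \<in> B0 then f \<mu> else 0)"
  have fin: "finite {\<mu>. f0 \<mu> \<noteq> 0}" by (rule finite_subset[OF _ B0(1)]) (auto simp: f0_def)
  have f0: "ell2 f0" by (rule ell2_finite_support[OF fin])
  have ff: "f = (\<lambda>\<mu>. f0 \<mu> + off B0 f \<mu>)" by (auto simp: f0_def off_def)
  let ?T = "{\<mu>. f0 \<mu> \<noteq> 0}"
  define k where "k \<mu> = (\<Sum>\<nu>\<in>?T. cmod (f0 \<nu>)) * (\<Sum>\<nu>\<in>?T. cmod (f0 \<nu>) * rcorr \<phi> \<omega> \<mu> \<nu>)" for \<mu>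
  have ks: "k summable_on UNIV"
    unfolding k_def by (intro summable_on_cmult_right summable_on_finite_sum sm)
  have k0: "0 \<le> k \<mu>" for \<mu> unfolding k_def by (intro mult_nonneg_nonneg sum_nonneg) auto
  have e22: "0 < (e / 2)\<^sup>2" using e by simp
  obtain B where B: "finite B" "\<And>B'. finite B' \<Longrightarrow> B' \<inter> B = {} \<Longrightarrow> sum k B' \<le> (e / 2)\<^sup>2"
    by (rule summable_tail[OF ks k0 e22]) (rule that)
  have "l2norm (off B ((CCop \<omega> \<phi> ^^ n) f)) \<le> e" for n
  proof -
    have dom: "(cmod ((CCop \<omega> \<phi> ^^ n) f0 \<mu>))\<^sup>2 \<le> k \<mu>" for \<mu>
      using orbit_domination[OF good fin, of "int n" \<mu>] by (simp add: CCpow_def k_def)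
    have 1: "l2norm (off B ((CCop \<omega> \<phi> ^^ n) f0)) \<le> e / 2"
      by (rule off_dominated[of _ k, OF dom B(2)]) (use e in auto)
    have "l2norm (off B ((CCop \<omega> \<phi> ^^ n) (off B0 f))) \<le> l2norm ((CCop \<omega> \<phi> ^^ n) (off B0 f))"
      by (rule off_le(2)[OF pw(1)[OF off_le(1)[OF f]]])
    also have "\<dots> = l2norm (off B0 f)" by (rule pw(2)[OF off_le(1)[OF f]])
    finally have 2: "l2norm (off B ((CCop \<omega> \<phi> ^^ n) (off B0 f))) \<le> e / 2" using B0(2) by linarith
    have "(CCop \<omega> \<phi> ^^ n) f = (\<lambda>\<mu>. (CCop \<omega> \<phi> ^^ n) f0 \<mu> + (CCop \<omega> \<phi> ^^ n) (off B0 f) \<mu>)"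
      by (subst ff) (rule Upow_add[OF unit])
    then have "l2norm (off B ((CCop \<omega> \<phi> ^^ n) f))
        = l2norm (\<lambda>\<mu>. off B ((CCop \<omega> \<phi> ^^ n) f0) \<mu> + off B ((CCop \<omega> \<phi> ^^ n) (off B0 f)) \<mu>)"
      by (simp only: off_add)
    also have "\<dots> \<le> l2norm (off B ((CCop \<omega> \<phi> ^^ n) f0)) + l2norm (off B ((CCop \<omega> \<phi> ^^ n) (off B0 f)))"
      by (rule l2norm_add[OF off_le(1)[OF pw(1)[OF f0]] off_le(1)[OF pw(1)[OF off_le(1)[OF f]]]])
    finally show ?thesis using 1 2 by linarith
  qed
  with B(1) show ?thesis by (rule that)
qed

text \<open>The algebraic span, with neither closure nor orthonormal basis: best approximations need
  not exist in it, and near-minimisers take their place.\<close>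

definition eigspan :: "(vec \<Rightarrow> vec) \<Rightarrow> vec \<Rightarrow> bool" where
  "eigspan T g \<longleftrightarrow> (\<exists>F c. finite F \<and> (\<forall>v\<in>F. eigvec T v) \<and> g = (\<lambda>\<mu>. \<Sum>v\<in>F. c v * v \<mu>))"

lemma eigspanI: "finite F \<Longrightarrow> \<forall>v\<in>F. eigvec T v \<Longrightarrow> g = (\<lambda>\<mu>. \<Sum>v\<in>F. c v * v \<mu>) \<Longrightarrow> eigspan T g"
  unfolding eigspan_def by (intro exI conjI)

lemma eigspan_ell2: "eigspan T g \<Longrightarrow> ell2 g"
proof -
  assume "eigspan T g"
  then obtain F c where F: "\<forall>v\<in>F. eigvec T v" "g = (\<lambda>\<mu>. \<Sum>v\<in>F. c v * v \<mu>)"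
    unfolding eigspan_def by blast
  have "ell2 (\<lambda>\<mu>. c v * v \<mu>)" if "v \<in> F" for v
    using F(1) that by (intro ell2_scale) (simp add: eigvec_def)
  then show ?thesis unfolding F(2) by (rule ell2_sum)
qed

lemma eigspan_zero: "eigspan T (\<lambda>_. 0)"
  unfolding eigspan_def by (intro exI[of _ "{}"]) simp

lemma eigspan_eigvec: "eigvec T v \<Longrightarrow> eigspan T v"
  unfolding eigspan_def by (intro exI[of _ "{v}"] exI[of _ "\<lambda>_. 1"]) simp

lemma eigspan_scale: assumes "eigspan T g" shows "eigspan T (\<lambda>\<mu>. a * g \<mu>)"
proof -
  obtain F c where F: "finite F" "\<forall>v\<in>F. eigvec T v" "g = (\<lambda>\<mu>. \<Sum>v\<in>F. c v * v \<mu>)"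
    using assms unfolding eigspan_def by blast
  have "(\<lambda>\<mu>. a * g \<mu>) = (\<lambda>\<mu>. \<Sum>v\<in>F. (a * c v) * v \<mu>)" unfolding F(3) by (simp add: sum_distrib_left mult.assoc)
  from eigspanI[OF F(1,2) this] show ?thesis .
qed

lemma eigspan_add: assumes "eigspan T g" "eigspan T h" shows "eigspan T (\<lambda>\<mu>. g \<mu> + h \<mu>)"
proof -
  obtain F c where F: "finite F" "\<forall>v\<in>F. eigvec T v" "g = (\<lambda>\<mu>. \<Sum>v\<in>F. c v * v \<mu>)"
    using assms(1) unfolding eigspan_def by blast
  obtain F' c' where F': "finite F'" "\<forall>v\<in>F'. eigvec T v" "h = (\<lambda>\<mu>. \<Sum>v\<in>F'. c' v * v \<mu>)"
    using assms(2) unfolding eigspan_def by blast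
  define d where "d v = (if v \<in> F then c v else 0) + (if v \<in> F' then c' v else 0)" for v
  have "g \<mu> + h \<mu> = (\<Sum>v\<in>F \<union> F'. d v * v \<mu>)" for \<mu>
  proof -
    have "g \<mu> = (\<Sum>v\<in>F \<union> F'. (if v \<in> F then c v else 0) * v \<mu>)"
      unfolding F(3) by (rule sum.mono_neutral_cong_left) (use F(1) F'(1) in auto)
    moreover have "h \<mu> = (\<Sum>v\<in>F \<union> F'. (if v \<in> F' then c' v else 0) * v \<mu>)"
      unfolding F'(3) by (rule sum.mono_neutral_cong_left) (use F(1) F'(1) in auto)
    ultimately show ?thesis by (simp add: d_def distrib_right sum.distrib)
  qed
  then have "(\<lambda>\<mu>. g \<mu> + h \<mu>) = (\<lambda>\<mu>. \<Sum>v\<in>F \<union> F'. d v * v \<mu>)" by (rule ext)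
  moreover have "finite (F \<union> F')" "\<forall>v\<in>F \<union> F'. eigvec T v" using F(1,2) F'(1,2) by auto
  ultimately show ?thesis by (intro eigspanI[of "F \<union> F'"])
qed

text \<open>If \<open>\<psi>\<close> had distance d > 0 from the span, a near-minimal residual would
  be nearly orthogonal to all eigenvectors, so its mean mass on any finite set would be small;
  tightness says the opposite. The set depends on the residual, and the admissible error on the set.
  The circle is broken by taking B for one residual \<open>f0\<close> and keeping it for a better
  one, which is close to \<open>f0\<close>.\<close>

lemma localized_imp_pure_point:
  assumes good: "good \<phi> \<omega>" and sm: "\<And>\<nu>. (\<lambda>\<mu>. rcorr \<phi> \<omega> \<mu> \<nu>) summable_on UNIV"
  shows "pure_point (CCop \<omega> \<phi>)"
proof -
  let ?U = "CCop \<omega> \<phi>"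
  have unit: "\<And>\<kappa>. cmod (\<omega> \<kappa>) = 1" using good unfolding good_def by blast
  have pw: "ell2 ((CCop \<omega> \<phi> ^^ n) h)" "l2norm ((CCop \<omega> \<phi> ^^ n) h) = l2norm h" if "ell2 h" for h n
    using that by (rule Upow[OF unit])+
  have "\<exists>g. eigspan ?U g \<and> l2norm (\<lambda>\<mu>. \<psi> \<mu> - g \<mu>) < \<epsilon>" if \<psi>: "ell2 \<psi>" and \<epsilon>: "0 < \<epsilon>" for \<psi> \<epsilon>
  proof (rule ccontr)
    assume neg: "\<not> ?thesis"
    define D where "D g = l2norm (\<lambda>\<mu>. \<psi> \<mu> - g \<mu>)" for g
    define d where "d = Inf (D ` {g. eigspan ?U g})"
    have ne: "D ` {g. eigspan ?U g} \<noteq> {}" using eigspan_zero[of ?U] by auto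
    have "bdd_below (D ` {g. eigspan ?U g})" by (rule bdd_belowI[of _ 0]) (auto simp: D_def)
    then have dle: "d \<le> D g" if "eigspan ?U g" for g
      unfolding d_def using that by (intro cInf_lower) auto
    have "\<epsilon> \<le> d" unfolding d_def
      by (rule cInf_greatest[OF ne]) (use neg in \<open>auto simp: D_def not_less\<close>)
    then have d: "0 < d" using \<epsilon> by linarith
    have near: "\<exists>g. eigspan ?U g \<and> (D g)\<^sup>2 \<le> d\<^sup>2 + \<delta>" if \<delta>: "0 < \<delta>" for \<delta>
    proof -
      have "d < sqrt (d\<^sup>2 + \<delta>)" using \<delta> d by (intro real_less_rsqrt) simp
      then obtain g where g: "eigspan ?U g" "D g < sqrt (d\<^sup>2 + \<delta>)"
        unfolding d_def using cInf_lessD[OF ne] by blast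
      have "(D g)\<^sup>2 \<le> (sqrt (d\<^sup>2 + \<delta>))\<^sup>2" using g(2) by (intro power_mono) (auto simp: D_def)
      then show ?thesis using g(1) \<delta> by (intro exI[of _ g]) simp
    qed
    have l2: "ell2 (\<lambda>\<mu>. \<psi> \<mu> - g \<mu>)" if "eigspan ?U g" for g
      by (rule ell2_diff[OF \<psi> eigspan_ell2[OF that]])
    have eig: "cmod (ip v (\<lambda>\<mu>. \<psi> \<mu> - g \<mu>)) \<le> sqrt \<delta> * l2norm v"
      if g: "eigspan ?U g" "(D g)\<^sup>2 \<le> d\<^sup>2 + \<delta>" and v: "eigvec ?U v" and \<delta>: "0 \<le> \<delta>" for g v \<delta>
    proof -
      let ?f = "\<lambda>\<mu>. \<psi> \<mu> - g \<mu>"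
      have v2: "ell2 v" using v by (simp add: eigvec_def)
      have "l2norm v \<noteq> 0" using l2norm_eq_0[OF v2] v by (auto simp: eigvec_def)
      then have nv: "0 < l2norm v" using l2norm_nonneg[of v] by linarith
      define q where "q = ip v ?f"
      \<comment> \<open>The coefficient of the projection of the residual onto v. Moving
        \<open>g\<close> by this multiple of v would lower the squared distance by |q|^2 / |v|^2, so
        near-minimality makes q small.\<close>
      define \<tau> where "\<tau> = q / complex_of_real ((l2norm v)\<^sup>2)"
      have "eigspan ?U (\<lambda>\<mu>. g \<mu> + \<tau> * v \<mu>)"
        by (intro eigspan_add eigspan_scale eigspan_eigvec g v)
      from dle[OF this] have "d\<^sup>2 \<le> (D (\<lambda>\<mu>. g \<mu> + \<tau> * v \<mu>))\<^sup>2" using d by (intro power_mono) auto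
      also have "D (\<lambda>\<mu>. g \<mu> + \<tau> * v \<mu>) = l2norm (\<lambda>\<mu>. ?f \<mu> + (- \<tau>) * v \<mu>)"
        unfolding D_def by (simp add: algebra_simps)
      also have "(l2norm (\<lambda>\<mu>. ?f \<mu> + (- \<tau>) * v \<mu>))\<^sup>2 = (D g)\<^sup>2 + 2 * Re ((- \<tau>) * ip ?f v) + (cmod (- \<tau>))\<^sup>2 * (l2norm v)\<^sup>2"
        unfolding D_def by (rule norm_ip_expand[OF l2[OF g(1)] v2])
      also have "ip ?f v = cnj q" unfolding q_def by (rule ip_cnj[symmetric])
      also have "(- \<tau>) * cnj q = complex_of_real (- ((cmod q)\<^sup>2 / (l2norm v)\<^sup>2))"
        unfolding \<tau>_def of_real_minus of_real_divide complex_norm_square by simp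
      also have "(cmod (- \<tau>))\<^sup>2 * (l2norm v)\<^sup>2 = (cmod q)\<^sup>2 / (l2norm v)\<^sup>2"
      proof -
        have "cmod (- \<tau>) = cmod q / (l2norm v)\<^sup>2" unfolding \<tau>_def norm_minus_cancel norm_divide norm_of_real by simp
        moreover have "(x / n\<^sup>2)\<^sup>2 * n\<^sup>2 = x\<^sup>2 / n\<^sup>2" if "0 < n" for x n :: real
          using that by (simp add: power_divide power2_eq_square)
        ultimately show ?thesis using nv by simp
      qed
      finally have "d\<^sup>2 \<le> (D g)\<^sup>2 - (cmod q)\<^sup>2 / (l2norm v)\<^sup>2" unfolding Re_complex_of_real by linarith
      then have "(cmod q)\<^sup>2 / (l2norm v)\<^sup>2 \<le> \<delta>" using g(2) by linarith
      then have "(cmod q)\<^sup>2 \<le> \<delta> * (l2norm v)\<^sup>2" using nv by (simp add: divide_le_eq)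
      also have "\<dots> = (sqrt \<delta> * l2norm v)\<^sup>2" using \<delta> by (simp add: power_mult_distrib)
      finally show ?thesis unfolding q_def by (rule power2_le_imp_le) (use \<delta> in simp)
    qed
    have close: "(l2norm (\<lambda>\<mu>. g \<mu> - h \<mu>))\<^sup>2 \<le> 4 * \<delta>"
      if g: "eigspan ?U g" "(D g)\<^sup>2 \<le> d\<^sup>2 + \<delta>" and h: "eigspan ?U h" "(D h)\<^sup>2 \<le> d\<^sup>2 + \<delta>" for g h \<delta>
    proof -
      \<comment> \<open>The midpoint of two near-minimisers also competes with d; the parallelogram
        law then forces them close together.\<close>
      have "eigspan ?U (\<lambda>\<mu>. (1 / 2) * (g \<mu> + h \<mu>))" by (intro eigspan_scale eigspan_add g h)
      from dle[OF this] have "d \<le> l2norm (\<lambda>\<mu>. \<psi> \<mu> - (1 / 2) * (g \<mu> + h \<mu>))" unfolding D_def .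
      moreover have "l2norm (\<lambda>\<mu>. (\<psi> \<mu> - h \<mu>) + (\<psi> \<mu> - g \<mu>)) = l2norm (\<lambda>\<mu>. 2 * (\<psi> \<mu> - (1 / 2) * (g \<mu> + h \<mu>)))"
        by (rule arg_cong[where f = l2norm], rule ext) (simp add: field_simps)
      then have "l2norm (\<lambda>\<mu>. (\<psi> \<mu> - h \<mu>) + (\<psi> \<mu> - g \<mu>)) = 2 * l2norm (\<lambda>\<mu>. \<psi> \<mu> - (1 / 2) * (g \<mu> + h \<mu>))"
        by (simp only: l2norm_scale) simp
      ultimately have "2 * d \<le> l2norm (\<lambda>\<mu>. (\<psi> \<mu> - h \<mu>) + (\<psi> \<mu> - g \<mu>))" by linarith
      then have "(2 * d)\<^sup>2 \<le> (l2norm (\<lambda>\<mu>. (\<psi> \<mu> - h \<mu>) + (\<psi> \<mu> - g \<mu>)))\<^sup>2" using d by (intro power_mono) auto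
      moreover have "(l2norm (\<lambda>\<mu>. (\<psi> \<mu> - h \<mu>) + (\<psi> \<mu> - g \<mu>)))\<^sup>2 + (l2norm (\<lambda>\<mu>. (\<psi> \<mu> - h \<mu>) - (\<psi> \<mu> - g \<mu>)))\<^sup>2
          = 2 * (D h)\<^sup>2 + 2 * (D g)\<^sup>2"
        unfolding D_def by (rule parallelogram[OF l2[OF h(1)] l2[OF g(1)]])
      moreover have "(\<lambda>\<mu>. (\<psi> \<mu> - h \<mu>) - (\<psi> \<mu> - g \<mu>)) = (\<lambda>\<mu>. g \<mu> - h \<mu>)" by simp
      ultimately show ?thesis using g(2) h(2) by (simp add: power_mult_distrib)
    qed
    \<comment> \<open>Chosen so that 4 times it is (d / 4)^2: two such near-minimisers differ by at
      most d / 4 in norm.\<close>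
    define \<delta>0 where "\<delta>0 = d\<^sup>2 / 64"
    have \<delta>0: "0 < \<delta>0" using d by (simp add: \<delta>0_def)
    obtain g0 where g0: "eigspan ?U g0" "(D g0)\<^sup>2 \<le> d\<^sup>2 + \<delta>0" using near[OF \<delta>0] by blast
    define f0 where "f0 = (\<lambda>\<mu>. \<psi> \<mu> - g0 \<mu>)"
    have f0: "ell2 f0" unfolding f0_def by (rule l2[OF g0(1)])
    have d4: "0 < d / 4" using d by simp
    obtain B where B: "finite B" "\<And>n. l2norm (off B ((?U ^^ n) f0)) \<le> d / 4"
      by (rule orbit_tight[OF good sm f0 d4]) (rule that)
    \<comment> \<open>Makes (card B + 1) * e * 2 d equal to 3 d^2 / 8, half of the lower bound
      proved for the mass on B; the \<open>+ 1\<close> covers an empty B.\<close>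
    define e where "e = 3 * d / (16 * (real (card B) + 1))"
    have e: "0 < e" unfolding e_def using d by (intro divide_pos_pos) auto
    \<comment> \<open>Small enough for \<open>sqrt \<delta>\<close> times the norm of
      \<open>f\<close>, which is at most 2 d, to be at most e^2 / 2, as the ergodic lemma
      requires.\<close>
    define \<delta> where "\<delta> = min \<delta>0 ((e\<^sup>2 / (4 * d))\<^sup>2)"
    have ed: "0 < e\<^sup>2 / (4 * d)" using e d by simp
    have \<delta>: "0 < \<delta>" "\<delta> \<le> \<delta>0" using \<delta>0 ed by (auto simp: \<delta>_def)
    have s\<delta>: "sqrt \<delta> \<le> e\<^sup>2 / (4 * d)"
      by (rule real_le_lsqrt) (use ed \<delta> in \<open>auto simp: \<delta>_def\<close>)
    obtain g where g: "eigspan ?U g" "(D g)\<^sup>2 \<le> d\<^sup>2 + \<delta>" using near[OF \<delta>(1)] by blast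
    define f where "f = (\<lambda>\<mu>. \<psi> \<mu> - g \<mu>)"
    have f: "ell2 f" unfolding f_def by (rule l2[OF g(1)])
    have fD: "l2norm f = D g" by (simp add: f_def D_def)
    have fd: "d \<le> l2norm f" unfolding fD by (rule dle[OF g(1)])
    have f2d: "l2norm f \<le> 2 * d"
    proof (rule power2_le_imp_le)
      show "(l2norm f)\<^sup>2 \<le> (2 * d)\<^sup>2" 
      proof -
        have "(2 * d)\<^sup>2 = 4 * d\<^sup>2" by (simp add: power_mult_distrib)
        then show ?thesis using g(2) \<delta>(2) zero_le_power2[of d] unfolding fD \<delta>0_def by linarith
      qed
    qed (use d in simp)
    have gg: "(D g)\<^sup>2 \<le> d\<^sup>2 + \<delta>0" using g(2) \<delta>(2) by linarith
    have tail: "l2norm (off B ((?U ^^ n) f)) \<le> d / 2" for n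
    proof -
      let ?h = "\<lambda>\<mu>. g0 \<mu> - g \<mu>"
      have h: "ell2 ?h" by (rule ell2_diff[OF eigspan_ell2[OF g0(1)] eigspan_ell2[OF g(1)]])
      have "(l2norm ?h)\<^sup>2 \<le> 4 * \<delta>0" by (rule close[OF g0 g(1) gg])
      also have "\<dots> = (d / 4)\<^sup>2" by (simp add: \<delta>0_def power_divide)
      finally have hn: "l2norm ?h \<le> d / 4" by (rule power2_le_imp_le) (use d in simp)
      have fh: "f = (\<lambda>\<mu>. f0 \<mu> + ?h \<mu>)" by (simp add: f_def f0_def)
      have "(?U ^^ n) f = (\<lambda>\<mu>. (?U ^^ n) f0 \<mu> + (?U ^^ n) ?h \<mu>)" unfolding fh by (rule Upow_add[OF unit])
      then have "l2norm (off B ((?U ^^ n) f)) = l2norm (\<lambda>\<mu>. off B ((?U ^^ n) f0) \<mu> + off B ((?U ^^ n) ?h) \<mu>)"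
        by (simp only: off_add)
      also have "\<dots> \<le> l2norm (off B ((?U ^^ n) f0)) + l2norm (off B ((?U ^^ n) ?h))"
        by (rule l2norm_add[OF off_le(1)[OF pw(1)[OF f0]] off_le(1)[OF pw(1)[OF h]]])
      also have "l2norm (off B ((?U ^^ n) ?h)) \<le> l2norm ((?U ^^ n) ?h)" by (rule off_le(2)[OF pw(1)[OF h]])
      also have "l2norm ((?U ^^ n) ?h) = l2norm ?h" by (rule pw(2)[OF h])
      finally show ?thesis using B(2)[of n] hn by linarith
    qed
    \<comment> \<open>The norm is conserved and at least d, while at most d / 2 of it lies outside
      B: 1 - 1/4 = 3/4.\<close>
    have lower: "3 * d\<^sup>2 / 4 \<le> (\<Sum>\<mu>\<in>B. (cmod ((?U ^^ n) f \<mu>))\<^sup>2)" for n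
    proof -
      have "d\<^sup>2 \<le> (l2norm ((?U ^^ n) f))\<^sup>2" unfolding pw(2)[OF f] using fd d by (intro power_mono) auto
      moreover have "(l2norm (off B ((?U ^^ n) f)))\<^sup>2 \<le> (d / 2)\<^sup>2" using tail by (intro power_mono) auto
      ultimately show ?thesis using l2norm_split[OF pw(1)[OF f] B(1), of n] by (simp add: power_divide)
    qed
    have "sqrt \<delta> * l2norm f \<le> e\<^sup>2 / (4 * d) * (2 * d)"
      using s\<delta> f2d ed by (intro mult_mono) auto
    also have "\<dots> = e\<^sup>2 / 2" using d by simp
    also have "\<dots> < e\<^sup>2" using e by simp
    finally have small: "sqrt \<delta> * l2norm f < e\<^sup>2" .
    have eig': "cmod (ip v f) \<le> sqrt \<delta> * l2norm v" if "eigvec ?U v" for v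
      unfolding f_def using \<delta>(1) by (intro eig[OF g that]) simp
    have "\<exists>N>0. \<forall>x\<in>circle. l2norm (Av \<omega> \<phi> N x f) \<le> e"
      by (rule uniform_mean_ergodic[OF unit f e _ small eig']) (use \<delta>(1) in simp_all)
    then obtain N where N: "0 < N" "\<And>x. x \<in> circle \<Longrightarrow> l2norm (Av \<omega> \<phi> N x f) \<le> e" by blast
    have W: "(\<Sum>n<N. (cmod ((?U ^^ n) f \<mu>))\<^sup>2) / real N \<le> e * l2norm f" for \<mu>
      by (rule Wiener_bound[OF unit f _ N(2)]) (use e in simp_all)
    have "3 * d\<^sup>2 / 4 = (\<Sum>n<N. 3 * d\<^sup>2 / 4) / real N" using N(1) by simp
    also have "\<dots> \<le> (\<Sum>n<N. \<Sum>\<mu>\<in>B. (cmod ((?U ^^ n) f \<mu>))\<^sup>2) / real N"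
      by (intro divide_right_mono sum_mono lower) simp
    also have "\<dots> = (\<Sum>\<mu>\<in>B. (\<Sum>n<N. (cmod ((?U ^^ n) f \<mu>))\<^sup>2) / real N)"
      by (subst sum.swap) (simp add: sum_divide_distrib)
    also have "\<dots> \<le> (\<Sum>\<mu>\<in>B. e * l2norm f)" by (rule sum_mono) (rule W)
    also have "\<dots> = real (card B) * (e * l2norm f)" by simp
    also have "\<dots> \<le> (real (card B) + 1) * (e * (2 * d))"
      using f2d e by (intro mult_mono) auto
    also have "\<dots> = 3 * d\<^sup>2 / 8"
    proof -
      have gen: "x * (3 * d / (16 * x) * (2 * d)) = 3 * d\<^sup>2 / 8" if "0 < x" for x :: real
        using that by (simp add: power2_eq_square)
      show ?thesis unfolding e_def by (rule gen) simp
    qed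
    finally have "3 * d\<^sup>2 / 4 \<le> 3 * d\<^sup>2 / 8" .
    moreover have "0 < d\<^sup>2" using d by simp
    ultimately show False by linarith
  qed
  note approx = this
  show ?thesis
    unfolding pure_point_def
  proof (intro allI impI)
    fix \<psi> and \<epsilon> :: real assume "ell2 \<psi>" "0 < \<epsilon>"
    from approx[OF this] obtain g where g: "eigspan ?U g" "l2norm (\<lambda>\<mu>. \<psi> \<mu> - g \<mu>) < \<epsilon>" by blast
    obtain F c where F: "finite F" "\<forall>v\<in>F. eigvec ?U v" "g = (\<lambda>\<mu>. \<Sum>v\<in>F. c v * v \<mu>)"
      using g(1) unfolding eigspan_def by blast
    show "\<exists>F c. finite F \<and> (\<forall>v\<in>F. eigvec ?U v) \<and> l2norm (\<lambda>\<mu>. \<psi> \<mu> - (\<Sum>v\<in>F. c v * v \<mu>)) < \<epsilon>"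
      using F(1,2) g(2)[unfolded F(3)] by (intro exI conjI)
  qed
qed

section \<open>The parameter window and the conclusion\<close>

text \<open>The product of sine and cosine is half the sine of the doubled angle, which vanishes at
  the multiples of pi / 2. The numbers leave room: the product is at most 1/5000, below 1/3136, the
  square of 1/56.\<close>

lemma near_half_pi_multiple:
  assumes dist: "infdist \<phi> (range (\<lambda>k::int. real_of_int k * (pi / 2))) \<le> 1 / 10000"
  shows "sqrt \<bar>cos \<phi>\<bar> * sqrt \<bar>sin \<phi>\<bar> \<le> 1 / 56"
proof -
  let ?A = "range (\<lambda>k::int. real_of_int k * (pi / 2))"
  \<comment> \<open>Doubling the radius produces a nearby lattice point without showing that the
    infimum is attained.\<close>
  have "\<exists>a\<in>?A. dist \<phi> a < 1 / 5000"
  proof (rule ccontr)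
    assume "\<not> ?thesis"
    then have far: "1 / 5000 \<le> dist \<phi> a" if "a \<in> ?A" for a using that by (meson not_less)
    have ne: "?A \<noteq> {}" by simp
    have "1 / 5000 \<le> infdist \<phi> ?A"
      unfolding infdist_notempty[OF ne] by (rule cINF_greatest[OF ne far])
    with dist show False by simp
  qed
  then obtain k :: int where k: "\<bar>\<phi> - real_of_int k * (pi / 2)\<bar> < 1 / 5000" by (auto simp: dist_real_def)
  have "\<bar>sin (2 * \<phi> - real_of_int k * pi)\<bar> = \<bar>sin (2 * \<phi>)\<bar>"
  proof -
    have s: "sin (real_of_int k * pi) = 0" using sin_zero_iff_int2 by blast
    then have "(cos (real_of_int k * pi))\<^sup>2 = 1" using sin_cos_squared_add[of "real_of_int k * pi"] by simp
    then have "\<bar>cos (real_of_int k * pi)\<bar> = 1" by (simp add: abs_square_eq_1)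
    then show ?thesis by (simp add: sin_diff s abs_mult)
  qed
  moreover have "\<bar>sin (2 * \<phi> - real_of_int k * pi)\<bar> \<le> \<bar>2 * \<phi> - real_of_int k * pi\<bar>" by (rule abs_sin_x_le_abs_x)
  moreover have "\<bar>2 * \<phi> - real_of_int k * pi\<bar> < 1 / 2500"
  proof -
    have "2 * \<phi> - real_of_int k * pi = 2 * (\<phi> - real_of_int k * (pi / 2))" by simp
    then have "\<bar>2 * \<phi> - real_of_int k * pi\<bar> = 2 * \<bar>\<phi> - real_of_int k * (pi / 2)\<bar>" by (simp only: abs_mult abs_numeral)
    with k show ?thesis by linarith
  qed
  ultimately have "\<bar>sin (2 * \<phi>)\<bar> < 1 / 2500" by linarith
  moreover have "\<bar>sin (2 * \<phi>)\<bar> = 2 * (\<bar>cos \<phi>\<bar> * \<bar>sin \<phi>\<bar>)" unfolding sin_double abs_mult by simp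
  ultimately have cs: "\<bar>cos \<phi>\<bar> * \<bar>sin \<phi>\<bar> \<le> 1 / 5000" by linarith
  have "sqrt \<bar>cos \<phi>\<bar> * sqrt \<bar>sin \<phi>\<bar> = sqrt (\<bar>cos \<phi>\<bar> * \<bar>sin \<phi>\<bar>)" by (simp only: real_sqrt_mult)
  also have "\<dots> \<le> 1 / 56" by (rule real_le_lsqrt) (use cs in \<open>auto simp: power2_eq_square\<close>)
  finally show ?thesis .
qed

theorem theorem1:
  "\<exists>\<phi>0>0. \<forall>\<phi>::real. infdist \<phi> (range (\<lambda>k::int. real_of_int k * (pi / 2))) \<le> \<phi>0 \<longrightarrow>
     (AE \<omega> in Pmeas. pure_point (CCop \<omega> \<phi>))
   \<and> (\<forall>p::real. p \<ge> 0 \<longrightarrow> (\<forall>\<psi>::vec. finite {\<mu>. \<psi> \<mu> \<noteq> 0} \<longrightarrow>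
        (AE \<omega> in Pmeas. \<exists>C::real. \<forall>n::int.
            (\<lambda>\<mu>. (xweight p \<mu> * cmod (CCpow \<omega> \<phi> n \<psi> \<mu>))^2) summable_on UNIV \<and>
            l2norm (\<lambda>\<mu>. complex_of_real (xweight p \<mu>) * CCpow \<omega> \<phi> n \<psi> \<mu>) \<le> C)))
   \<and> (\<exists>c g::real. c > 0 \<and> g > 0 \<and> (\<forall>\<mu> \<nu>::site.
        (\<integral>\<^sup>+ \<omega>. ennreal (Sup {cmod (fcalc_entry \<omega> \<phi> f \<mu> \<nu>) | f.
              continuous_on circle f \<and> (\<forall>z\<in>circle. cmod (f z) \<le> 1)}) \<partial>Pmeas)
        \<le> ennreal (c * exp (- g * znorm (\<mu> - \<nu>)))))"
proof (rule exI[of _ "1 / 10000"], intro conjI allI impI)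
  show "(0::real) < 1 / 10000" by simp
next
  fix \<phi> :: real
  assume dist: "infdist \<phi> (range (\<lambda>k::int. real_of_int k * (pi / 2))) \<le> 1 / 10000"
  note small = near_half_pi_multiple[OF this]
  show "AE \<omega> in Pmeas. pure_point (CCop \<omega> \<phi>)"
    using AE_good[OF small] AE_weighted_summable[OF small order_refl]
  proof eventually_elim
    case (elim \<omega>)
    \<comment> \<open>The weighted statement at p = 0, where the weight is 1 at every site.\<close>
    have "(\<lambda>\<mu>. rcorr \<phi> \<omega> \<mu> \<nu>) summable_on UNIV" for \<nu>
      using elim(2)[rule_format, of \<nu>] unfolding xweight_def by simp
    with elim(1) show ?case by (rule localized_imp_pure_point)
  qed
  show "AE \<omega> in Pmeas. \<exists>C::real. \<forall>n::int.
            (\<lambda>\<mu>. (xweight p \<mu> * cmod (CCpow \<omega> \<phi> n \<psi> \<mu>))^2) summable_on UNIV \<and>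
            l2norm (\<lambda>\<mu>. complex_of_real (xweight p \<mu>) * CCpow \<omega> \<phi> n \<psi> \<mu>) \<le> C"
    if "p \<ge> 0" and "finite {\<mu>. \<psi> \<mu> \<noteq> 0}" for p :: real and \<psi> :: vec
    using dynamical_localization[OF small] that by blast
  show "\<exists>c g::real. c > 0 \<and> g > 0 \<and> (\<forall>\<mu> \<nu>::site.
        (\<integral>\<^sup>+ \<omega>. ennreal (Sup {cmod (fcalc_entry \<omega> \<phi> f \<mu> \<nu>) | f.
              continuous_on circle f \<and> (\<forall>z\<in>circle. cmod (f z) \<le> 1)}) \<partial>Pmeas)
        \<le> ennreal (c * exp (- g * znorm (\<mu> - \<nu>))))"
    by (rule fcalc_localization[OF small])
qed

end
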